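(* Let $(S,g)$ be an asymptotically conical surface of non-negative scalar curvature with asymptotic angle $\alpha<\pi/2$, and let $\gamma:[0,+\infty)\to S$ be a properly embedded geodesic ray, asymptotic to the half-line $\vartheta=0$. For any fixed $0<\vartheta<\pi\sin\alpha$ one cannot find two diverging sequences of radii $\{\rho_k\}$ and $\{\rho'_k\}$ with $\rho'_k<\rho_k$ for all $k\ge1$, a sequence of solutions $\{\Gamma_k\}$ to the min-max Plateau problems with endpoints $p_k,q_k$ satisfying $$\rho(p_k)=\rho(q_k)=\rho_k,\qquad \vartheta(q_k)=\vartheta,\qquad \vartheta(p_k)=\vartheta-\pi\sin\alpha,$$ and functions $f_k:[\rho'_k/2,2\rho'_k]\to\mathbb{R}$ of class $C^1$ such that $\Gamma_k\supset\mathrm{graph}(f_k)$ and $$\sup_{\rho'_k/2\le\rho\le2\rho'_k}\left(|f_k(\rho)|+\rho'_k|f'_k(\rho)|\right)<\rho'_k k^{-1}\quad\text{for all }k\ge1.$$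
   Context: Surfaces are smooth, connected, without boundary. On $\mathbb{R}^2\setminus\{0\}$ use polar coordinates $(r,\varphi)\in(0,+\infty)\times S^1$. A complete non-compact Riemannian surface $(S,g)$ is asymptotically conical, with asymptotic angle $\alpha\in(0,\pi/2]$ and decay rate $\mu>0$, if there exist a compact $Z\subset S$ and a diffeomorphism $\Phi:S\setminus Z\to\mathbb{R}^2\setminus\{0\}$ (fixed, giving coordinates $(r,\varphi)$ on $S\setminus Z$) such that $$(\Phi^{-1})^*g=(1+e_{rr})\,dr\otimes dr+(1+e_{\varphi\varphi})\,r^2\sin^2(\alpha)\,d\varphi\otimes d\varphi+2e_{r\varphi}\,r\,dr\otimes d\varphi,$$ with $e_{rr},e_{\varphi\varphi},e_{r\varphi}=O_2(r^{-\mu})$ as $r\to+\infty$, i.e. $\partial^\beta e=O(r^{-\mu-|\beta|_r})$ for all multi-indices $0\le|\beta|\le2$, $|\beta|_r$ being the number of $r$-differentiations. Points of coordinates $(r_0,\varphi_0)$ and $(r_0,\varphi_0+\pi)$ are called antipodal. Wedge coordinates on $S\setminus Z$ are $\rho=r$, $\vartheta=\varphi\sin\alpha$, with $\vartheta$ taken modulo $2\pi\sin\alpha$; in them the cone metric $dr^2+r^2\sin^2(\alpha)d\varphi^2$ is the flat metric of a planar wedge of angle $2\pi\sin\alpha$ with sides identified. Set $x^1=\rho\cos\vartheta$, $x^2=\rho\sin\vartheta$ (near $\vartheta=0$); the (Cartesian) graph of $f:I\to\mathbb{R}$ is $\{x^2=f(x^1),\ x^1\in I\}$. A properly embedded geodesic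 ray $\gamma$ is asymptotic to the half-line $\vartheta=0$ if there are $\rho_0>0$, $C>0$ and $f\in C^2([\rho_0,+\infty);\mathbb{R})$ whose Cartesian graph coincides with $\gamma([0,+\infty))\cap\{\rho\ge\rho_0\}$ and such that $|f(\rho)|+\rho|f'(\rho)|\le C\rho^{1-\mu}$. Solutions to the min-max Plateau problems. Let $C_\alpha$ be $\mathbb{R}^2\setminus\{0\}$ with the metric $dr^2+r^2\sin^2(\alpha)d\varphi^2$, $\alpha<\pi/2$; let $\Gamma',\Gamma''$ be the two (and only two) smooth geodesic segments of $C_\alpha$ joining $(r,\varphi)=(1,0)$ and $(1,\pi)$. There are a constant $\overline r_0$ and, for all $r_0\ge\overline r_0$, $\varphi_0\in S^1$, two distinct simple geodesics $\Gamma_1^{(r_0,\varphi_0)},\Gamma_2^{(r_0,\varphi_0)}$ joining $p=(r_0,\varphi_0)$ to $q=(r_0,\varphi_0+\pi)$, disjoint except at the endpoints, contained in $S\setminus Z$, and whose images under $(r,\varphi)\mapsto(r/r_0,\varphi-\varphi_0)$ converge respectively to $\Gamma',\Gamma''$ (constant speed parametrizations on $[0,1]$ converging in $C^2$, uniformly in $\varphi_0$) as $r_0\to+\infty$. Such a family is fixed, and $\gamma_1,\gamma_2:[0,1]\to S$ are the constant speed parametrizations from $p$ to $q$. Let $X(r_0,\varphi_0)=\{\gamma\in W^{1,2}([0,1],S):\gamma(0)=p,\gamma(1)=q\}$, $\Sigma(r_0,\varphi_0)=\{H\in C([0,1],X(r_0,\varphi_0)):H(0)=\gamma_1,H(1)=\gamma_2\}$,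 $E(\gamma)=\int_0^1g(\dot\gamma,\dot\gamma)dt$ and $\Lambda(r_0,\varphi_0)=\inf_{H\in\Sigma(r_0,\varphi_0)}\max_{s\in[0,1]}E(H(s))$. A solution to the min-max Plateau problem with (antipodal) endpoints $p,q$ is the support of a simple geodesic joining $p$ to $q$ whose constant speed parametrization on $[0,1]$ has energy $E$ equal to $\Lambda(r_0,\varphi_0)$ and Morse index at most one as a critical point of $E$ on $X(r_0,\varphi_0)$. *)

theory Defs
  imports "HOL-Analysis.Analysis"
begin

definition pd :: "2 \<Rightarrow> (real^2 \<Rightarrow> 'b::real_normed_vector) \<Rightarrow> real^2 \<Rightarrow> 'b" where
  "pd i f = (\<lambda>x. frechet_derivative f (at x) (axis i 1))"

fun Ck_on :: "nat \<Rightarrow> (real^2) set \<Rightarrow> (real^2 \<Rightarrow> 'b::real_normed_vector) \<Rightarrow> bool" where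
  "Ck_on 0 U f \<longleftrightarrow> continuous_on U f"
| "Ck_on (Suc k) U f \<longleftrightarrow> (\<forall>x\<in>U. f differentiable (at x)) \<and> (\<forall>i. Ck_on k U (pd i f))"

definition smooth_on :: "(real^2) set \<Rightarrow> (real^2 \<Rightarrow> 'b::real_normed_vector) \<Rightarrow> bool" where
  "smooth_on U f \<longleftrightarrow> (\<forall>k. Ck_on k U f)"

definition bil :: "real^2^2 \<Rightarrow> real^2 \<Rightarrow> real^2 \<Rightarrow> real" where
  "bil A v w = v \<bullet> (A *v w)"

text \<open>A Riemannian surface is given by an atlas in which every chart carries the Gram matrix of
  the metric, as a function of the coordinates. The atlas need not be maximal.\<close>

record 'a rchart =
  cdom :: "'a set"
  coord :: "'a \<Rightarrow> real^2"
  gram :: "real^2 \<Rightarrow> real^2^2"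

definition cinv :: "'a rchart \<Rightarrow> real^2 \<Rightarrow> 'a" where
  "cinv c = the_inv_into (cdom c) (coord c)"

definition cimage :: "'a rchart \<Rightarrow> (real^2) set" where
  "cimage c = coord c ` cdom c"

definition transition :: "'a rchart \<Rightarrow> 'a rchart \<Rightarrow> real^2 \<Rightarrow> real^2" where
  "transition c d = coord d \<circ> cinv c"

definition carrier :: "'a rchart set \<Rightarrow> 'a set" where
  "carrier M = (\<Union>c\<in>M. cdom c)"

definition riemannian_chart :: "'a::topological_space rchart \<Rightarrow> bool" where
  "riemannian_chart c \<longleftrightarrow>
     open (cdom c) \<and> open (cimage c) \<and>
     homeomorphism (cdom c) (cimage c) (coord c) (cinv c) \<and>
     smooth_on (cimage c) (gram c) \<and>
     (\<forall>x\<in>cimage c. transpose (gram c x) = gram c x \<and> (\<forall>v. v \<noteq> 0 \<longrightarrow> bil (gram c x) v v > 0))"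

definition riemannian_atlas :: "'a::topological_space rchart set \<Rightarrow> bool" where
  "riemannian_atlas M \<longleftrightarrow>
     (\<forall>c\<in>M. riemannian_chart c) \<and>
     (\<forall>c\<in>M. \<forall>d\<in>M.
        smooth_on (coord c ` (cdom c \<inter> cdom d)) (transition c d) \<and>
        (\<forall>x\<in>coord c ` (cdom c \<inter> cdom d). \<forall>v w.
           bil (gram c x) v w =
           bil (gram d (transition c d x))
             (frechet_derivative (transition c d) (at x) v)
             (frechet_derivative (transition c d) (at x) w)))"

definition chart_at :: "'a rchart set \<Rightarrow> 'a \<Rightarrow> 'a rchart" where
  "chart_at M p = (SOME c. c \<in> M \<and> p \<in> cdom c)"

definition christoffel :: "(real^2 \<Rightarrow> real^2^2) \<Rightarrow> 2 \<Rightarrow> 2 \<Rightarrow> 2 \<Rightarrow> real^2 \<Rightarrow> real" where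
  "christoffel G k i j x =
     (\<Sum>l\<in>UNIV. matrix_inv (G x) $ k $ l *
        (pd i (\<lambda>y. G y $ j $ l) x + pd j (\<lambda>y. G y $ i $ l) x - pd l (\<lambda>y. G y $ i $ j) x)) / 2"

text \<open>\<open>riemann G l k i j\<close> is the \<open>l\<close>-th component of \<open>R(\<partial>\<^sub>i,\<partial>\<^sub>j)\<partial>\<^sub>k\<close>, with
  \<open>R(X,Y)Z = \<nabla>\<^sub>X\<nabla>\<^sub>Y Z - \<nabla>\<^sub>Y\<nabla>\<^sub>X Z - \<nabla>\<^bsub>[X,Y]\<^esub> Z\<close>.\<close>

definition riemann :: "(real^2 \<Rightarrow> real^2^2) \<Rightarrow> 2 \<Rightarrow> 2 \<Rightarrow> 2 \<Rightarrow> 2 \<Rightarrow> real^2 \<Rightarrow> real" where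
  "riemann G l k i j x =
     pd i (christoffel G l j k) x - pd j (christoffel G l i k) x +
     (\<Sum>m\<in>UNIV. christoffel G l i m x * christoffel G m j k x
             - christoffel G l j m x * christoffel G m i k x)"

definition ricci :: "(real^2 \<Rightarrow> real^2^2) \<Rightarrow> 2 \<Rightarrow> 2 \<Rightarrow> real^2 \<Rightarrow> real" where
  "ricci G j k x = (\<Sum>i\<in>UNIV. riemann G i k i j x)"

definition scalar_curvature :: "(real^2 \<Rightarrow> real^2^2) \<Rightarrow> real^2 \<Rightarrow> real" where
  "scalar_curvature G x = (\<Sum>j\<in>UNIV. \<Sum>k\<in>UNIV. matrix_inv (G x) $ j $ k * ricci G j k x)"

definition nonneg_scalar_curvature :: "'a rchart set \<Rightarrow> bool" where
  "nonneg_scalar_curvature M \<longleftrightarrow> (\<forall>c\<in>M. \<forall>x\<in>cimage c. scalar_curvature (gram c) x \<ge> 0)"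

definition vd :: "real set \<Rightarrow> (real \<Rightarrow> 'b::real_normed_vector) \<Rightarrow> real \<Rightarrow> 'b" where
  "vd I x = (\<lambda>t. vector_derivative x (at t within I))"

definition speed2 :: "'a rchart set \<Rightarrow> real set \<Rightarrow> (real \<Rightarrow> 'a) \<Rightarrow> real \<Rightarrow> real" where
  "speed2 M I \<gamma> t =
     (let c = chart_at M (\<gamma> t); v = vd I (coord c \<circ> \<gamma>) t in bil (gram c (coord c (\<gamma> t))) v v)"

definition C1_curve :: "'a::topological_space rchart set \<Rightarrow> (real \<Rightarrow> 'a) \<Rightarrow> bool" where
  "C1_curve M \<gamma> \<longleftrightarrow>
     continuous_on {0..1} \<gamma> \<and> \<gamma> ` {0..1} \<subseteq> carrier M \<and>
     (\<forall>c\<in>M. \<forall>t\<in>{0..1}. \<gamma> t \<in> cdom c \<longrightarrow>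
        (coord c \<circ> \<gamma>) differentiable (at t within {0..1}) \<and>
        continuous (at t within {0..1}) (vd {0..1} (coord c \<circ> \<gamma>)))"

definition curve_length :: "'a rchart set \<Rightarrow> (real \<Rightarrow> 'a) \<Rightarrow> real" where
  "curve_length M \<gamma> = integral {0..1} (\<lambda>t. sqrt (speed2 M {0..1} \<gamma> t))"

text \<open>Since \<open>C1_curve\<close> allows vanishing velocity, piecewise \<open>C\<^sup>1\<close> curves can be
  reparametrized to such curves, so the infimum below is the usual one. The value \<open>0\<close> off the
  carrier only serves the locale \<^locale>\<open>Metric_space\<close>, which constrains the distance everywhere.\<close>

definition rdist :: "'a::topological_space rchart set \<Rightarrow> 'a \<Rightarrow> 'a \<Rightarrow> real" where
  "rdist M p q =
     (if p \<in> carrier M \<and> q \<in> carrier M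
      then INF \<gamma>\<in>{\<gamma>. C1_curve M \<gamma> \<and> \<gamma> 0 = p \<and> \<gamma> 1 = q}. curve_length M \<gamma>
      else 0)"

definition complete_surface :: "'a::topological_space rchart set \<Rightarrow> bool" where
  "complete_surface M \<longleftrightarrow> Metric_space.mcomplete (carrier M) (rdist M)"

definition geodesic_on :: "'a::topological_space rchart set \<Rightarrow> real set \<Rightarrow> (real \<Rightarrow> 'a) \<Rightarrow> bool" where
  "geodesic_on M I \<gamma> \<longleftrightarrow>
     continuous_on I \<gamma> \<and> \<gamma> ` I \<subseteq> carrier M \<and>
     (\<forall>c\<in>M. \<forall>t\<in>I. \<gamma> t \<in> cdom c \<longrightarrow>
        (let x = coord c \<circ> \<gamma>; v = vd I x in
           x differentiable (at t within I) \<and>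
           (v has_vector_derivative
              (\<chi> k. - (\<Sum>i\<in>UNIV. \<Sum>j\<in>UNIV. christoffel (gram c) k i j (x t) * v t $ i * v t $ j)))
             (at t within I)))"

definition polar :: "real \<Rightarrow> real \<Rightarrow> real^2" where
  "polar r \<phi> = vector [r * cos \<phi>, r * sin \<phi>]"

text \<open>\<open>polar_gram G 1 1\<close>, \<open>polar_gram G 2 2\<close> and \<open>polar_gram G 1 2\<close> are the coefficients of the
  metric \<open>G\<close> on the punctured plane with respect to the polar frame \<open>\<partial>\<^sub>r, \<partial>\<^sub>\<phi>\<close>, as functions of
  \<open>u = (r, \<phi>)\<close>.\<close>

definition polar_frame :: "2 \<Rightarrow> real^2 \<Rightarrow> real^2" where
  "polar_frame i u =
     (if i = 1 then vector [cos (u $ 2), sin (u $ 2)]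
      else vector [- (u $ 1) * sin (u $ 2), u $ 1 * cos (u $ 2)])"

definition polar_gram :: "(real^2 \<Rightarrow> real^2^2) \<Rightarrow> 2 \<Rightarrow> 2 \<Rightarrow> real^2 \<Rightarrow> real" where
  "polar_gram G i j u = bil (G (polar (u $ 1) (u $ 2))) (polar_frame i u) (polar_frame j u)"

text \<open>\<open>O2 \<mu> e\<close>: the function \<open>e\<close> of \<open>(r, \<phi>)\<close> is \<open>O\<^sub>2(r\<^sup>-\<^sup>\<mu>)\<close>, uniformly in \<open>\<phi>\<close>.\<close>

definition O2 :: "real \<Rightarrow> (real^2 \<Rightarrow> real) \<Rightarrow> bool" where
  "O2 \<mu> e \<longleftrightarrow>
     (\<exists>C R. R > 0 \<and>
        (\<forall>a b u. a + b \<le> 2 \<longrightarrow> u $ 1 \<ge> R \<longrightarrow>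
           \<bar>(pd 1 ^^ a) ((pd 2 ^^ b) e) u\<bar> \<le> C * (u $ 1) powr (- \<mu> - real a)))"

text \<open>The compact set and the diffeomorphism at infinity are encoded by a chart \<open>\<Phi>\<close> compatible
  with \<open>M\<close>: its domain is the complement of the compact set, and its Gram matrix is the
  push-forward of the metric.\<close>

definition asymptotically_conical ::
  "'a::topological_space rchart set \<Rightarrow> 'a rchart \<Rightarrow> real \<Rightarrow> real \<Rightarrow> bool" where
  "asymptotically_conical M \<Phi> \<alpha> \<mu> \<longleftrightarrow>
     riemannian_atlas M \<and> connected (carrier M) \<and> \<not> compact (carrier M) \<and> complete_surface M \<and>
     0 < \<alpha> \<and> \<alpha> \<le> pi / 2 \<and> \<mu> > 0 \<and>
     riemannian_atlas (insert \<Phi> M) \<and> cdom \<Phi> \<subseteq> carrier M \<and> compact (carrier M - cdom \<Phi>) \<and>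
     cimage \<Phi> = - {0} \<and>
     O2 \<mu> (\<lambda>u. polar_gram (gram \<Phi>) 1 1 u - 1) \<and>
     O2 \<mu> (\<lambda>u. polar_gram (gram \<Phi>) 2 2 u / ((u $ 1)\<^sup>2 * (sin \<alpha>)\<^sup>2) - 1) \<and>
     O2 \<mu> (\<lambda>u. polar_gram (gram \<Phi>) 1 2 u / u $ 1)"

definition end_point :: "'a rchart \<Rightarrow> real \<Rightarrow> real \<Rightarrow> 'a" where
  "end_point \<Phi> r \<phi> = cinv \<Phi> (polar r \<phi>)"

text \<open>The sides \<open>\<theta> = \<plusminus> \<pi> sin \<alpha>\<close> of the wedge are the identified ones, so \<open>\<theta>\<close> and the Cartesian
  coordinates are single-valued on \<open>|\<theta>| < \<pi> sin \<alpha>\<close>.\<close>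

definition cartesian_graph ::
  "'a rchart \<Rightarrow> real \<Rightarrow> real set \<Rightarrow> (real \<Rightarrow> real) \<Rightarrow> 'a set" where
  "cartesian_graph \<Phi> \<alpha> I f =
     {y \<in> cdom \<Phi>. \<exists>\<rho> \<theta>. \<rho> > 0 \<and> \<bar>\<theta>\<bar> < pi * sin \<alpha> \<and> coord \<Phi> y = polar \<rho> (\<theta> / sin \<alpha>) \<and>
        \<rho> * cos \<theta> \<in> I \<and> \<rho> * sin \<theta> = f (\<rho> * cos \<theta>)}"

definition properly_embedded_geodesic_ray ::
  "'a::topological_space rchart set \<Rightarrow> (real \<Rightarrow> 'a) \<Rightarrow> bool" where
  "properly_embedded_geodesic_ray M \<gamma> \<longleftrightarrow>
     geodesic_on M {0..} \<gamma> \<and> inj_on \<gamma> {0..} \<and>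
     (\<forall>K. compact K \<and> K \<subseteq> carrier M \<longrightarrow> compact ({0..} \<inter> \<gamma> -` K))"

definition C1_real_on :: "real set \<Rightarrow> (real \<Rightarrow> real) \<Rightarrow> (real \<Rightarrow> real) \<Rightarrow> bool" where
  "C1_real_on I f f' \<longleftrightarrow>
     (\<forall>x\<in>I. (f has_real_derivative f' x) (at x within I)) \<and> continuous_on I f'"

definition asymptotic_to_half_line ::
  "'a rchart \<Rightarrow> real \<Rightarrow> real \<Rightarrow> (real \<Rightarrow> 'a) \<Rightarrow> bool" where
  "asymptotic_to_half_line \<Phi> \<alpha> \<mu> \<gamma> \<longleftrightarrow>
     (\<exists>\<rho>0 C f f' f''. \<rho>0 > 0 \<and> C > 0 \<and>
        C1_real_on {\<rho>0..} f f' \<and> C1_real_on {\<rho>0..} f' f'' \<and>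
        cartesian_graph \<Phi> \<alpha> {\<rho>0..} f = \<gamma> ` {0..} \<inter> {y \<in> cdom \<Phi>. norm (coord \<Phi> y) \<ge> \<rho>0} \<and>
        (\<forall>\<rho>\<ge>\<rho>0. \<bar>f \<rho>\<bar> + \<rho> * \<bar>f' \<rho>\<bar> \<le> C * \<rho> powr (1 - \<mu>)))"

text \<open>\<open>w\<close> is the weak derivative of \<open>x\<close>: the curve \<open>x\<close> is absolutely continuous with
  square-integrable derivative.\<close>

definition W12_on :: "real \<Rightarrow> real \<Rightarrow> (real \<Rightarrow> real^2) \<Rightarrow> bool" where
  "W12_on a b x \<longleftrightarrow>
     (\<exists>w. w absolutely_integrable_on {a..b} \<and> (\<lambda>t. (norm (w t))\<^sup>2) integrable_on {a..b} \<and>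
          (\<forall>s\<in>{a..b}. (w has_integral (x s - x a)) {a..s}))"

definition path_space :: "'a::topological_space rchart set \<Rightarrow> 'a \<Rightarrow> 'a \<Rightarrow> (real \<Rightarrow> 'a) set" where
  "path_space M p q =
     {\<gamma>. continuous_on {0..1} \<gamma> \<and> \<gamma> ` {0..1} \<subseteq> carrier M \<and> \<gamma> 0 = p \<and> \<gamma> 1 = q \<and>
         (\<forall>c\<in>M. \<forall>a b. 0 \<le> a \<and> a < b \<and> b \<le> 1 \<and> \<gamma> ` {a..b} \<subseteq> cdom c \<longrightarrow> W12_on a b (coord c \<circ> \<gamma>))}"

text \<open>The (strong) \<open>W\<^sup>1\<^sup>,\<^sup>2\<close> topology: a path is close to \<open>\<gamma>\<close> if it is \<open>W\<^sup>1\<^sup>,\<^sup>2\<close>-close to \<open>\<gamma>\<close> in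
  charts, over finitely many intervals that \<open>\<gamma>\<close> maps into chart domains.\<close>

definition W12_nbhd :: "'a::topological_space rchart set \<Rightarrow> 'a \<Rightarrow> 'a \<Rightarrow>
    (real \<Rightarrow> 'a) \<Rightarrow> 'a rchart \<Rightarrow> real \<Rightarrow> real \<Rightarrow> real \<Rightarrow> (real \<Rightarrow> 'a) set" where
  "W12_nbhd M p q \<gamma> c a b \<epsilon> =
     {\<eta> \<in> path_space M p q. \<eta> ` {a..b} \<subseteq> cdom c \<and>
        (let z = (\<lambda>t. coord c (\<eta> t) - coord c (\<gamma> t)) in
           integral {a..b} (\<lambda>t. (norm (z t))\<^sup>2 + (norm (vd {a..b} z t))\<^sup>2) < \<epsilon>\<^sup>2)}"

definition path_space_topology ::
  "'a::topological_space rchart set \<Rightarrow> 'a \<Rightarrow> 'a \<Rightarrow> (real \<Rightarrow> 'a) topology" where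
  "path_space_topology M p q =
     topology_generated_by
       {W12_nbhd M p q \<gamma> c a b \<epsilon> | \<gamma> c a b \<epsilon>.
          \<gamma> \<in> path_space M p q \<and> c \<in> M \<and> 0 \<le> a \<and> a < b \<and> b \<le> 1 \<and> \<gamma> ` {a..b} \<subseteq> cdom c \<and> \<epsilon> > 0}"

definition energy :: "'a rchart set \<Rightarrow> (real \<Rightarrow> 'a) \<Rightarrow> real" where
  "energy M \<gamma> = integral {0..1} (speed2 M {0..1} \<gamma>)"

text \<open>A tangent vector at \<open>p\<close> is the family of its components in the charts around \<open>p\<close>.\<close>

definition tangent_vector :: "'a rchart set \<Rightarrow> 'a \<Rightarrow> ('a rchart \<Rightarrow> real^2) \<Rightarrow> bool" where
  "tangent_vector M p v \<longleftrightarrow>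
     (\<forall>c\<in>M. \<forall>d\<in>M. p \<in> cdom c \<inter> cdom d \<longrightarrow>
        v d = frechet_derivative (transition c d) (at (coord c p)) (v c))"

text \<open>The tangent space at \<open>\<gamma>\<close> of the path space with fixed endpoints.\<close>

definition variation_fields ::
  "'a rchart set \<Rightarrow> (real \<Rightarrow> 'a) \<Rightarrow> (real \<Rightarrow> 'a rchart \<Rightarrow> real^2) set" where
  "variation_fields M \<gamma> =
     {V. (\<forall>t\<in>{0..1}. tangent_vector M (\<gamma> t) (V t)) \<and>
         (\<forall>c\<in>M. \<forall>t\<in>{0, 1}. \<gamma> t \<in> cdom c \<longrightarrow> V t c = 0) \<and>
         (\<forall>c\<in>M. \<forall>a b. 0 \<le> a \<and> a < b \<and> b \<le> 1 \<and> \<gamma> ` {a..b} \<subseteq> cdom c \<longrightarrow>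
            W12_on a b (\<lambda>t. V t c))}"

definition covariant_derivative ::
  "'a rchart \<Rightarrow> (real \<Rightarrow> 'a) \<Rightarrow> (real \<Rightarrow> real^2) \<Rightarrow> real \<Rightarrow> real^2" where
  "covariant_derivative c \<gamma> V t =
     (let x = coord c \<circ> \<gamma> in
        vd {0..1} V t +
        (\<chi> k. \<Sum>i\<in>UNIV. \<Sum>j\<in>UNIV. christoffel (gram c) k i j (x t) * vd {0..1} x t $ i * V t $ j))"

definition curvature_term :: "(real^2 \<Rightarrow> real^2^2) \<Rightarrow> real^2 \<Rightarrow> real^2 \<Rightarrow> real^2 \<Rightarrow> real" where
  "curvature_term G x V v =
     bil (G x) (\<chi> l. \<Sum>i\<in>UNIV. \<Sum>j\<in>UNIV. \<Sum>k\<in>UNIV. riemann G l k i j x * V $ i * v $ j * v $ k) V"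

text \<open>The second variation \<open>2 \<integral> |\<nabla>\<^sub>t V|\<^sup>2 - \<langle>R(V,\<gamma>')\<gamma>',V\<rangle> dt\<close> of the energy at the
  geodesic \<open>\<gamma>\<close>, that is, the Hessian of the energy on the path space.\<close>

definition second_variation ::
  "'a rchart set \<Rightarrow> (real \<Rightarrow> 'a) \<Rightarrow> (real \<Rightarrow> 'a rchart \<Rightarrow> real^2) \<Rightarrow> real" where
  "second_variation M \<gamma> V =
     2 * integral {0..1} (\<lambda>t.
       let c = chart_at M (\<gamma> t); x = coord c (\<gamma> t); v = vd {0..1} (coord c \<circ> \<gamma>) t;
           DV = covariant_derivative c \<gamma> (\<lambda>s. V s c) t
       in bil (gram c x) DV DV - curvature_term (gram c) x (V t c) v)"

text \<open>The supremum of the dimensions of subspaces on which the Hessian is negative definite; the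
  fields \<open>V 0, \<dots>, V (k - 1)\<close> form a basis of the subspace (negativity forces them to be linearly
  independent).\<close>

definition morse_index :: "'a rchart set \<Rightarrow> (real \<Rightarrow> 'a) \<Rightarrow> enat" where
  "morse_index M \<gamma> =
     Sup {enat k | k. \<exists>V :: nat \<Rightarrow> real \<Rightarrow> 'a rchart \<Rightarrow> real^2.
       (\<forall>i<k. V i \<in> variation_fields M \<gamma>) \<and>
       (\<forall>a :: nat \<Rightarrow> real. (\<exists>i<k. a i \<noteq> 0) \<longrightarrow>
          second_variation M \<gamma> (\<lambda>t c. \<Sum>i<k. a i *\<^sub>R V i t c) < 0)}"

text \<open>The metric \<open>dr\<^sup>2 + r\<^sup>2 sin\<^sup>2 \<alpha> d\<phi>\<^sup>2\<close> on the punctured plane in the coordinates of the plane,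
  where \<open>dr = (x\<^sub>1 dx\<^sub>1 + x\<^sub>2 dx\<^sub>2) / r\<close> and \<open>r d\<phi> = (- x\<^sub>2 dx\<^sub>1 + x\<^sub>1 dx\<^sub>2) / r\<close>.\<close>

definition cone_chart :: "real \<Rightarrow> (real^2) rchart" where
  "cone_chart \<alpha> =
     \<lparr>cdom = - {0}, coord = id,
      gram = (\<lambda>x. let y = vector [- (x $ 2), x $ 1] :: real^2 in
        (\<chi> i j. (x $ i * x $ j + (sin \<alpha>)\<^sup>2 * y $ i * y $ j) / (norm x)\<^sup>2))\<rparr>"

definition rotation :: "real \<Rightarrow> real^2 \<Rightarrow> real^2" where
  "rotation \<theta> x = vector [cos \<theta> * x $ 1 - sin \<theta> * x $ 2, sin \<theta> * x $ 1 + cos \<theta> * x $ 2]"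

text \<open>\<open>C\<^sup>2\<close> convergence to \<open>\<sigma>\<close>, uniform in \<open>\<phi>0\<close>, of the images of the curves \<open>\<gamma> r0 \<phi>0\<close> under
  \<open>(r, \<phi>) \<mapsto> (r / r0, \<phi> - \<phi>0)\<close> as \<open>r0\<close> tends to infinity.\<close>

definition rescaled_C2_limit ::
  "'a rchart \<Rightarrow> (real \<Rightarrow> real \<Rightarrow> real \<Rightarrow> 'a) \<Rightarrow> (real \<Rightarrow> real^2) \<Rightarrow> bool" where
  "rescaled_C2_limit \<Phi> \<gamma> \<sigma> \<longleftrightarrow>
     (\<forall>j\<le>2. uniform_limit (UNIV \<times> {0..1})
        (\<lambda>r0 (\<phi>0, t). (vd {0..1} ^^ j) (\<lambda>s. (1 / r0) *\<^sub>R rotation (- \<phi>0) (coord \<Phi> (\<gamma> r0 \<phi>0 s))) t)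
        (\<lambda>(\<phi>0, t). (vd {0..1} ^^ j) \<sigma> t) at_top)"

definition cone_geodesic_segment :: "real \<Rightarrow> (real \<Rightarrow> real^2) \<Rightarrow> bool" where
  "cone_geodesic_segment \<alpha> \<sigma> \<longleftrightarrow>
     geodesic_on {cone_chart \<alpha>} {0..1} \<sigma> \<and> \<sigma> 0 = polar 1 0 \<and> \<sigma> 1 = polar 1 pi"

text \<open>Angles in \<open>S\<^sup>1\<close> are represented by real numbers, whence the periodicity.\<close>

definition plateau_family ::
  "'a::topological_space rchart set \<Rightarrow> 'a rchart \<Rightarrow> real \<Rightarrow> real \<Rightarrow>
   (real \<Rightarrow> real \<Rightarrow> real \<Rightarrow> 'a) \<Rightarrow> (real \<Rightarrow> real \<Rightarrow> real \<Rightarrow> 'a) \<Rightarrow> bool" where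
  "plateau_family M \<Phi> \<alpha> rbar \<gamma>1 \<gamma>2 \<longleftrightarrow>
     rbar > 0 \<and>
     (\<forall>r0\<ge>rbar. \<forall>\<phi>0.
        (\<forall>\<gamma>\<in>{\<gamma>1, \<gamma>2}.
           (\<forall>t\<in>{0..1}. \<gamma> r0 (\<phi>0 + 2 * pi) t = \<gamma> r0 \<phi>0 t) \<and>
           geodesic_on M {0..1} (\<gamma> r0 \<phi>0) \<and> inj_on (\<gamma> r0 \<phi>0) {0..1} \<and>
           \<gamma> r0 \<phi>0 ` {0..1} \<subseteq> cdom \<Phi> \<and>
           \<gamma> r0 \<phi>0 0 = end_point \<Phi> r0 \<phi>0 \<and> \<gamma> r0 \<phi>0 1 = end_point \<Phi> r0 (\<phi>0 + pi)) \<and>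
        \<gamma>1 r0 \<phi>0 ` {0..1} \<inter> \<gamma>2 r0 \<phi>0 ` {0..1} =
          {end_point \<Phi> r0 \<phi>0, end_point \<Phi> r0 (\<phi>0 + pi)}) \<and>
     (\<exists>\<sigma>1 \<sigma>2. cone_geodesic_segment \<alpha> \<sigma>1 \<and> cone_geodesic_segment \<alpha> \<sigma>2 \<and>
        \<sigma>1 ` {0..1} \<noteq> \<sigma>2 ` {0..1} \<and>
        rescaled_C2_limit \<Phi> \<gamma>1 \<sigma>1 \<and> rescaled_C2_limit \<Phi> \<gamma>2 \<sigma>2)"

definition sweepouts ::
  "'a::topological_space rchart set \<Rightarrow> (real \<Rightarrow> 'a) \<Rightarrow> (real \<Rightarrow> 'a) \<Rightarrow> (real \<Rightarrow> real \<Rightarrow> 'a) set" where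
  "sweepouts M \<gamma>1 \<gamma>2 =
     {H. continuous_map (top_of_set {0..1}) (path_space_topology M (\<gamma>1 0) (\<gamma>1 1)) H \<and>
         H 0 = \<gamma>1 \<and> H 1 = \<gamma>2}"

definition minmax_level ::
  "'a::topological_space rchart set \<Rightarrow> (real \<Rightarrow> 'a) \<Rightarrow> (real \<Rightarrow> 'a) \<Rightarrow> ereal" where
  "minmax_level M \<gamma>1 \<gamma>2 = (INF H\<in>sweepouts M \<gamma>1 \<gamma>2. SUP s\<in>{0..1}. ereal (energy M (H s)))"

text \<open>Solutions with endpoints of polar coordinates \<open>(r0, \<phi>0)\<close> and \<open>(r0, \<phi>0 + \<pi>)\<close>.\<close>

definition minmax_plateau_solution ::
  "'a::topological_space rchart set \<Rightarrow> 'a rchart \<Rightarrow> real \<Rightarrow>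
   (real \<Rightarrow> real \<Rightarrow> real \<Rightarrow> 'a) \<Rightarrow> (real \<Rightarrow> real \<Rightarrow> real \<Rightarrow> 'a) \<Rightarrow> real \<Rightarrow> real \<Rightarrow> 'a set \<Rightarrow> bool" where
  "minmax_plateau_solution M \<Phi> rbar \<gamma>1 \<gamma>2 r0 \<phi>0 \<Gamma> \<longleftrightarrow>
     r0 \<ge> rbar \<and>
     (\<exists>\<gamma>. geodesic_on M {0..1} \<gamma> \<and> inj_on \<gamma> {0..1} \<and> \<Gamma> = \<gamma> ` {0..1} \<and>
        \<gamma> 0 = end_point \<Phi> r0 \<phi>0 \<and> \<gamma> 1 = end_point \<Phi> r0 (\<phi>0 + pi) \<and>
        ereal (energy M \<gamma>) = minmax_level M (\<gamma>1 r0 \<phi>0) (\<gamma>2 r0 \<phi>0) \<and>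
        morse_index M \<gamma> \<le> 1)"

end

theory Submission
  imports Defs
begin

text \<open>
  In the wedge coordinates the metric of the end differs from the flat one by \<open>O(r\<^sup>-\<^sup>\<mu>)\<close>, and its
  first derivatives by \<open>O(r\<^sup>-\<^sup>\<mu>\<^sup>-\<^sup>1)\<close>. The curvature of a geodesic that runs outward from
  radius \<open>r\<^sub>0\<close>, measured in the flat metric, is then integrable along the geodesic, with integral
  \<open>O(r\<^sub>0\<^sup>-\<^sup>\<mu>)\<close>. A geodesic that leaves a point of large radius in a nearly radial direction
  therefore keeps running outward, nearly radially and almost at constant polar angle, for as long as
  it exists. This contradicts the configuration of the statement. At the scale \<open>\<rho>'\<^sub>k\<close> the solution
  \<open>\<Gamma>\<^sub>k\<close> contains a graph that is \<open>C\<^sup>1\<close>-close to the half-line \<open>\<theta> = 0\<close>; follow it outward from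
  there, in whichever direction of time increases the radius. It stays at polar angles
  close to \<open>0\<close> until it ends, whereas its two endpoints have the fixed polar angles
  \<open>\<psi> = \<theta> / sin \<alpha> \<in> (0, \<pi>)\<close> and \<open>\<psi> - \<pi> \<in> (-\<pi>, 0)\<close>.

  The quantitative form of this argument rests on the angular momentum \<open>A = g(\<gamma>', \<partial>\<^sub>\<phi>)\<close>. Since
  \<open>A' = (\<partial>\<^sub>\<phi> g)(\<gamma>', \<gamma>') / 2 = O(r\<^sup>-\<^sup>\<mu>) |\<gamma>'|\<^sup>2\<close>, while the speed \<open>L = |\<gamma>'|\<close> is constant and
  comparable to \<open>r'\<close> in nearly radial motion, \<open>A\<close> grows at most like \<open>L r\<^sup>1\<^sup>-\<^sup>\<mu>\<close>. As \<open>A\<close> is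
  essentially \<open>sin\<^sup>2 \<alpha> r\<^sup>2 \<phi>'\<close>, the slope \<open>r \<phi>' / r'\<close> decays like \<open>(r\<^sub>0 / r)\<^sup>\<mu>\<close>, and the total
  variation \<open>\<integral> |\<phi>'| dt\<close> of the angle is small: this is \<open>near_radial_estimate\<close>. The lemma
  \<open>near_radial_geodesic_stays_in_sector\<close> turns it into an unconditional statement by a continuity
  argument, and \<open>graph_tangent_point\<close> provides the starting point on \<open>\<Gamma>\<^sub>k\<close>.

  Geodesics are defined by Christoffel symbols in the charts of the atlas, whereas the estimate takes
  place in polar coordinates of the end. The passage from one to the other uses the covariant form
  \<open>d/dt g(\<gamma>', \<eta>) = (\<partial>\<^sub>\<eta> g)(\<gamma>', \<gamma>') / 2\<close> of the geodesic equation, which pulls back under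
  maps of class \<open>C\<^sup>2\<close> (\<open>euler_lagrange_pullback\<close>).
\<close>

section \<open>Symmetry of second derivatives\<close>

text \<open>Applying the mean value theorem in the direction \<open>\<xi>\<close> turns the second difference quotient,
  which is symmetric in \<open>\<xi>\<close> and \<open>\<eta>\<close>, into an increment of the directional derivative
  \<open>f' z \<xi>\<close>; differentiability of the latter at the single point \<open>u\<close> is enough to pass to the limit.\<close>

lemma second_difference_limit:
  fixes f :: "'a::real_normed_vector \<Rightarrow> real"
  assumes "open U" "u \<in> U"
    and f: "\<And>z. z \<in> U \<Longrightarrow> (f has_derivative f' z) (at z)"
    and A: "((\<lambda>z. f' z \<xi>) has_derivative A) (at u)"
  shows "((\<lambda>t. (f (u + t *\<^sub>R \<xi> + t *\<^sub>R \<eta>) - f (u + t *\<^sub>R \<xi>) - f (u + t *\<^sub>R \<eta>) + f u) / t\<^sup>2)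
           \<longlongrightarrow> A \<eta>) (at_right 0)"
proof (rule tendstoI)
  fix e :: real assume "e > 0"
  define N where "N = norm \<xi> + norm \<eta> + 1"
  have N: "N > 0" by (simp add: N_def add_nonneg_pos)
  define e' where "e' = e / (3 * N)"
  have e': "e' > 0" using \<open>e > 0\<close> N by (simp add: e'_def)
  have linA: "linear A" using A by (rule has_derivative_linear)
  obtain d where d: "d > 0"
      "\<And>y. norm (y - u) < d \<Longrightarrow> \<bar>f' y \<xi> - f' u \<xi> - A (y - u)\<bar> \<le> e' * norm (y - u)"
    using A e' unfolding has_derivative_at_alt by (metis real_norm_def)
  obtain d' where d': "d' > 0" "ball u d' \<subseteq> U"
    using \<open>open U\<close> \<open>u \<in> U\<close> openE by blast
  define \<delta> where "\<delta> = min d d' / N"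
  have "\<delta> > 0" using d d' N by (simp add: \<delta>_def)
  have main: "\<bar>(f (u + t *\<^sub>R \<xi> + t *\<^sub>R \<eta>) - f (u + t *\<^sub>R \<xi>) - f (u + t *\<^sub>R \<eta>) + f u) / t\<^sup>2 - A \<eta>\<bar> < e"
    if t: "0 < t" "t < \<delta>" for t
  proof -
    have tN: "t * N < min d d'" using t N by (simp add: \<delta>_def pos_less_divide_eq)
    have near: "norm (s *\<^sub>R \<xi> + b *\<^sub>R \<eta>) \<le> t * N" if "0 \<le> s" "s \<le> t" "0 \<le> b" "b \<le> t" for s b
    proof -
      have "norm (s *\<^sub>R \<xi> + b *\<^sub>R \<eta>) \<le> s * norm \<xi> + b * norm \<eta>"
        using norm_triangle_ineq[of "s *\<^sub>R \<xi>" "b *\<^sub>R \<eta>"] that by simp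
      also have "\<dots> \<le> t * norm \<xi> + t * norm \<eta>"
        using that by (intro add_mono mult_right_mono) auto
      also have "\<dots> \<le> t * N" using t by (simp add: N_def algebra_simps)
      finally show ?thesis .
    qed
    have inU: "u + s *\<^sub>R \<xi> + b *\<^sub>R \<eta> \<in> U" if "0 \<le> s" "s \<le> t" "0 \<le> b" "b \<le> t" for s b
    proof -
      have "dist u (u + s *\<^sub>R \<xi> + b *\<^sub>R \<eta>) = norm (s *\<^sub>R \<xi> + b *\<^sub>R \<eta>)"
        by (subst dist_commute) (simp add: dist_norm add.assoc)
      then show ?thesis using near[OF that] tN d'(2) by (auto simp: subset_iff)
    qed
    define g where "g = (\<lambda>s. f (u + s *\<^sub>R \<xi> + t *\<^sub>R \<eta>) - f (u + s *\<^sub>R \<xi>))"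
    have dg: "(g has_real_derivative (f' (u + s *\<^sub>R \<xi> + t *\<^sub>R \<eta>) \<xi> - f' (u + s *\<^sub>R \<xi>) \<xi>)) (at s)"
      if "0 \<le> s" "s \<le> t" for s
    proof -
      have 1: "(f has_derivative f' (u + s *\<^sub>R \<xi> + t *\<^sub>R \<eta>)) (at (u + s *\<^sub>R \<xi> + t *\<^sub>R \<eta>))"
        using f inU[of s t] that t by simp
      have 2: "(f has_derivative f' (u + s *\<^sub>R \<xi>)) (at (u + s *\<^sub>R \<xi>))"
        using f inU[of s 0] that t by simp
      have 3: "((\<lambda>s. f (u + s *\<^sub>R \<xi> + t *\<^sub>R \<eta>)) has_derivative (\<lambda>h. f' (u + s *\<^sub>R \<xi> + t *\<^sub>R \<eta>) (h *\<^sub>R \<xi>))) (at s)"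
        by (rule has_derivative_compose[where f = "\<lambda>s. u + s *\<^sub>R \<xi> + t *\<^sub>R \<eta>" and g = f, OF _ 1]) (auto intro!: derivative_eq_intros)
      have 4: "((\<lambda>s. f (u + s *\<^sub>R \<xi>)) has_derivative (\<lambda>h. f' (u + s *\<^sub>R \<xi>) (h *\<^sub>R \<xi>))) (at s)"
        by (rule has_derivative_compose[where f = "\<lambda>s. u + s *\<^sub>R \<xi>" and g = f, OF _ 2]) (auto intro!: derivative_eq_intros)
      have l1: "linear (f' (u + s *\<^sub>R \<xi> + t *\<^sub>R \<eta>))" "linear (f' (u + s *\<^sub>R \<xi>))"
        using 1 2 has_derivative_linear by auto
      show ?thesis unfolding g_def has_field_derivative_def
        by (rule has_derivative_eq_rhs[OF has_derivative_diff[OF 3 4]])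
           (simp add: linear_cmul[OF l1(1)] linear_cmul[OF l1(2)] fun_eq_iff right_diff_distrib mult.commute)
    qed
    obtain s where s: "0 < s" "s < t"
      "g t - g 0 = (t - 0) * (f' (u + s *\<^sub>R \<xi> + t *\<^sub>R \<eta>) \<xi> - f' (u + s *\<^sub>R \<xi>) \<xi>)"
      using MVT2[OF t(1) dg] by blast
    have near_u: "\<bar>f' (u + z) \<xi> - f' u \<xi> - A z\<bar> \<le> e' * (t * N)" if "norm z \<le> t * N" for z
    proof -
      have "\<bar>f' (u + z) \<xi> - f' u \<xi> - A z\<bar> \<le> e' * norm z"
        using d(2)[of "u + z"] that tN by simp
      also have "\<dots> \<le> e' * (t * N)" using that e' by (intro mult_left_mono) auto
      finally show ?thesis .
    qed
    have a1: "\<bar>f' (u + s *\<^sub>R \<xi> + t *\<^sub>R \<eta>) \<xi> - f' u \<xi> - A (s *\<^sub>R \<xi> + t *\<^sub>R \<eta>)\<bar> \<le> e' * (t * N)"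
      using near_u[OF near[of s t]] s by (simp add: add.assoc)
    have a2: "\<bar>f' (u + s *\<^sub>R \<xi>) \<xi> - f' u \<xi> - A (s *\<^sub>R \<xi>)\<bar> \<le> e' * (t * N)"
      using near_u[OF near[of s 0]] s by simp
    have A3: "A (s *\<^sub>R \<xi> + t *\<^sub>R \<eta>) - A (s *\<^sub>R \<xi>) = t * A \<eta>"
      by (simp add: linear_add[OF linA] linear_cmul[OF linA])
    have "\<bar>(f' (u + s *\<^sub>R \<xi> + t *\<^sub>R \<eta>) \<xi> - f' (u + s *\<^sub>R \<xi>) \<xi>) - t * A \<eta>\<bar> \<le> 2 * (e' * (t * N))"
      using a1 a2 unfolding A3[symmetric] by linarith
    moreover have "(g t - g 0) / t\<^sup>2 - A \<eta> = ((f' (u + s *\<^sub>R \<xi> + t *\<^sub>R \<eta>) \<xi> - f' (u + s *\<^sub>R \<xi>) \<xi>) - t * A \<eta>) / t"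
    proof -
      have "(t - 0) * X / t\<^sup>2 - c = (X - t * c) / t" for X c :: real
        using t by (simp add: field_simps power2_eq_square)
      then show ?thesis unfolding s(3) .
    qed
    ultimately have "\<bar>(g t - g 0) / t\<^sup>2 - A \<eta>\<bar> \<le> 2 * e' * N"
      using t by (simp add: abs_divide pos_divide_le_eq mult_ac)
    also have "\<dots> < e" using t N \<open>e > 0\<close> by (simp add: e'_def)
    finally show ?thesis by (simp add: g_def algebra_simps)
  qed
  show "\<forall>\<^sub>F t in at_right 0. dist ((f (u + t *\<^sub>R \<xi> + t *\<^sub>R \<eta>) - f (u + t *\<^sub>R \<xi>) - f (u + t *\<^sub>R \<eta>) + f u) / t\<^sup>2) (A \<eta>) < e"
    unfolding eventually_at_right_field dist_real_def using \<open>\<delta> > 0\<close> main by blast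
qed

lemma second_derivative_symmetric:
  fixes f :: "'a::real_normed_vector \<Rightarrow> 'b::euclidean_space"
  assumes "open U" "u \<in> U"
    and f: "\<And>z. z \<in> U \<Longrightarrow> (f has_derivative f' z) (at z)"
    and A: "((\<lambda>z. f' z \<xi>) has_derivative A) (at u)"
    and B: "((\<lambda>z. f' z \<eta>) has_derivative B) (at u)"
  shows "A \<eta> = B \<xi>"
proof (rule euclidean_eqI)
  fix b :: 'b assume "b \<in> Basis"
  have f_b: "((\<lambda>z. f z \<bullet> b) has_derivative (\<lambda>h. f' z h \<bullet> b)) (at z)" if "z \<in> U" for z
    using f[OF that] by (intro derivative_eq_intros) auto
  have A_b: "((\<lambda>z. f' z \<xi> \<bullet> b) has_derivative (\<lambda>h. A h \<bullet> b)) (at u)"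
    using A by (intro derivative_eq_intros) auto
  have B_b: "((\<lambda>z. f' z \<eta> \<bullet> b) has_derivative (\<lambda>h. B h \<bullet> b)) (at u)"
    using B by (intro derivative_eq_intros) auto
  note l1 = second_difference_limit[OF assms(1,2) f_b A_b, of \<eta>]
  note l2 = second_difference_limit[OF assms(1,2) f_b B_b, of \<xi>]
  have "(\<lambda>t. (f (u + t *\<^sub>R \<eta> + t *\<^sub>R \<xi>) \<bullet> b - f (u + t *\<^sub>R \<eta>) \<bullet> b - f (u + t *\<^sub>R \<xi>) \<bullet> b + f u \<bullet> b) / t\<^sup>2)
     = (\<lambda>t. (f (u + t *\<^sub>R \<xi> + t *\<^sub>R \<eta>) \<bullet> b - f (u + t *\<^sub>R \<xi>) \<bullet> b - f (u + t *\<^sub>R \<eta>) \<bullet> b + f u \<bullet> b) / t\<^sup>2)"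
    by (auto simp: algebra_simps)
  then show "A \<eta> \<bullet> b = B \<xi> \<bullet> b"
    using tendsto_unique[OF trivial_limit_at_right_real l1] l2 by simp
qed

section \<open>The geodesic equation in covariant form\<close>

text \<open>The Euler--Lagrange equation of the Lagrangian \<open>g x v v / 2\<close>, where \<open>v\<close> stands for the velocity of
  \<open>x\<close>. Only the momentum \<open>g x v\<close> is differentiated along the curve, and its components are tested
  against constant vectors \<open>\<eta>\<close>; this makes the equation transform like a covector, since the second
  derivatives of the change of coordinates cancel.\<close>

definition euler_lagrange_at ::
  "(real^2 \<Rightarrow> real^2 \<Rightarrow> real^2 \<Rightarrow> real) \<Rightarrow> real set \<Rightarrow> (real \<Rightarrow> real^2) \<Rightarrow> (real \<Rightarrow> real^2) \<Rightarrow> real \<Rightarrow> bool"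
  where "euler_lagrange_at g I x v t \<longleftrightarrow>
    (\<forall>\<eta>. \<exists>D. ((\<lambda>z. g z (v t) (v t)) has_derivative D) (at (x t)) \<and>
            ((\<lambda>s. g (x s) (v s) \<eta>) has_real_derivative D \<eta> / 2) (at t within I))"

lemma bil_2:
  "bil A v w = v $ 1 * A $ 1 $ 1 * w $ 1 + v $ 1 * A $ 1 $ 2 * w $ 2
     + v $ 2 * A $ 2 $ 1 * w $ 1 + v $ 2 * A $ 2 $ 2 * w $ 2"
  by (simp add: bil_def matrix_vector_mult_def inner_vec_def sum_2 algebra_simps)

lemma bounded_bilinear_bil: "bounded_bilinear (bil A)"
proof -
  have "bilinear (bil A)"
    by (auto simp: bilinear_def bil_2 intro!: linearI simp: algebra_simps)
  then show ?thesis by (simp add: bilinear_conv_bounded_bilinear)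
qed

lemma vec2_eq_axis: "(v :: real^2) = (v $ 1) *\<^sub>R axis 1 1 + (v $ 2) *\<^sub>R axis 2 1"
  by (simp add: vec_eq_iff forall_2 axis_def)

lemma frechet_derivative_eq_pd:
  assumes "f differentiable (at x)"
  shows "frechet_derivative f (at x) h = h $ 1 *\<^sub>R pd 1 f x + h $ 2 *\<^sub>R pd 2 f x"
proof -
  have l: "linear (frechet_derivative f (at x))" by (rule linear_frechet_derivative[OF assms])
  show ?thesis unfolding pd_def
    by (subst vec2_eq_axis[of h]) (simp add: linear_add[OF l] linear_cmul[OF l])
qed

text \<open>Along the curve, \<open>(F\<^sup>*g)(\<nu>, \<xi>) = g(v, F' \<xi>)\<close>. Its derivative contains the extra term
  \<open>g(v, F''(\<xi>, \<nu>))\<close>, and half the derivative of \<open>(F\<^sup>*g)(\<nu>, \<nu>)\<close> in the direction \<open>\<xi>\<close> contains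
  \<open>g(v, F''(\<nu>, \<xi>))\<close>. The two agree because \<open>F''\<close> is symmetric.\<close>

lemma euler_lagrange_pullback:
  fixes g :: "real^2 \<Rightarrow> real^2 \<Rightarrow> real^2 \<Rightarrow> real"
  assumes EL: "euler_lagrange_at g I x v t"
    and bil: "\<And>z. bounded_bilinear (g z)"
    and sym: "\<And>z \<xi> \<eta>. z \<in> V \<Longrightarrow> g z \<xi> \<eta> = g z \<eta> \<xi>"
    and diff: "\<And>i j. (\<lambda>z. g z (axis i 1) (axis j 1)) differentiable (at (x t))"
    and U: "open U" "u t \<in> U" and FV: "\<And>z. z \<in> U \<Longrightarrow> F z \<in> V"
    and F: "\<And>z. z \<in> U \<Longrightarrow> (F has_derivative F' z) (at z)"
    and F': "\<And>\<xi>. ((\<lambda>z. F' z \<xi>) has_derivative F'' \<xi>) (at (u t))"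
    and u: "(u has_vector_derivative \<nu> t) (at t within I)"
    and t: "t \<in> I"
    and near: "\<forall>\<^sub>F s in at t within I. x s = F (u s) \<and> v s = F' (u s) (\<nu> s)"
    and at: "x t = F (u t)" "v t = F' (u t) (\<nu> t)"
  shows "euler_lagrange_at (\<lambda>z \<xi> \<eta>. g (F z) (F' z \<xi>) (F' z \<eta>)) I u \<nu> t"
proof -
  define a where "a i j z = g z (axis i 1) (axis j 1)" for i j z
  have gexp: "g z \<xi> \<eta> = \<xi> $ 1 * \<eta> $ 1 * a 1 1 z + \<xi> $ 1 * \<eta> $ 2 * a 1 2 z
       + \<xi> $ 2 * \<eta> $ 1 * a 2 1 z + \<xi> $ 2 * \<eta> $ 2 * a 2 2 z" for z \<xi> \<eta>
  proof -
    interpret bounded_bilinear "g z" by (rule bil)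
    show ?thesis unfolding a_def
      by (subst vec2_eq_axis[of \<xi>], subst vec2_eq_axis[of \<eta>])
         (simp add: add_left add_right scaleR_left scaleR_right algebra_simps)
  qed
  have a_sym: "a 2 1 (x t) = a 1 2 (x t)"
    unfolding a_def using sym FV U at by simp
  obtain Da where Da: "\<And>i j. ((\<lambda>z. a i j z) has_derivative Da i j) (at (x t))"
    using diff unfolding a_def differentiable_def by metis
  define v0 where "v0 = v t"
  have lin_a: "linear (Da i j)" for i j using Da has_derivative_linear by blast
  define D where "D h = v0 $ 1 * v0 $ 1 * Da 1 1 h + v0 $ 1 * v0 $ 2 * Da 1 2 h
       + v0 $ 2 * v0 $ 1 * Da 2 1 h + v0 $ 2 * v0 $ 2 * Da 2 2 h" for h
  have D: "((\<lambda>z. g z v0 v0) has_derivative D) (at (x t))"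
    unfolding gexp D_def by ((rule Da refl | rule derivative_eq_intros)+) auto
  have P: "((\<lambda>s. g (x s) (v s) \<eta>) has_real_derivative D \<eta> / 2) (at t within I)" for \<eta>
  proof -
    obtain D' where D': "((\<lambda>z. g z (v t) (v t)) has_derivative D') (at (x t))"
       "((\<lambda>s. g (x s) (v s) \<eta>) has_real_derivative D' \<eta> / 2) (at t within I)"
      using EL unfolding euler_lagrange_at_def by blast
    have "D' = D" using has_derivative_unique[OF D'(1) D[unfolded v0_def]] .
    then show ?thesis using D'(2) by simp
  qed
  have linF: "linear (F' (u t))" using F U has_derivative_linear by blast
  have linF'': "linear (F'' \<xi>)" for \<xi> using F' has_derivative_linear by blast
  have F''sym: "F'' \<xi> \<eta> = F'' \<eta> \<xi>" for \<xi> \<eta>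
    by (rule second_derivative_symmetric[OF U F F' F'])
  have ud: "(u has_derivative (\<lambda>h. h *\<^sub>R \<nu> t)) (at t within I)"
    using u by (simp add: has_vector_derivative_def)
  have uF: "((\<lambda>s. F' (u s) \<xi>) has_derivative (\<lambda>h. h *\<^sub>R F'' \<xi> (\<nu> t))) (at t within I)" for \<xi>
    by (rule has_derivative_eq_rhs[OF has_derivative_compose[OF ud F']])
       (auto simp: linear_cmul[OF linF''])
  have comp: "((\<lambda>s. F' (u s) \<xi> $ i) has_real_derivative F'' \<xi> (\<nu> t) $ i) (at t within I)" for \<xi> i
    unfolding has_field_derivative_def
    by (rule has_derivative_eq_rhs[OF bounded_linear.has_derivative[OF bounded_linear_vec_nth uF]])
       (auto simp: mult.commute)
  show ?thesis unfolding euler_lagrange_at_def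
  proof (intro allI)
    fix \<xi>
    define \<nu>0 where "\<nu>0 = \<nu> t"
    define w where "w = F'' \<nu>0"
    define E where "E h = D (F' (u t) h) + 2 * g (x t) v0 (w h)" for h
    have Dlin: "D (y + z) = D y + D z" "D (c *\<^sub>R y) = c * D y" for y z c
      unfolding D_def by (simp_all add: linear_add[OF lin_a] linear_cmul[OF lin_a] algebra_simps)
    have aF: "((\<lambda>z. a i j (F z)) has_derivative (\<lambda>h. Da i j (F' (u t) h))) (at (u t))" for i j
      using has_derivative_compose[OF F[OF U(2)] Da[unfolded at(1)]] by simp
    have cF: "((\<lambda>z. F' z \<nu>0 $ i) has_derivative (\<lambda>h. w h $ i)) (at (u t))" for i
      unfolding w_def by (rule bounded_linear.has_derivative[OF bounded_linear_vec_nth F'])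
    have E: "((\<lambda>z. g (F z) (F' z \<nu>0) (F' z \<nu>0)) has_derivative E) (at (u t))"
      unfolding gexp
      by ((rule aF cF refl | rule derivative_eq_intros)+)
         (auto simp: E_def D_def gexp v0_def \<nu>0_def[symmetric] at a_sym[unfolded at(1)] fun_eq_iff algebra_simps)
    have Q: "((\<lambda>s. F' (u s) \<xi> $ 1 * g (x s) (v s) (axis 1 1) + F' (u s) \<xi> $ 2 * g (x s) (v s) (axis 2 1))
      has_real_derivative
       (F'' \<xi> \<nu>0 $ 1 * g (x t) v0 (axis 1 1) + F' (u t) \<xi> $ 1 * (D (axis 1 1) / 2)
      + (F'' \<xi> \<nu>0 $ 2 * g (x t) v0 (axis 2 1) + F' (u t) \<xi> $ 2 * (D (axis 2 1) / 2)))) (at t within I)"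
      unfolding \<nu>0_def v0_def by ((rule P comp refl | rule derivative_eq_intros)+) (auto simp: algebra_simps v0_def)
    have gF: "F' (u s) \<xi> $ 1 * g (x s) (v s) (axis 1 1) + F' (u s) \<xi> $ 2 * g (x s) (v s) (axis 2 1)
      = g (x s) (v s) (F' (u s) \<xi>)" for s
      by (simp add: gexp axis_def algebra_simps)
    have val: "(F'' \<xi> \<nu>0 $ 1 * g (x t) v0 (axis 1 1) + F' (u t) \<xi> $ 1 * (D (axis 1 1) / 2)
      + (F'' \<xi> \<nu>0 $ 2 * g (x t) v0 (axis 2 1) + F' (u t) \<xi> $ 2 * (D (axis 2 1) / 2))) = E \<xi> / 2"
    proof -
      have "D (F' (u t) \<xi>) = F' (u t) \<xi> $ 1 * D (axis 1 1) + F' (u t) \<xi> $ 2 * D (axis 2 1)"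
        by (subst vec2_eq_axis[of "F' (u t) \<xi>"]) (simp add: Dlin)
      moreover have "g (x t) v0 (w \<xi>) = F'' \<xi> \<nu>0 $ 1 * g (x t) v0 (axis 1 1) + F'' \<xi> \<nu>0 $ 2 * g (x t) v0 (axis 2 1)"
        unfolding w_def F''sym[of \<nu>0] by (simp add: gexp axis_def algebra_simps)
      ultimately show ?thesis unfolding E_def by (simp add: algebra_simps)
    qed
    have "((\<lambda>s. g (F (u s)) (F' (u s) (\<nu> s)) (F' (u s) \<xi>)) has_real_derivative E \<xi> / 2) (at t within I)"
      using Q unfolding gF val has_field_derivative_def
      by (rule has_derivative_transform_eventually) (use near at t in \<open>auto elim: eventually_mono\<close>)
    then show "\<exists>D. ((\<lambda>z. g (F z) (F' z (\<nu> t)) (F' z (\<nu> t))) has_derivative D) (at (u t)) \<and>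
      ((\<lambda>s. g (F (u s)) (F' (u s) (\<nu> s)) (F' (u s) \<xi>)) has_real_derivative D \<xi> / 2) (at t within I)"
      using E unfolding \<nu>0_def by blast
  qed
qed

lemma christoffel_lowered:
  assumes "transpose (G x) = G x" "\<And>v. v \<noteq> 0 \<Longrightarrow> bil (G x) v v > 0"
  shows "(\<Sum>k\<in>UNIV. G x $ m $ k * christoffel G k i j x) =
    (pd i (\<lambda>y. G y $ j $ m) x + pd j (\<lambda>y. G y $ i $ m) x - pd m (\<lambda>y. G y $ i $ j) x) / 2"
proof -
  define N where "N = matrix_inv (G x)"
  define b where "b l = pd i (\<lambda>y. G y $ j $ l) x + pd j (\<lambda>y. G y $ i $ l) x - pd l (\<lambda>y. G y $ i $ j) x" for l
  have "inj ((*v) (G x))"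
  proof (rule injI)
    fix v w assume "G x *v v = G x *v w"
    then have "bil (G x) (v - w) (v - w) = 0"
      by (simp add: bil_def matrix_vector_mult_diff_distrib)
    then show "v = w" using assms(2)[of "v - w"] by auto
  qed
  then have "invertible (G x)"
    by (metis matrix_left_invertible_injective invertible_left_inverse)
  then have "G x ** N = mat 1" 
    unfolding N_def matrix_inv_def invertible_def by (rule someI2_ex) auto
  then have N: "(\<Sum>k\<in>UNIV. G x $ m $ k * N $ k $ l) = (if m = l then 1 else 0)" for l
    by (simp add: matrix_matrix_mult_def vec_eq_iff mat_def)
  have "(\<Sum>k\<in>UNIV. G x $ m $ k * christoffel G k i j x)
      = (\<Sum>k\<in>UNIV. \<Sum>l\<in>UNIV. G x $ m $ k * (N $ k $ l * b l)) / 2"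
    by (simp add: christoffel_def N_def b_def sum_distrib_left sum_divide_distrib)
  also have "\<dots> = (\<Sum>l\<in>UNIV. (\<Sum>k\<in>UNIV. G x $ m $ k * N $ k $ l) * b l) / 2"
    by (subst sum.swap) (simp add: sum_distrib_right mult.assoc)
  also have "\<dots> = b m / 2" by (simp add: N if_distrib[of "\<lambda>z. z * _"] cong: if_cong)
  finally show ?thesis by (simp add: b_def)
qed

text \<open>The acceleration prescribed by the Christoffel symbols is substituted into the derivative of the
  momentum and, for the second claim, into that of the squared speed; lowering the index
  (\<open>christoffel_lowered\<close>) cancels all derivatives of the metric but one, respectively all of them.\<close>

lemma geodesic_equation_imp_euler_lagrange:
  assumes U: "open U" "x t \<in> U"
    and symG: "\<And>z. z \<in> U \<Longrightarrow> transpose (G z) = G z"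
    and pos: "\<And>v. v \<noteq> 0 \<Longrightarrow> bil (G (x t)) v v > 0"
    and diff: "\<And>i j. (\<lambda>z. G z $ i $ j) differentiable (at (x t))"
    and x: "(x has_vector_derivative v t) (at t within I)"
    and v: "(v has_vector_derivative
              (\<chi> k. - (\<Sum>i\<in>UNIV. \<Sum>j\<in>UNIV. christoffel G k i j (x t) * v t $ i * v t $ j))) (at t within I)"
  shows "euler_lagrange_at (\<lambda>z. bil (G z)) I x v t"
    and "((\<lambda>s. bil (G (x s)) (v s) (v s)) has_real_derivative 0) (at t within I)"
proof -
  define p where "p k i j = pd k (\<lambda>z. G z $ i $ j) (x t)" for k i j
  define v0 where "v0 = v t"
  define a where "a = (\<chi> k. - (\<Sum>i\<in>UNIV. \<Sum>j\<in>UNIV. christoffel G k i j (x t) * v t $ i * v t $ j))"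
  define D where "D i j h = h $ 1 * p 1 i j + h $ 2 * p 2 i j" for i j and h :: "real^2"
  have D: "((\<lambda>z. G z $ i $ j) has_derivative D i j) (at (x t))" for i j
    using diff[of i j] unfolding frechet_derivative_works
    by (rule has_derivative_eq_rhs) (auto simp: fun_eq_iff frechet_derivative_eq_pd[OF diff] D_def p_def)
  have symU: "G z $ i $ j = G z $ j $ i" if "z \<in> U" for z i j
    using symG[OF that] by (simp add: transpose_def vec_eq_iff)
  have psym: "p k 2 1 = p k 1 2" for k
  proof -
    have "((\<lambda>z. G z $ 2 $ 1) has_derivative D 1 2) (at (x t))"
      by (rule has_derivative_transform_within_open[OF D U]) (simp add: symU)
    then have "D 1 2 = D 2 1" using D has_derivative_unique by blast
    then have "D 1 2 (axis k 1) = D 2 1 (axis k 1)" by simp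
    then show ?thesis using exhaust_2[of k] by (auto simp: D_def axis_def)
  qed
  have Gsym: "G (x t) $ 2 $ 1 = G (x t) $ 1 $ 2" using symU U by simp
  have Gx: "((\<lambda>s. G (x s) $ i $ j) has_real_derivative D i j v0) (at t within I)" for i j
    unfolding has_field_derivative_def
    by (rule has_derivative_eq_rhs[OF has_derivative_compose[OF x[unfolded has_vector_derivative_def] D]])
       (auto simp: D_def v0_def algebra_simps)
  have vi: "((\<lambda>s. v s $ i) has_real_derivative a $ i) (at t within I)" for i
    using bounded_linear.has_vector_derivative[OF bounded_linear_vec_nth v[folded a_def]]
    by (simp add: has_real_derivative_iff_has_vector_derivative)
  have low: "G (x t) $ m $ 1 * a $ 1 + G (x t) $ m $ 2 * a $ 2 =
      - (\<Sum>i\<in>UNIV. \<Sum>j\<in>UNIV. (p i j m + p j i m - p m i j) / 2 * v0 $ i * v0 $ j)" for m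
  proof -
    have "G (x t) $ m $ 1 * a $ 1 + G (x t) $ m $ 2 * a $ 2 =
      - (\<Sum>i\<in>UNIV. \<Sum>j\<in>UNIV. (\<Sum>k\<in>UNIV. G (x t) $ m $ k * christoffel G k i j (x t)) * v0 $ i * v0 $ j)"
      by (simp add: a_def v0_def sum_2 algebra_simps)
    moreover have "(\<Sum>k\<in>UNIV. G (x t) $ m $ k * christoffel G k i j (x t)) = (p i j m + p j i m - p m i j) / 2" for i j
      unfolding p_def by (rule christoffel_lowered[of G "x t", OF symG[OF U(2)] pos])
    ultimately show ?thesis by (simp only:)
  qed
  have low1: "G (x t) $ 1 $ 1 * a $ 1 + G (x t) $ 1 $ 2 * a $ 2 =
     - (p 1 1 1 * v0$1 * v0$1 / 2 + p 2 1 1 * v0$1 * v0$2 + (p 2 1 2 - p 1 2 2 / 2) * v0$2 * v0$2)"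
    using low[of 1] by (simp add: sum_2 psym field_simps)
  have low2: "G (x t) $ 1 $ 2 * a $ 1 + G (x t) $ 2 $ 2 * a $ 2 =
     - (p 2 2 2 * v0$2 * v0$2 / 2 + p 1 2 2 * v0$1 * v0$2 + (p 1 1 2 - p 2 1 1 / 2) * v0$1 * v0$1)"
    using low[of 2] by (simp add: sum_2 psym Gsym field_simps)
  define Q where "Q h = D 1 1 h * v0$1 * v0$1 + 2 * D 1 2 h * v0$1 * v0$2 + D 2 2 h * v0$2 * v0$2" for h
  have D21: "D 2 1 h = D 1 2 h" for h by (simp add: D_def psym)
  have "((\<lambda>z. bil (G z) v0 v0) has_derivative Q) (at (x t))"
    unfolding bil_2 by ((rule D refl | rule derivative_eq_intros)+) (auto simp: Q_def D21 fun_eq_iff algebra_simps)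
  moreover have "((\<lambda>s. bil (G (x s)) (v s) \<eta>) has_real_derivative Q \<eta> / 2) (at t within I)" for \<eta>
  proof -
    have "((\<lambda>s. bil (G (x s)) (v s) \<eta>) has_real_derivative
       v0$1 * D 1 1 v0 * \<eta>$1 + v0$1 * D 1 2 v0 * \<eta>$2 + v0$2 * D 1 2 v0 * \<eta>$1 + v0$2 * D 2 2 v0 * \<eta>$2
       + \<eta>$1 * (G (x t) $ 1 $ 1 * a $ 1 + G (x t) $ 1 $ 2 * a $ 2)
       + \<eta>$2 * (G (x t) $ 1 $ 2 * a $ 1 + G (x t) $ 2 $ 2 * a $ 2)) (at t within I)"
      unfolding bil_2
      by ((rule Gx vi refl | rule derivative_eq_intros)+) (auto simp: v0_def D21 Gsym algebra_simps)
    moreover have "v0$1 * D 1 1 v0 * \<eta>$1 + v0$1 * D 1 2 v0 * \<eta>$2 + v0$2 * D 1 2 v0 * \<eta>$1 + v0$2 * D 2 2 v0 * \<eta>$2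
       + \<eta>$1 * (G (x t) $ 1 $ 1 * a $ 1 + G (x t) $ 1 $ 2 * a $ 2)
       + \<eta>$2 * (G (x t) $ 1 $ 2 * a $ 1 + G (x t) $ 2 $ 2 * a $ 2) = Q \<eta> / 2"
      unfolding low1 low2 by (simp add: D_def Q_def field_simps)
    ultimately show ?thesis by simp
  qed
  ultimately show "euler_lagrange_at (\<lambda>z. bil (G z)) I x v t"
    unfolding euler_lagrange_at_def v0_def by blast
  have "((\<lambda>s. bil (G (x s)) (v s) (v s)) has_real_derivative
       v0$1 * D 1 1 v0 * v0$1 + 2 * (v0$1 * D 1 2 v0 * v0$2) + v0$2 * D 2 2 v0 * v0$2
       + 2 * v0$1 * (G (x t) $ 1 $ 1 * a $ 1 + G (x t) $ 1 $ 2 * a $ 2)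
       + 2 * v0$2 * (G (x t) $ 1 $ 2 * a $ 1 + G (x t) $ 2 $ 2 * a $ 2)) (at t within I)"
    unfolding bil_2
    by ((rule Gx vi refl | rule derivative_eq_intros)+) (auto simp: v0_def D21 Gsym algebra_simps)
  moreover have "v0$1 * D 1 1 v0 * v0$1 + 2 * (v0$1 * D 1 2 v0 * v0$2) + v0$2 * D 2 2 v0 * v0$2
       + 2 * v0$1 * (G (x t) $ 1 $ 1 * a $ 1 + G (x t) $ 1 $ 2 * a $ 2)
       + 2 * v0$2 * (G (x t) $ 1 $ 2 * a $ 1 + G (x t) $ 2 $ 2 * a $ 2) = 0"
    unfolding low1 low2 by (simp add: D_def field_simps)
  ultimately show "((\<lambda>s. bil (G (x s)) (v s) (v s)) has_real_derivative 0) (at t within I)" by simp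
qed

section \<open>Geodesics in a compatible chart\<close>

lemma euler_lagrange_cong:
  assumes EL: "euler_lagrange_at g I x v t"
    and V: "open V" "x t \<in> V" "\<And>z. z \<in> V \<Longrightarrow> g' z = g z"
    and near: "\<forall>\<^sub>F s in at t within I. x s \<in> V" and "t \<in> I"
  shows "euler_lagrange_at g' I x v t"
  unfolding euler_lagrange_at_def
proof
  fix \<eta>
  obtain D where D: "((\<lambda>z. g z (v t) (v t)) has_derivative D) (at (x t))"
      "((\<lambda>s. g (x s) (v s) \<eta>) has_real_derivative D \<eta> / 2) (at t within I)"
    using EL unfolding euler_lagrange_at_def by blast
  have "((\<lambda>z. g' z (v t) (v t)) has_derivative D) (at (x t))"
    by (rule has_derivative_transform_within_open[OF D(1) V(1,2)]) (simp add: V(3))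
  moreover have "((\<lambda>s. g' (x s) (v s) \<eta>) has_real_derivative D \<eta> / 2) (at t within I)"
    using D(2) unfolding has_field_derivative_def
    by (rule has_derivative_transform_eventually)
       (use near V \<open>t \<in> I\<close> in \<open>auto elim: eventually_mono\<close>)
  ultimately show "\<exists>D. ((\<lambda>z. g' z (v t) (v t)) has_derivative D) (at (x t)) \<and>
      ((\<lambda>s. g' (x s) (v s) \<eta>) has_real_derivative D \<eta> / 2) (at t within I)" by blast
qed

lemma bil_symmetric:
  assumes "transpose A = A"
  shows "bil A v w = bil A w v"
proof -
  have "transpose A $ 1 $ 2 = A $ 1 $ 2" using assms by simp
  then have "A $ 2 $ 1 = A $ 1 $ 2" by (simp add: transpose_def)
  then show ?thesis by (simp add: bil_2)
qed

lemma vd_eqI: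
  fixes x :: "real \<Rightarrow> 'b::euclidean_space"
  assumes "(x has_vector_derivative w) (at t within {0..1})" "t \<in> {0..1}"
  shows "vd {0..1} x t = w"
  unfolding vd_def using vector_derivative_within_closed_interval[of 0 1 t x w] assms by simp

lemma open_chart_overlap:
  assumes "riemannian_chart c" "open W"
  shows "open (coord c ` (cdom c \<inter> W))"
proof -
  have h: "homeomorphism (cdom c) (cimage c) (coord c) (cinv c)" and o: "open (cimage c)"
    using assms by (auto simp: riemannian_chart_def)
  have "openin (top_of_set (cdom c)) (cdom c \<inter> W)" using assms(2) by auto
  then have "openin (top_of_set (cimage c)) (coord c ` (cdom c \<inter> W))"
    by (rule homeomorphism_imp_open_map[OF h])
  then show ?thesis using o openin_open_trans by blast
qed

lemma cinv_coord: "riemannian_chart c \<Longrightarrow> p \<in> cdom c \<Longrightarrow> cinv c (coord c p) = p"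
  and coord_cinv: "riemannian_chart c \<Longrightarrow> z \<in> cimage c \<Longrightarrow> coord c (cinv c z) = z"
  and cinv_in_cdom: "riemannian_chart c \<Longrightarrow> z \<in> cimage c \<Longrightarrow> cinv c z \<in> cdom c"
  by (auto simp: riemannian_chart_def homeomorphism_def)

lemma transition_coord: "riemannian_chart c \<Longrightarrow> p \<in> cdom c \<Longrightarrow> transition c d (coord c p) = coord d p"
  by (simp add: transition_def cinv_coord)

lemma eventually_in_open:
  assumes "continuous_on I \<gamma>" "t \<in> I" "open W" "\<gamma> t \<in> W"
  shows "\<forall>\<^sub>F s in at t within I. \<gamma> s \<in> W"
  using assms continuous_on topological_tendstoD by metis

lemma smooth_on_differentiable: "smooth_on U f \<Longrightarrow> z \<in> U \<Longrightarrow> f differentiable (at z)"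
  unfolding smooth_on_def by (metis Ck_on.simps(2))

lemma smooth_on_pd: "smooth_on U f \<Longrightarrow> smooth_on U (pd i f)"
  unfolding smooth_on_def by (metis Ck_on.simps(2))

lemma has_derivative_frechet_derivative_apply:
  assumes "smooth_on U f" "open U" "z \<in> U"
  shows "((\<lambda>z. frechet_derivative f (at z) \<xi>) has_derivative
     (\<lambda>h. \<xi> $ 1 *\<^sub>R frechet_derivative (pd 1 f) (at z) h + \<xi> $ 2 *\<^sub>R frechet_derivative (pd 2 f) (at z) h)) (at z)"
proof -
  have d: "(pd i f has_derivative frechet_derivative (pd i f) (at z)) (at z)" for i
    using smooth_on_differentiable[OF smooth_on_pd[OF assms(1)] assms(3)] frechet_derivative_works by blast
  have "((\<lambda>z. \<xi> $ 1 *\<^sub>R pd 1 f z + \<xi> $ 2 *\<^sub>R pd 2 f z) has_derivative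
     (\<lambda>h. \<xi> $ 1 *\<^sub>R frechet_derivative (pd 1 f) (at z) h + \<xi> $ 2 *\<^sub>R frechet_derivative (pd 2 f) (at z) h)) (at z)"
    by (intro has_derivative_add has_derivative_scaleR_right d)
  then show ?thesis
    by (rule has_derivative_transform_within_open[OF _ assms(2,3)])
       (simp add: frechet_derivative_eq_pd[OF smooth_on_differentiable[OF assms(1)]])
qed

lemma velocity_transition:
  assumes atlas: "riemannian_atlas (insert \<Phi> M)"
    and \<gamma>: "continuous_on {0..1} \<gamma>" and s: "s \<in> {0..1}"
    and cd: "c \<in> insert \<Phi> M" "d \<in> insert \<Phi> M" "\<gamma> s \<in> cdom c" "\<gamma> s \<in> cdom d"
    and x: "(coord c \<circ> \<gamma> has_vector_derivative v) (at s within {0..1})"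
  shows "(coord d \<circ> \<gamma> has_vector_derivative
     frechet_derivative (transition c d) (at (coord c (\<gamma> s))) v) (at s within {0..1})"
proof -
  have ch: "riemannian_chart c" "riemannian_chart d"
    using atlas cd by (auto simp: riemannian_atlas_def)
  let ?U = "coord c ` (cdom c \<inter> cdom d)"
  have op: "open (cdom c \<inter> cdom d)" using ch by (auto simp: riemannian_chart_def)
  have sm: "smooth_on ?U (transition c d)"
    using atlas cd unfolding riemannian_atlas_def by blast
  have T: "(transition c d has_derivative frechet_derivative (transition c d) (at (coord c (\<gamma> s)))) (at ((coord c \<circ> \<gamma>) s))"
    using smooth_on_differentiable[OF sm, of "coord c (\<gamma> s)"] cd frechet_derivative_works by auto
  have l: "linear (frechet_derivative (transition c d) (at (coord c (\<gamma> s))))"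
    using T has_derivative_linear by blast
  have "((\<lambda>s. transition c d ((coord c \<circ> \<gamma>) s)) has_derivative
     (\<lambda>h. h *\<^sub>R frechet_derivative (transition c d) (at (coord c (\<gamma> s))) v)) (at s within {0..1})"
    using has_derivative_compose[OF x[unfolded has_vector_derivative_def] T]
    by (simp add: linear_cmul[OF l])
  then have "((coord d \<circ> \<gamma>) has_derivative
     (\<lambda>h. h *\<^sub>R frechet_derivative (transition c d) (at (coord c (\<gamma> s))) v)) (at s within {0..1})"
    by (rule has_derivative_transform_eventually)
       (use eventually_in_open[OF \<gamma> s op] cd(3,4) s in \<open>auto elim!: eventually_mono simp: transition_coord[OF ch(1)]\<close>)
  then show ?thesis by (simp add: has_vector_derivative_def)
qed

text \<open>Around each time the equation is known in some chart \<open>c\<close> of the atlas; it is pulled back along the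
  transition map from \<open>\<Phi>\<close> to \<open>c\<close>, which is an isometry for the Gram matrices. In this way the
  chart at infinity can be used although geodesics are defined by the charts of the atlas.\<close>

lemma geodesic_in_compatible_chart:
  fixes M :: "'a::topological_space rchart set"
  assumes atlas: "riemannian_atlas (insert \<Phi> M)"
    and geo: "geodesic_on M {0..1} \<gamma>" and t: "t \<in> {0..1}" and t\<Phi>: "\<gamma> t \<in> cdom \<Phi>"
  shows "(coord \<Phi> \<circ> \<gamma> has_vector_derivative vd {0..1} (coord \<Phi> \<circ> \<gamma>) t) (at t within {0..1})"
    and "continuous (at t within {0..1}) (vd {0..1} (coord \<Phi> \<circ> \<gamma>))"
    and "euler_lagrange_at (\<lambda>z. bil (gram \<Phi> z)) {0..1} (coord \<Phi> \<circ> \<gamma>) (vd {0..1} (coord \<Phi> \<circ> \<gamma>)) t"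
    and "((\<lambda>s. bil (gram \<Phi> (coord \<Phi> (\<gamma> s))) (vd {0..1} (coord \<Phi> \<circ> \<gamma>) s) (vd {0..1} (coord \<Phi> \<circ> \<gamma>) s))
            has_real_derivative 0) (at t within {0..1})"
proof -
  let ?I = "{0..1::real}"
  have cont: "continuous_on ?I \<gamma>" using geo by (simp add: geodesic_on_def)
  obtain c where c: "c \<in> M" "\<gamma> t \<in> cdom c"
    using geo t unfolding geodesic_on_def carrier_def by blast
  have chc: "riemannian_chart c" and ch\<Phi>: "riemannian_chart \<Phi>"
    using atlas c by (auto simp: riemannian_atlas_def)
  define A where "A = cdom c \<inter> cdom \<Phi>"
  have opA: "open A" and tA: "\<gamma> t \<in> A"
    using chc ch\<Phi> c t\<Phi> by (auto simp: riemannian_chart_def A_def)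
  have near: "\<forall>\<^sub>F s in at t within ?I. s \<in> ?I \<and> \<gamma> s \<in> A"
    using eventually_in_open[OF cont t opA tA] by (auto simp: eventually_at_filter elim: eventually_mono)
  define x where "x = coord c \<circ> \<gamma>"
  define y where "y = coord \<Phi> \<circ> \<gamma>"
  define v where "v = vd ?I x"
  define w where "w = vd ?I y"
  define T where "T = transition c \<Phi>"
  define S where "S = transition \<Phi> c"
  define U where "U = coord c ` A"
  define V where "V = coord \<Phi> ` A"
  have opU: "open U" unfolding U_def A_def using open_chart_overlap chc ch\<Phi> by (auto simp: riemannian_chart_def)
  have opV: "open V" unfolding V_def A_def using open_chart_overlap[of \<Phi> "cdom c"] chc ch\<Phi>
    by (auto simp: riemannian_chart_def Int_commute)
  have smT: "smooth_on U T" and smS: "smooth_on V S"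
    using atlas c unfolding riemannian_atlas_def U_def V_def A_def T_def S_def by (auto simp: Int_commute)
  have x_geo: "x differentiable (at s within ?I) \<and> (v has_vector_derivative
              (\<chi> k. - (\<Sum>i\<in>UNIV. \<Sum>j\<in>UNIV. christoffel (gram c) k i j (x s) * v s $ i * v s $ j))) (at s within ?I)"
    if "s \<in> ?I" "\<gamma> s \<in> A" for s
    using geo c that unfolding geodesic_on_def Let_def x_def v_def A_def by blast
  have x_deriv: "(x has_vector_derivative v s) (at s within ?I)" if "s \<in> ?I" "\<gamma> s \<in> A" for s
    using x_geo[OF that] unfolding v_def vd_def by (simp add: vector_derivative_works)
  note v_deriv = conjunct2[OF x_geo]
  have y_deriv: "(y has_vector_derivative w s) (at s within ?I)"
    and w_eq: "w s = frechet_derivative T (at (x s)) (v s)" if "s \<in> ?I" "\<gamma> s \<in> A" for s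
  proof -
    have y: "(y has_vector_derivative frechet_derivative T (at (x s)) (v s)) (at s within ?I)"
      using velocity_transition[OF atlas cont that(1), of c \<Phi>] x_deriv[OF that] that c
      by (auto simp: A_def x_def y_def T_def)
    then show "(y has_vector_derivative w s) (at s within ?I)" "w s = frechet_derivative T (at (x s)) (v s)"
      unfolding w_def using y vd_eqI[OF y that(1)] by auto
  qed
  have v_eq: "v s = frechet_derivative S (at (y s)) (w s)" if "s \<in> ?I" "\<gamma> s \<in> A" for s
    unfolding v_def
    by (rule vd_eqI[OF _ that(1)])
       (use velocity_transition[OF atlas cont that(1), of \<Phi> c] y_deriv[OF that] that c
         in \<open>auto simp: A_def x_def y_def S_def\<close>)
  have x_S: "x s = S (y s)" if "\<gamma> s \<in> A" for s
    using that by (simp add: x_def y_def S_def A_def transition_coord[OF ch\<Phi>])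
  have xU: "x s \<in> U" and yV: "y s \<in> V" if "\<gamma> s \<in> A" for s using that by (auto simp: x_def y_def U_def V_def)
  have iso: "bil (gram \<Phi> z) \<xi> \<eta> = bil (gram c (S z)) (frechet_derivative S (at z) \<xi>) (frechet_derivative S (at z) \<eta>)"
    if "z \<in> V" for z \<xi> \<eta>
    using atlas c that unfolding riemannian_atlas_def V_def A_def S_def by (auto simp: Int_commute)
  show "(coord \<Phi> \<circ> \<gamma> has_vector_derivative vd ?I (coord \<Phi> \<circ> \<gamma>) t) (at t within ?I)"
    using y_deriv[OF t tA] by (simp add: y_def w_def)
  show "continuous (at t within ?I) (vd ?I (coord \<Phi> \<circ> \<gamma>))"
  proof -
    have xc: "continuous (at t within ?I) x" and vc: "continuous (at t within ?I) v"
      using x_deriv[OF t tA] v_deriv[OF t tA] has_vector_derivative_continuous by blast+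
    have pc: "continuous (at t within ?I) (\<lambda>s. pd i T (x s))" for i
    proof -
      have "isCont (pd i T) (x t)"
        using smooth_on_differentiable[OF smooth_on_pd[OF smT]] xU[OF tA] differentiable_imp_continuous_within by blast
      then show ?thesis using xc by (simp add: continuous_within_compose3)
    qed
    have "continuous (at t within ?I) (\<lambda>s. v s $ 1 *\<^sub>R pd 1 T (x s) + v s $ 2 *\<^sub>R pd 2 T (x s))"
      by (intro continuous_intros pc vc continuous_component)
    moreover have "\<forall>\<^sub>F s in at t within ?I. v s $ 1 *\<^sub>R pd 1 T (x s) + v s $ 2 *\<^sub>R pd 2 T (x s) = w s"
      using near by eventually_elim
        (simp add: w_eq frechet_derivative_eq_pd[OF smooth_on_differentiable[OF smT xU]])
    moreover have "v t $ 1 *\<^sub>R pd 1 T (x t) + v t $ 2 *\<^sub>R pd 2 T (x t) = w t"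
      using t tA by (simp add: w_eq frechet_derivative_eq_pd[OF smooth_on_differentiable[OF smT xU]])
    ultimately have "continuous (at t within ?I) w"
      unfolding continuous_within using filterlim_cong by force
    then show ?thesis by (simp add: w_def y_def)
  qed
  have Gsym: "\<And>z. z \<in> cimage c \<Longrightarrow> transpose (gram c z) = gram c z"
    and Gpos: "\<And>z v. z \<in> cimage c \<Longrightarrow> v \<noteq> 0 \<Longrightarrow> bil (gram c z) v v > 0"
    and smG: "smooth_on (cimage c) (gram c)" and opc: "open (cimage c)"
    using chc by (auto simp: riemannian_chart_def)
  have xc: "x t \<in> cimage c" using c by (simp add: x_def cimage_def)
  have Gd: "(\<lambda>z. gram c z $ i $ j) differentiable (at (x t))" for i j
  proof -
    obtain D where "(gram c has_derivative D) (at (x t))"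
      using smooth_on_differentiable[OF smG xc] differentiable_def by blast
    then have "((\<lambda>z. gram c z $ i $ j) has_derivative (\<lambda>h. D h $ i $ j)) (at (x t))"
      by (intro bounded_linear.has_derivative[OF bounded_linear_vec_nth])
    then show ?thesis using differentiable_def by blast
  qed
  note EL = geodesic_equation_imp_euler_lagrange[of "cimage c" x t "gram c" v ?I,
      OF opc xc Gsym Gpos[OF xc] Gd x_deriv[OF t tA] v_deriv[OF t tA], simplified]
  have Sd: "(S has_derivative frechet_derivative S (at z)) (at z)" if "z \<in> V" for z
    using smooth_on_differentiable[OF smS that] frechet_derivative_works by blast
  have "euler_lagrange_at (\<lambda>z \<xi> \<eta>. bil (gram c (S z)) (frechet_derivative S (at z) \<xi>) (frechet_derivative S (at z) \<eta>)) ?I y w t"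
  proof (rule euler_lagrange_pullback[where x = x and v = v and V = "cimage c" and U = V and u = y and \<nu> = w])
    show "euler_lagrange_at (\<lambda>z. bil (gram c z)) ?I x v t" by (rule EL(1))
    show "bounded_bilinear (bil (gram c z))" for z by (rule bounded_bilinear_bil)
    show "bil (gram c z) \<xi> \<eta> = bil (gram c z) \<eta> \<xi>" if "z \<in> cimage c" for z \<xi> \<eta>
      by (rule bil_symmetric[OF Gsym[OF that]])
    show "open V" "y t \<in> V" "t \<in> ?I" using opV yV[OF tA] t by auto
    show "(S has_derivative frechet_derivative S (at z)) (at z)" if "z \<in> V" for z by (rule Sd[OF that])
    show "((\<lambda>z. frechet_derivative S (at z) \<xi>) has_derivative
        (\<lambda>h. \<xi> $ 1 *\<^sub>R frechet_derivative (pd 1 S) (at (y t)) h + \<xi> $ 2 *\<^sub>R frechet_derivative (pd 2 S) (at (y t)) h)) (at (y t))" for \<xi>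
      by (rule has_derivative_frechet_derivative_apply[OF smS opV yV[OF tA]])
    show "(y has_vector_derivative w t) (at t within ?I)" by (rule y_deriv[OF t tA])
    show "(\<lambda>z. bil (gram c z) (axis i 1) (axis j 1)) differentiable (at (x t))" for i j
      unfolding bil_2 by (intro derivative_intros Gd)
    show "S z \<in> cimage c" if "z \<in> V" for z
      using that unfolding V_def S_def A_def by (auto simp: transition_coord[OF ch\<Phi>] cimage_def)
    show "\<forall>\<^sub>F s in at t within ?I. x s = S (y s) \<and> v s = frechet_derivative S (at (y s)) (w s)"
      using near by eventually_elim (simp add: x_S v_eq)
  qed (use x_S v_eq t tA in auto)
  then show "euler_lagrange_at (\<lambda>z. bil (gram \<Phi> z)) ?I (coord \<Phi> \<circ> \<gamma>) (vd ?I (coord \<Phi> \<circ> \<gamma>)) t"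
    unfolding y_def[symmetric] w_def[symmetric]
    by (rule euler_lagrange_cong[where V = V])
       (use near opV yV[OF tA] t in \<open>auto simp: fun_eq_iff iso yV elim: eventually_mono\<close>)
  have "((\<lambda>s. bil (gram \<Phi> (y s)) (w s) (w s)) has_real_derivative 0) (at t within ?I)"
    using EL(2) unfolding has_field_derivative_def
    by (rule has_derivative_transform_eventually)
       (use near t tA in \<open>auto simp: iso yV x_S[symmetric] v_eq[symmetric] elim: eventually_mono\<close>)
  then show "((\<lambda>s. bil (gram \<Phi> (coord \<Phi> (\<gamma> s))) (vd ?I (coord \<Phi> \<circ> \<gamma>) s) (vd ?I (coord \<Phi> \<circ> \<gamma>) s))
            has_real_derivative 0) (at t within ?I)"
    by (simp add: w_def y_def)
qed

text \<open>The velocity enters the geodesic equation quadratically, so its change of sign is not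
  seen. This makes it possible to follow a geodesic outward in either direction of time.\<close>

lemma geodesic_on_reverse:
  assumes M: "\<And>c. c \<in> M \<Longrightarrow> open (cdom c)" and geo: "geodesic_on M {0..1} \<gamma>"
  shows "geodesic_on M {0..1} (\<lambda>t. \<gamma> (1 - t))"
proof -
  let ?I = "{0..1::real}"
  have img: "(\<lambda>t. 1 - t) ` ?I = ?I" by (auto simp: image_iff intro: bexI[of _ "1 - _"])
  have rev: "((\<lambda>s. f (1 - s)) has_vector_derivative - d) (at t within ?I)"
    if "(f has_vector_derivative d) (at (1 - t) within ?I)" for f :: "real \<Rightarrow> real^2" and d t
  proof -
    have "((\<lambda>s. 1 - s) has_vector_derivative -1) (at t within ?I)"
      by (auto intro!: derivative_eq_intros simp: has_vector_derivative_def)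
    from vector_diff_chain_within[OF this, of f d] that
    show ?thesis by (simp add: img o_def)
  qed
  have cont: "continuous_on ?I \<gamma>" using geo by (simp add: geodesic_on_def)
  have cont': "continuous_on ?I (\<lambda>t. \<gamma> (1 - t))"
    by (rule continuous_on_compose2[OF cont]) (auto intro: continuous_intros)
  have "(let x = coord c \<circ> (\<lambda>t. \<gamma> (1 - t)); v = vd ?I x in
           x differentiable (at t within ?I) \<and>
           (v has_vector_derivative
              (\<chi> k. - (\<Sum>i\<in>UNIV. \<Sum>j\<in>UNIV. christoffel (gram c) k i j (x t) * v t $ i * v t $ j)))
             (at t within ?I))"
    if c: "c \<in> M" and t: "t \<in> ?I" "\<gamma> (1 - t) \<in> cdom c" for c t
  proof -
    have op: "open (cdom c)" using M c .
    define x where "x = coord c \<circ> \<gamma>"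
    define x' where "x' = coord c \<circ> (\<lambda>t. \<gamma> (1 - t))"
    have x': "x' = (\<lambda>s. x (1 - s))" by (auto simp: x_def x'_def)
    have geo_x: "x differentiable (at s within ?I) \<and> (vd ?I x has_vector_derivative
              (\<chi> k. - (\<Sum>i\<in>UNIV. \<Sum>j\<in>UNIV. christoffel (gram c) k i j (x s) * vd ?I x s $ i * vd ?I x s $ j)))
             (at s within ?I)"
      if "s \<in> ?I" "\<gamma> s \<in> cdom c" for s
      using geo c that unfolding geodesic_on_def Let_def x_def by blast
    have dx: "(x has_vector_derivative vd ?I x s) (at s within ?I)" if "s \<in> ?I" "\<gamma> s \<in> cdom c" for s
      using geo_x[OF that] unfolding vd_def by (simp add: vector_derivative_works)
    note dv = conjunct2[OF geo_x]
    have dx': "(x' has_vector_derivative - vd ?I x (1 - s)) (at s within ?I)"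
      if "s \<in> ?I" "\<gamma> (1 - s) \<in> cdom c" for s
      unfolding x' using that by (intro rev dx) auto
    have v': "vd ?I x' s = - vd ?I x (1 - s)" if "s \<in> ?I" "\<gamma> (1 - s) \<in> cdom c" for s
      using vd_eqI[OF dx'[OF that] that(1)] .
    have "((\<lambda>s. - vd ?I x (1 - s)) has_vector_derivative
        (\<chi> k. - (\<Sum>i\<in>UNIV. \<Sum>j\<in>UNIV. christoffel (gram c) k i j (x (1 - t)) * vd ?I x (1 - t) $ i * vd ?I x (1 - t) $ j)))
        (at t within ?I)"
      using has_vector_derivative_minus[OF rev[OF dv]] t by simp
    then have "(vd ?I x' has_vector_derivative
        (\<chi> k. - (\<Sum>i\<in>UNIV. \<Sum>j\<in>UNIV. christoffel (gram c) k i j (x (1 - t)) * vd ?I x (1 - t) $ i * vd ?I x (1 - t) $ j)))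
        (at t within ?I)"
      unfolding has_vector_derivative_def
      by (rule has_derivative_transform_eventually)
         (use eventually_in_open[OF cont' t(1) op t(2)] t v' in
           \<open>auto simp: eventually_at_filter elim!: eventually_mono\<close>)
    then have "x' differentiable (at t within ?I) \<and>
           (vd ?I x' has_vector_derivative
              (\<chi> k. - (\<Sum>i\<in>UNIV. \<Sum>j\<in>UNIV. christoffel (gram c) k i j (x' t) * vd ?I x' t $ i * vd ?I x' t $ j)))
             (at t within ?I)"
      using dx'[OF t] unfolding v'[OF t] by (auto simp: x' differentiable_def has_vector_derivative_def)
    then show ?thesis by (simp add: x'_def Let_def)
  qed
  moreover have "(\<lambda>t. \<gamma> (1 - t)) ` ?I \<subseteq> carrier M"
    using geo unfolding geodesic_on_def by auto
  ultimately show ?thesis using cont' unfolding geodesic_on_def by blast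
qed

section \<open>Polar coordinates\<close>

text \<open>The polar angle on the half-plane \<open>z $ 1 > 0\<close>, where it is smooth. Near-radial motion close to
  the half-line \<open>\<theta> = 0\<close> stays in this half-plane, so that no lift of the angle is necessary.\<close>

definition azimuth :: "real^2 \<Rightarrow> real" where
  "azimuth z = arctan (z $ 2 / z $ 1)"

lemma norm_vec2: "norm (z :: real^2) = sqrt ((z $ 1)\<^sup>2 + (z $ 2)\<^sup>2)"
  by (simp add: norm_vec_def L2_set_def sum_2)

lemma polar_nth [simp]: "polar r \<phi> $ 1 = r * cos \<phi>" "polar r \<phi> $ 2 = r * sin \<phi>"
  by (simp_all add: polar_def)

lemma norm_polar: "r \<ge> 0 \<Longrightarrow> norm (polar r \<phi>) = r"
proof -
  assume "r \<ge> 0"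
  have "(r * cos \<phi>)\<^sup>2 + (r * sin \<phi>)\<^sup>2 = r\<^sup>2 * ((sin \<phi>)\<^sup>2 + (cos \<phi>)\<^sup>2)"
    by (simp only: power_mult_distrib distrib_left add.commute)
  then show ?thesis using \<open>r \<ge> 0\<close> by (simp add: norm_vec2)
qed

lemma azimuth_polar:
  assumes "r > 0" "\<bar>\<phi>\<bar> < pi / 2"
  shows "azimuth (polar r \<phi>) = \<phi>"
proof -
  have "r * sin \<phi> / (r * cos \<phi>) = tan \<phi>" using assms by (simp add: tan_def)
  then show ?thesis unfolding azimuth_def using assms arctan_tan[of \<phi>] by simp
qed

lemma cos_azimuth: "z $ 1 > 0 \<Longrightarrow> norm z * cos (azimuth z) = z $ 1"
  and sin_azimuth: "z $ 1 > 0 \<Longrightarrow> norm z * sin (azimuth z) = z $ 2"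
proof -
  assume z: "z $ 1 > 0"
  have "1 + (z $ 2 / z $ 1)\<^sup>2 = ((z $ 1)\<^sup>2 + (z $ 2)\<^sup>2) / (z $ 1)\<^sup>2"
    using z by (simp add: field_simps)
  then have s: "sqrt (1 + (z $ 2 / z $ 1)\<^sup>2) = norm z / z $ 1"
    using z by (simp add: norm_vec2 real_sqrt_divide)
  have n: "norm z > 0" using z by auto
  show "norm z * cos (azimuth z) = z $ 1" using z n by (simp add: azimuth_def cos_arctan s)
  show "norm z * sin (azimuth z) = z $ 2" using z n by (simp add: azimuth_def sin_arctan s)
qed

lemma polar_norm_azimuth: "z $ 1 > 0 \<Longrightarrow> polar (norm z) (azimuth z) = z"
  by (simp add: vec_eq_iff forall_2 cos_azimuth sin_azimuth)

lemma abs_azimuth_less: "\<bar>azimuth z\<bar> < pi / 2"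
  unfolding azimuth_def using arctan_bounded[of "z $ 2 / z $ 1"] by linarith

lemma polar_frame_nth:
  "polar_frame 1 u $ 1 = cos (u $ 2)" "polar_frame 1 u $ 2 = sin (u $ 2)"
  "polar_frame 2 u $ 1 = - (u $ 1) * sin (u $ 2)" "polar_frame 2 u $ 2 = u $ 1 * cos (u $ 2)"
  by (simp_all add: polar_frame_def)

lemma has_derivative_vec2I:
  fixes f :: "'a::real_normed_vector \<Rightarrow> real^2"
  assumes "((\<lambda>z. f z $ 1) has_derivative (\<lambda>h. f' h $ 1)) (at x within S)"
    and "((\<lambda>z. f z $ 2) has_derivative (\<lambda>h. f' h $ 2)) (at x within S)"
  shows "(f has_derivative f') (at x within S)"
proof -
  have "((\<lambda>z. (f z $ 1) *\<^sub>R axis 1 1 + (f z $ 2) *\<^sub>R axis 2 1 :: real^2) has_derivative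
         (\<lambda>h. (f' h $ 1) *\<^sub>R axis 1 1 + (f' h $ 2) *\<^sub>R axis 2 1)) (at x within S)"
    by (intro has_derivative_add has_derivative_scaleR_left assms)
  then show ?thesis by (simp add: vec2_eq_axis[symmetric])
qed

lemma has_derivative_nth: "((\<lambda>z :: real^2. z $ i) has_derivative (\<lambda>h. h $ i)) (at x within S)"
  by (rule bounded_linear_imp_has_derivative[OF bounded_linear_vec_nth])

definition polar_diff :: "real^2 \<Rightarrow> real^2 \<Rightarrow> real^2" where
  "polar_diff z \<xi> = \<xi> $ 1 *\<^sub>R polar_frame 1 z + \<xi> $ 2 *\<^sub>R polar_frame 2 z"

lemma has_derivative_polar:
  "((\<lambda>z. polar (z $ 1) (z $ 2)) has_derivative polar_diff z) (at z)"
  by (rule has_derivative_vec2I)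
     (auto intro!: has_derivative_nth derivative_eq_intros simp: polar_diff_def polar_frame_nth fun_eq_iff algebra_simps)

lemma has_derivative_polar_diff:
  "((\<lambda>z. polar_diff z \<xi>) has_derivative
     (\<lambda>h. vector [- \<xi> $ 1 * sin (z $ 2) * h $ 2 - \<xi> $ 2 * (h $ 1 * sin (z $ 2) + z $ 1 * cos (z $ 2) * h $ 2),
                 \<xi> $ 1 * cos (z $ 2) * h $ 2 + \<xi> $ 2 * (h $ 1 * cos (z $ 2) - z $ 1 * sin (z $ 2) * h $ 2)])) (at z)"
  by (rule has_derivative_vec2I)
     (auto intro!: has_derivative_nth derivative_eq_intros simp: polar_diff_def polar_frame_nth fun_eq_iff algebra_simps)

lemma polar_gram_symmetric:
  "transpose (G (polar (z $ 1) (z $ 2))) = G (polar (z $ 1) (z $ 2)) \<Longrightarrow> polar_gram G i j z = polar_gram G j i z"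
  unfolding polar_gram_def by (rule bil_symmetric)

lemma bil_polar_diff:
  "bil (G (polar (z $ 1) (z $ 2))) (polar_diff z \<xi>) (polar_diff z \<eta>) =
     \<xi> $ 1 * \<eta> $ 1 * polar_gram G 1 1 z + \<xi> $ 1 * \<eta> $ 2 * polar_gram G 1 2 z
   + \<xi> $ 2 * \<eta> $ 1 * polar_gram G 2 1 z + \<xi> $ 2 * \<eta> $ 2 * polar_gram G 2 2 z"
  by (simp add: polar_gram_def polar_diff_def bil_2 algebra_simps)

lemma differentiable_polar_gram:
  assumes "G differentiable (at (polar (z $ 1) (z $ 2)))"
  shows "polar_gram G i j differentiable (at z)"
proof -
  obtain D where D: "(G has_derivative D) (at (polar (z $ 1) (z $ 2)))"
    using assms differentiable_def by blast
  have G: "(\<lambda>z. G (polar (z $ 1) (z $ 2)) $ k $ l) differentiable (at z)" for k l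
    using bounded_linear.has_derivative[OF bounded_linear_vec_nth bounded_linear.has_derivative[OF bounded_linear_vec_nth
        has_derivative_compose[OF has_derivative_polar D]]] differentiable_def by blast
  have f: "(\<lambda>z. polar_frame i z $ k) differentiable (at z)" for i k
  proof -
    have c: "((\<lambda>z. cos (z $ 2)) has_derivative (\<lambda>h. - sin (z $ 2) * h $ 2)) (at z)"
      and s: "((\<lambda>z. sin (z $ 2)) has_derivative (\<lambda>h. cos (z $ 2) * h $ 2)) (at z)"
      and r: "((\<lambda>z. z $ 1) has_derivative (\<lambda>h. h $ 1)) (at z)" for z :: "real^2"
      by (auto intro!: has_derivative_nth derivative_eq_intros simp: fun_eq_iff)
    have d: "(\<lambda>z. cos (z $ 2)) differentiable (at z)" "(\<lambda>z. sin (z $ 2)) differentiable (at z)"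
       "(\<lambda>z. z $ 1) differentiable (at z)" for z :: "real^2"
      using c s r differentiable_def by blast+
    show ?thesis using exhaust_2[of i] exhaust_2[of k]
      by (auto simp: polar_frame_nth intro!: derivative_intros d)
  qed
  show ?thesis unfolding polar_gram_def bil_2 by (intro derivative_intros G f)
qed

text \<open>The Euler--Lagrange equation pulled back along \<open>(r, \<phi>) \<mapsto> polar r \<phi>\<close> and tested against
  \<open>\<partial>\<^sub>\<phi>\<close> is the evolution law of the angular momentum \<open>g(y', \<partial>\<^sub>\<phi>)\<close>: third claim. The last claim is
  the squared speed in polar coordinates.\<close>

lemma euler_lagrange_polar:
  fixes G :: "real^2 \<Rightarrow> real^2^2" and y w :: "real \<Rightarrow> real^2"
  defines "r \<equiv> \<lambda>s. norm (y s)" and "\<phi> \<equiv> \<lambda>s. azimuth (y s)"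
    and "r' \<equiv> \<lambda>s. (y s \<bullet> w s) / norm (y s)"
    and "\<phi>' \<equiv> \<lambda>s. (y s $ 1 * w s $ 2 - y s $ 2 * w s $ 1) / (norm (y s))\<^sup>2"
  defines "u \<equiv> \<lambda>s. vector [r s, \<phi> s]"
  assumes EL: "euler_lagrange_at (\<lambda>z. bil (G z)) I y w t" and t: "t \<in> I"
    and sym: "\<And>z. z \<noteq> 0 \<Longrightarrow> transpose (G z) = G z"
    and diff: "\<And>z. z \<noteq> 0 \<Longrightarrow> G differentiable (at z)"
    and y: "(y has_vector_derivative w t) (at t within I)" and pos: "y t $ 1 > 0"
  shows "(r has_real_derivative r' t) (at t within I)"
    and "(\<phi> has_real_derivative \<phi>' t) (at t within I)"
    and "((\<lambda>s. r' s * polar_gram G 1 2 (u s) + \<phi>' s * polar_gram G 2 2 (u s)) has_real_derivative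
       ((r' t)\<^sup>2 * pd 2 (polar_gram G 1 1) (u t) + 2 * r' t * \<phi>' t * pd 2 (polar_gram G 1 2) (u t)
          + (\<phi>' t)\<^sup>2 * pd 2 (polar_gram G 2 2) (u t)) / 2) (at t within I)"
    and "bil (G (y t)) (w t) (w t) = (r' t)\<^sup>2 * polar_gram G 1 1 (u t)
       + 2 * r' t * \<phi>' t * polar_gram G 1 2 (u t) + (\<phi>' t)\<^sup>2 * polar_gram G 2 2 (u t)"
proof -
  define \<nu> :: "real \<Rightarrow> real^2" where "\<nu> s = vector [r' s, \<phi>' s]" for s
  define F :: "real^2 \<Rightarrow> real^2" where "F z = polar (z $ 1) (z $ 2)" for z
  let ?U = "{z :: real^2. z $ 1 > 0}"
  have opU: "open ?U" by (intro open_Collect_less continuous_intros)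
  have yc: "(y \<longlongrightarrow> y t) (at t within I)"
    using has_vector_derivative_continuous[OF y] by (simp add: continuous_within)
  have near: "\<forall>\<^sub>F s in at t within I. y s $ 1 > 0"
    using topological_tendstoD[OF yc opU] pos by simp
  have y1: "((\<lambda>s. y s $ 1) has_real_derivative w t $ 1) (at t within I)"
   and y2: "((\<lambda>s. y s $ 2) has_real_derivative w t $ 2) (at t within I)"
    using bounded_linear.has_vector_derivative[OF bounded_linear_vec_nth y]
    by (simp_all add: has_real_derivative_iff_has_vector_derivative)
  have yt0: "y t \<noteq> 0" "norm (y t) > 0" using pos by auto
  have sq: "(norm z)\<^sup>2 = (z $ 1)\<^sup>2 + (z $ 2)\<^sup>2" for z :: "real^2" by (simp add: norm_vec2)
  have rd: "(r has_real_derivative r' t) (at t within I)"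
  proof -
    have p: "(y t $ 1)\<^sup>2 + (y t $ 2)\<^sup>2 > 0" using pos by (simp add: add_pos_nonneg)
    have "((\<lambda>s. (y s $ 1)\<^sup>2 + (y s $ 2)\<^sup>2) has_real_derivative 2 * (y t \<bullet> w t)) (at t within I)"
      by (rule derivative_eq_intros y1 y2 refl)+ (simp add: inner_vec_def sum_2)
    from DERIV_chain2[OF DERIV_real_sqrt[OF p] this] show ?thesis
      unfolding r_def r'_def norm_vec2 by (simp add: field_simps)
  qed
  have \<phi>d: "(\<phi> has_real_derivative \<phi>' t) (at t within I)"
  proof -
    have inv: "inverse (1 + (y t $ 2 / y t $ 1)\<^sup>2) = (y t $ 1)\<^sup>2 / (norm (y t))\<^sup>2"
      using pos by (simp add: sq field_simps)
    have cancel: "a\<^sup>2 / N * (X / (a * a)) = X / N" if "a \<noteq> 0" for a N X :: real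
      using that by (simp add: power2_eq_square)
    have e: "inverse (1 + (y t $ 2 / y t $ 1)\<^sup>2) * ((w t $ 2 * y t $ 1 - y t $ 2 * w t $ 1) / (y t $ 1 * y t $ 1)) = \<phi>' t"
      unfolding inv \<phi>'_def using pos by (subst cancel) (auto simp: mult.commute)
    show ?thesis unfolding \<phi>_def azimuth_def e[symmetric]
      by (rule derivative_eq_intros y1 y2 refl | use pos in simp)+
  qed
  have F_u: "y s = F (u s)" if "y s $ 1 > 0" for s
    using polar_norm_azimuth[OF that] by (simp add: F_def u_def r_def \<phi>_def)
  have F'_\<nu>: "w s = polar_diff (u s) (\<nu> s)" if p: "y s $ 1 > 0" for s
  proof -
    have n: "norm (y s) > 0" using p by auto
    have c: "cos (azimuth (y s)) = y s $ 1 / norm (y s)" and sn: "sin (azimuth (y s)) = y s $ 2 / norm (y s)"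
      using cos_azimuth[OF p] sin_azimuth[OF p] n by (auto simp: field_simps)
    have "w s $ 1 * (norm (y s))\<^sup>2 = (y s \<bullet> w s) * y s $ 1 - (y s $ 1 * w s $ 2 - y s $ 2 * w s $ 1) * y s $ 2"
      "w s $ 2 * (norm (y s))\<^sup>2 = (y s \<bullet> w s) * y s $ 2 + (y s $ 1 * w s $ 2 - y s $ 2 * w s $ 1) * y s $ 1"
      unfolding sq by (simp_all add: inner_vec_def sum_2 algebra_simps power2_eq_square)
    then have "w s $ 1 = ((y s \<bullet> w s) * y s $ 1 - (y s $ 1 * w s $ 2 - y s $ 2 * w s $ 1) * y s $ 2) / (norm (y s))\<^sup>2"
      "w s $ 2 = ((y s \<bullet> w s) * y s $ 2 + (y s $ 1 * w s $ 2 - y s $ 2 * w s $ 1) * y s $ 1) / (norm (y s))\<^sup>2"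
      using n by (simp_all add: field_simps)
    moreover have "polar_diff (u s) (\<nu> s) $ 1 = ((y s \<bullet> w s) * y s $ 1 - (y s $ 1 * w s $ 2 - y s $ 2 * w s $ 1) * y s $ 2) / (norm (y s))\<^sup>2"
      "polar_diff (u s) (\<nu> s) $ 2 = ((y s \<bullet> w s) * y s $ 2 + (y s $ 1 * w s $ 2 - y s $ 2 * w s $ 1) * y s $ 1) / (norm (y s))\<^sup>2"
      using n by (simp_all add: polar_diff_def polar_frame_nth u_def \<nu>_def r_def \<phi>_def r'_def \<phi>'_def c sn
          power2_eq_square diff_divide_distrib add_divide_distrib) (simp_all add: diff_divide_distrib[symmetric])
    ultimately show ?thesis by (simp add: vec_eq_iff forall_2)
  qed
  have uU: "u t \<in> ?U" using pos yt0 by (simp add: u_def r_def)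
  have ud: "(u has_vector_derivative \<nu> t) (at t within I)"
    unfolding has_vector_derivative_def
    by (rule has_derivative_vec2I)
       (use rd \<phi>d in \<open>simp_all add: u_def \<nu>_def has_field_derivative_def mult.commute[of _ "r' t"] mult.commute[of _ "\<phi>' t"]\<close>)
  have Gd: "(\<lambda>z. bil (G z) (axis i 1) (axis j 1)) differentiable (at (y t))" for i j
  proof -
    obtain D where "(G has_derivative D) (at (y t))" using diff yt0 differentiable_def by blast
    then have "((\<lambda>z. G z $ k $ l) has_derivative (\<lambda>h. D h $ k $ l)) (at (y t))" for k l
      by (intro bounded_linear.has_derivative[OF bounded_linear_vec_nth])
    then have "(\<lambda>z. G z $ k $ l) differentiable (at (y t))" for k l using differentiable_def by blast
    then show ?thesis unfolding bil_2 by (intro derivative_intros)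
  qed
  have Fne: "F z \<noteq> 0" if "z \<in> ?U" for z
    using that norm_polar[of "z $ 1" "z $ 2"] by (auto simp: F_def)
  have "euler_lagrange_at (\<lambda>z \<xi> \<eta>. bil (G (F z)) (polar_diff z \<xi>) (polar_diff z \<eta>)) I u \<nu> t"
  proof (rule euler_lagrange_pullback[where x = y and v = w and V = "- {0}" and U = ?U and u = u and \<nu> = \<nu>])
    show "euler_lagrange_at (\<lambda>z. bil (G z)) I y w t" by (rule EL)
    show "bounded_bilinear (bil (G z))" for z by (rule bounded_bilinear_bil)
    show "bil (G z) \<xi> \<eta> = bil (G z) \<eta> \<xi>" if "z \<in> - {0}" for z \<xi> \<eta>
      by (rule bil_symmetric[OF sym]) (use that in simp)
    show "(\<lambda>z. bil (G z) (axis i 1) (axis j 1)) differentiable (at (y t))" for i j by (rule Gd)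
    show "open ?U" "u t \<in> ?U" "t \<in> I" using opU uU t by auto
    show "F z \<in> - {0}" if "z \<in> ?U" for z using Fne[OF that] by simp
    show "(F has_derivative polar_diff z) (at z)" for z
      unfolding F_def[abs_def] by (rule has_derivative_polar)
    show "((\<lambda>z. polar_diff z \<xi>) has_derivative
     (\<lambda>h. vector [- \<xi> $ 1 * sin (u t $ 2) * h $ 2 - \<xi> $ 2 * (h $ 1 * sin (u t $ 2) + u t $ 1 * cos (u t $ 2) * h $ 2),
                 \<xi> $ 1 * cos (u t $ 2) * h $ 2 + \<xi> $ 2 * (h $ 1 * cos (u t $ 2) - u t $ 1 * sin (u t $ 2) * h $ 2)])) (at (u t))" for \<xi>
      by (rule has_derivative_polar_diff)
    show "(u has_vector_derivative \<nu> t) (at t within I)" by (rule ud)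
    show "\<forall>\<^sub>F s in at t within I. y s = F (u s) \<and> w s = polar_diff (u s) (\<nu> s)"
      using near by eventually_elim (use F_u F'_\<nu> in blast)
    show "y t = F (u t)" "w t = polar_diff (u t) (\<nu> t)" using F_u F'_\<nu> pos by blast+
  qed
  then obtain D where
      D: "((\<lambda>z. bil (G (F z)) (polar_diff z (\<nu> t)) (polar_diff z (\<nu> t))) has_derivative D) (at (u t))"
      and A: "((\<lambda>s. bil (G (F (u s))) (polar_diff (u s) (\<nu> s)) (polar_diff (u s) (axis 2 1))) has_real_derivative D (axis 2 1) / 2) (at t within I)"
    unfolding euler_lagrange_at_def by blast
  have hs: "polar_gram G 2 1 z = polar_gram G 1 2 z" if "z \<in> ?U" for z
    by (rule polar_gram_symmetric, rule sym) (use Fne[OF that] in \<open>simp add: F_def\<close>)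
  have hd: "(polar_gram G i j has_derivative frechet_derivative (polar_gram G i j) (at (u t))) (at (u t))" for i j
    using differentiable_polar_gram[OF diff] Fne[OF uU] frechet_derivative_works unfolding F_def by blast
  have D': "((\<lambda>z. bil (G (F z)) (polar_diff z (\<nu> t)) (polar_diff z (\<nu> t))) has_derivative
     (\<lambda>h. \<nu> t $ 1 * \<nu> t $ 1 * frechet_derivative (polar_gram G 1 1) (at (u t)) h
        + \<nu> t $ 1 * \<nu> t $ 2 * frechet_derivative (polar_gram G 1 2) (at (u t)) h
        + \<nu> t $ 2 * \<nu> t $ 1 * frechet_derivative (polar_gram G 2 1) (at (u t)) h
        + \<nu> t $ 2 * \<nu> t $ 2 * frechet_derivative (polar_gram G 2 2) (at (u t)) h)) (at (u t))"
    unfolding F_def bil_polar_diff by (intro has_derivative_add has_derivative_mult_right hd)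
  have pd21: "pd 2 (polar_gram G 2 1) (u t) = pd 2 (polar_gram G 1 2) (u t)"
  proof -
    have "(polar_gram G 2 1 has_derivative frechet_derivative (polar_gram G 1 2) (at (u t))) (at (u t))"
      by (rule has_derivative_transform_within_open[OF hd opU uU]) (simp add: hs)
    then show ?thesis unfolding pd_def using frechet_derivative_at by metis
  qed
  have "D (axis 2 1) = (r' t)\<^sup>2 * pd 2 (polar_gram G 1 1) (u t) + 2 * r' t * \<phi>' t * pd 2 (polar_gram G 1 2) (u t)
          + (\<phi>' t)\<^sup>2 * pd 2 (polar_gram G 2 2) (u t)"
    unfolding has_derivative_unique[OF D D'] pd_def[symmetric] pd21
    by (simp add: \<nu>_def power2_eq_square algebra_simps pd21[unfolded pd_def] pd_def)
  note A = A[unfolded this]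
  show "((\<lambda>s. r' s * polar_gram G 1 2 (u s) + \<phi>' s * polar_gram G 2 2 (u s)) has_real_derivative
       ((r' t)\<^sup>2 * pd 2 (polar_gram G 1 1) (u t) + 2 * r' t * \<phi>' t * pd 2 (polar_gram G 1 2) (u t)
          + (\<phi>' t)\<^sup>2 * pd 2 (polar_gram G 2 2) (u t)) / 2) (at t within I)"
    using A unfolding F_def bil_polar_diff by (simp add: \<nu>_def axis_def)
  show "bil (G (y t)) (w t) (w t) = (r' t)\<^sup>2 * polar_gram G 1 1 (u t)
       + 2 * r' t * \<phi>' t * polar_gram G 1 2 (u t) + (\<phi>' t)\<^sup>2 * polar_gram G 2 2 (u t)"
    unfolding F_u[OF pos] F'_\<nu>[OF pos] unfolding F_def bil_polar_diff hs[OF uU]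
    by (simp add: \<nu>_def power2_eq_square algebra_simps)
  show "(r has_real_derivative r' t) (at t within I)" "(\<phi> has_real_derivative \<phi>' t) (at t within I)"
    by (rule rd \<phi>d)+
qed

section \<open>Nearly radial motion on a perturbed cone\<close>

lemma difference_bound:
  fixes f g :: "real \<Rightarrow> real"
  assumes "a \<le> b"
    and f: "\<And>t. t \<in> {a..b} \<Longrightarrow> (f has_real_derivative f' t) (at t within {a..b})"
    and g: "\<And>t. t \<in> {a..b} \<Longrightarrow> (g has_real_derivative g' t) (at t within {a..b})"
    and le: "\<And>t. t \<in> {a..b} \<Longrightarrow> \<bar>f' t\<bar> \<le> g' t"
  shows "\<bar>f b - f a\<bar> \<le> g b - g a"
proof (cases "a = b")
  case False
  then have "a < b" using \<open>a \<le> b\<close> by simp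
  have "norm (f b - f a) \<le> g b - g a"
  proof (rule differentiable_bound_general[OF \<open>a < b\<close>])
    show "continuous_on {a..b} f" "continuous_on {a..b} g"
      using f g DERIV_continuous_on by blast+
    show "(f has_vector_derivative f' t) (at t)" "(g has_vector_derivative g' t) (at t)"
      "norm (f' t) \<le> g' t" if "a < t" "t < b" for t
      using f[of t] g[of t] le[of t] that at_within_Icc_at[of a t b]
      by (auto simp: has_real_derivative_iff_has_vector_derivative)
  qed
  then show ?thesis by simp
qed auto

lemma interval_induction:
  fixes a b :: real
  assumes "a \<le> b" and start: "P a"
    and closed: "\<And>t. a < t \<Longrightarrow> t \<le> b \<Longrightarrow> (\<And>s. a \<le> s \<Longrightarrow> s < t \<Longrightarrow> P s) \<Longrightarrow> P t"
    and open_right: "\<And>t. a \<le> t \<Longrightarrow> t < b \<Longrightarrow> (\<And>s. a \<le> s \<Longrightarrow> s \<le> t \<Longrightarrow> P s) \<Longrightarrow>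
        \<exists>d>0. \<forall>s. t < s \<and> s < t + d \<and> s \<le> b \<longrightarrow> P s"
  shows "t \<in> {a..b} \<Longrightarrow> P t"
proof (rule ccontr)
  assume t: "t \<in> {a..b}" "\<not> P t"
  define B where "B = {s. a \<le> s \<and> s \<le> b \<and> \<not> P s}"
  define c where "c = Inf B"
  have tB: "t \<in> B" using t by (simp add: B_def)
  have bdd: "bdd_below B" by (rule bdd_belowI[of _ a]) (simp add: B_def)
  have c: "a \<le> c" "c \<le> t" unfolding c_def
    using tB bdd by (auto intro!: cInf_greatest cInf_lower simp: B_def)
  have below: "P s" if "a \<le> s" "s < c" for s
    using that c t cInf_lower[OF _ bdd, of s] by (force simp: B_def c_def)
  have Pc: "P c"
    using start closed[of c] below c t by (cases "a = c") auto
  then have "c < t" using t c by (cases "c = t") auto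
  then obtain d where d: "d > 0" "\<And>s. c < s \<Longrightarrow> s < c + d \<Longrightarrow> s \<le> b \<Longrightarrow> P s"
    using open_right[of c] below Pc c t by (metis atLeastAtMost_iff le_less less_le_trans)
  have "c + d \<le> c" unfolding c_def
  proof (rule cInf_greatest)
    show "B \<noteq> {}" using tB by blast
    fix s assume s: "s \<in> B"
    then have "c \<le> s" unfolding c_def by (rule cInf_lower[OF _ bdd])
    then have "c < s" using s Pc by (cases "s = c") (auto simp: B_def)
    then have "\<not> s < c + d" using s d(2)[of s] by (auto simp: B_def)
    then show "Inf B + d \<le> s" by (simp add: c_def)
  qed
  then show False using d(1) by simp
qed

text \<open>In the cone \<open>|r \<phi>'| \<le> r'\<close> the speed \<open>L\<close> and the radial velocity are comparable. In this lemma
  \<open>x\<close> stands for \<open>r'\<close> and \<open>z\<close> for \<open>r \<phi>'\<close>.\<close>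

lemma near_radial_speed:
  fixes e_rr e_pp e_rp x z L \<sigma> :: real
  assumes "\<bar>e_rr\<bar> \<le> 1/8" "\<bar>e_pp\<bar> \<le> 1/8" "\<bar>e_rp\<bar> \<le> 1/8" "\<bar>z\<bar> \<le> x" "0 < \<sigma>" "\<sigma> \<le> 1" "L > 0"
    and E: "(1 + e_rr) * x\<^sup>2 + 2 * e_rp * x * z + \<sigma>\<^sup>2 * (1 + e_pp) * z\<^sup>2 = L\<^sup>2"
  shows "L / 2 \<le> x" "x \<le> 2 * L"
proof -
  have x: "x \<ge> 0" using assms by linarith
  have z2: "z\<^sup>2 \<le> x\<^sup>2" using assms(4) x by (simp add: abs_le_square_iff[symmetric])
  have xz: "\<bar>x * z\<bar> \<le> x\<^sup>2"
    using mult_left_mono[OF assms(4) x] x by (simp add: abs_mult power2_eq_square)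
  have 1: "\<bar>e_rr * x\<^sup>2\<bar> \<le> x\<^sup>2 / 8" using mult_right_mono[OF assms(1), of "x\<^sup>2"] by (simp add: abs_mult)
  have 2: "\<bar>e_rp * (x * z)\<bar> \<le> x\<^sup>2 / 8"
    using mult_mono[OF assms(3) xz] by (simp add: abs_mult)
  have s: "\<sigma>\<^sup>2 \<le> 1" using assms by (simp add: power_le_one)
  have e_pp: "0 \<le> 1 + e_pp" "1 + e_pp \<le> 9/8" using assms by auto
  have z9: "(1 + e_pp) * z\<^sup>2 \<le> 9/8 * x\<^sup>2" using e_pp z2 by (intro mult_mono) auto
  have "\<sigma>\<^sup>2 * ((1 + e_pp) * z\<^sup>2) \<le> 1 * (9/8 * x\<^sup>2)" by (rule mult_mono) (use s e_pp z9 in auto)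
  moreover have "0 \<le> \<sigma>\<^sup>2 * ((1 + e_pp) * z\<^sup>2)" using e_pp by simp
  moreover have "x\<^sup>2 + e_rr * x\<^sup>2 + 2 * (e_rp * (x * z)) + \<sigma>\<^sup>2 * ((1 + e_pp) * z\<^sup>2) = L\<^sup>2"
    using E by (simp add: algebra_simps)
  ultimately have b: "L\<^sup>2 \<le> 4 * x\<^sup>2" "x\<^sup>2 \<le> 4 * L\<^sup>2" using 1 2 by linarith+
  have "L\<^sup>2 \<le> (2 * x)\<^sup>2" "x\<^sup>2 \<le> (2 * L)\<^sup>2" using b by (simp_all add: power_mult_distrib)
  then show "L / 2 \<le> x" "x \<le> 2 * L"
    using x \<open>L > 0\<close> power2_le_imp_le[of L "2 * x"] power2_le_imp_le[of x "2 * L"] by auto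
qed

text \<open>As long as the motion stays in the cone \<open>|r \<phi>'| \<le> r'\<close>, the momentum law gives
  \<open>|A| \<le> |A(a)| + 8 C L r\<^sup>1\<^sup>-\<^sup>\<mu>\<close>. Solving \<open>A = r e\<^sub>r\<^sub>p r' + r\<^sup>2 \<sigma>\<^sup>2 (1 + e\<^sub>p\<^sub>p) \<phi>'\<close> for \<open>\<phi>'\<close> bounds the slope
  by \<open>K a (r(a) / r)\<^sup>\<mu>\<close>, and integrating once more bounds the variation of \<open>\<phi>\<close>. If
  \<open>K a < 1\<close>, the conclusion improves the hypothesis \<open>|r \<phi>'| \<le> r'\<close>; this is used to propagate it. The
  parameter \<open>m\<close> is the initial slope, \<open>C r\<^sup>-\<^sup>\<mu>\<close> the size of the perturbation of the metric.\<close>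

lemma near_radial_estimate:
  fixes r \<phi> r' \<phi>' e_rr e_pp e_rp A' :: "real \<Rightarrow> real" and C m \<sigma> \<mu> R L :: real
  defines "K \<equiv> \<lambda>t. 4 * (12 * C * r t powr - \<mu> + 3 * m) / \<sigma>\<^sup>2"
  assumes ab: "a \<le> b"
    and r: "\<And>t. t \<in> {a..b} \<Longrightarrow> (r has_real_derivative r' t) (at t within {a..b})"
    and \<phi>: "\<And>t. t \<in> {a..b} \<Longrightarrow> (\<phi> has_real_derivative \<phi>' t) (at t within {a..b})"
    and cone: "\<And>t. t \<in> {a..b} \<Longrightarrow> \<bar>r t * \<phi>' t\<bar> \<le> r' t"
    and \<mu>: "0 < \<mu>" "\<mu> \<le> 1/2" and \<sigma>: "0 < \<sigma>" "\<sigma> \<le> 1"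
    and C: "0 \<le> C" "C * R powr - \<mu> \<le> 1/8" and R: "1 \<le> R" "R \<le> r a"
    and e: "\<And>t. t \<in> {a..b} \<Longrightarrow> R \<le> r t \<Longrightarrow>
        \<bar>e_rr t\<bar> \<le> C * r t powr - \<mu> \<and> \<bar>e_pp t\<bar> \<le> C * r t powr - \<mu> \<and> \<bar>e_rp t\<bar> \<le> C * r t powr - \<mu>"
    and L: "L > 0" "\<And>t. t \<in> {a..b} \<Longrightarrow>
        (1 + e_rr t) * (r' t)\<^sup>2 + 2 * e_rp t * r' t * (r t * \<phi>' t) + \<sigma>\<^sup>2 * (1 + e_pp t) * (r t * \<phi>' t)\<^sup>2 = L\<^sup>2"
    and A: "\<And>t. t \<in> {a..b} \<Longrightarrow>
        ((\<lambda>t. r t * e_rp t * r' t + (r t)\<^sup>2 * \<sigma>\<^sup>2 * (1 + e_pp t) * \<phi>' t) has_real_derivative A' t) (at t within {a..b})"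
    and A': "\<And>t. t \<in> {a..b} \<Longrightarrow> R \<le> r t \<Longrightarrow> \<bar>A' t\<bar> \<le> 2 * C * r t powr - \<mu> * (r' t)\<^sup>2"
    and m: "r a * \<bar>\<phi>' a\<bar> \<le> m * r' a"
  shows "r a \<le> r b \<and> r b \<le> r a + 2 * L * (b - a) \<and> L / 2 \<le> r' b
    \<and> \<bar>r b * \<phi>' b\<bar> \<le> K a * r' b \<and> \<bar>\<phi> b - \<phi> a\<bar> \<le> K a / \<mu>"
proof (intro conjI)
  let ?A = "\<lambda>t. r t * e_rp t * r' t + (r t)\<^sup>2 * \<sigma>\<^sup>2 * (1 + e_pp t) * \<phi>' t"
  have sub: "(f has_real_derivative d) (at s within {a..t})"
    if "(f has_real_derivative d) (at s within {a..b})" "t \<in> {a..b}" for f :: "real \<Rightarrow> real" and d s t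
    using that DERIV_subset[of f d s "{a..b}" "{a..t}"] by auto
  have r'0: "0 \<le> r' t" if "t \<in> {a..b}" for t
    using cone[OF that] abs_ge_zero order_trans by blast
  have mono: "r a \<le> r t" if t: "t \<in> {a..b}" for t
  proof -
    have "\<bar>0 - 0 :: real\<bar> \<le> r t - r a"
      by (rule difference_bound[where f = "\<lambda>_. 0" and f' = "\<lambda>_. 0" and g = r and g' = r'])
         (use t r'0 sub[OF r t] in auto)
    then show ?thesis by simp
  qed
  have rR: "R \<le> r t" and r1: "1 \<le> r t" if "t \<in> {a..b}" for t using mono[OF that] R by auto
  have powle: "r t powr - \<mu> \<le> R powr - \<mu>" if "t \<in> {a..b}" for t
    using rR[OF that] R \<mu> by (intro powr_mono2') auto
  have small: "C * r t powr - \<mu> \<le> 1/8" if "t \<in> {a..b}" for t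
    using mult_left_mono[OF powle[OF that] C(1)] C(2) by linarith
  have speed: "L / 2 \<le> r' t" "r' t \<le> 2 * L" if t: "t \<in> {a..b}" for t
    using near_radial_speed[of "e_rr t" "e_pp t" "e_rp t" "r t * \<phi>' t" "r' t" \<sigma> L]
      e[OF t rR[OF t]] small[OF t] cone[OF t] \<sigma> L(1) L(2)[OF t] by auto
  have aI: "a \<in> {a..b}" and bI: "b \<in> {a..b}" using ab by auto
  have powA: "((\<lambda>t. 4 * C * L / (1 - \<mu>) * r t powr (1 - \<mu>)) has_real_derivative
      4 * C * L * r t powr - \<mu> * r' t) (at t within {a..b})" if t: "t \<in> {a..b}" for t
    by (rule derivative_eq_intros r[OF t] refl | use r1[OF t] \<mu> in simp)+
  have momentum: "\<bar>?A t\<bar> \<le> \<bar>?A a\<bar> + 8 * C * L * r t powr (1 - \<mu>)" if t: "t \<in> {a..b}" for t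
  proof -
    have "\<bar>?A t - ?A a\<bar> \<le> 4 * C * L / (1 - \<mu>) * r t powr (1 - \<mu>) - 4 * C * L / (1 - \<mu>) * r a powr (1 - \<mu>)"
    proof (rule difference_bound[where f' = A' and g' = "\<lambda>t. 4 * C * L * r t powr - \<mu> * r' t"])
      show "a \<le> t" using t by simp
      fix s assume "s \<in> {a..t}"
      then have s: "s \<in> {a..b}" using t by auto
      show "(?A has_real_derivative A' s) (at s within {a..t})" by (rule sub[OF A[OF s] t])
      show "((\<lambda>t. 4 * C * L / (1 - \<mu>) * r t powr (1 - \<mu>)) has_real_derivative
          4 * C * L * r s powr - \<mu> * r' s) (at s within {a..t})" by (rule sub[OF powA[OF s] t])
      have "(r' s)\<^sup>2 \<le> 2 * L * r' s"
        unfolding power2_eq_square using speed[OF s] r'0[OF s] by (intro mult_right_mono) auto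
      then have "2 * C * r s powr - \<mu> * (r' s)\<^sup>2 \<le> 2 * C * r s powr - \<mu> * (2 * L * r' s)"
        using C by (intro mult_left_mono) auto
      then show "\<bar>A' s\<bar> \<le> 4 * C * L * r s powr - \<mu> * r' s"
        using A'[OF s rR[OF s]] by (simp add: algebra_simps)
    qed
    also have "\<dots> \<le> 4 * C * L / (1 - \<mu>) * r t powr (1 - \<mu>)"
      using C L \<mu> by simp
    also have "\<dots> \<le> 8 * C * L * r t powr (1 - \<mu>)"
    proof (rule mult_right_mono)
      have "4 * C * L * 1 \<le> 4 * C * L * (2 * (1 - \<mu>))"
        using C L \<mu> by (intro mult_left_mono) auto
      then show "4 * C * L / (1 - \<mu>) \<le> 8 * C * L" using \<mu> by (simp add: pos_divide_le_eq algebra_simps)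
    qed simp
    finally show ?thesis by linarith
  qed
  have radial: "\<bar>r t * e_rp t * r' t\<bar> \<le> 2 * C * L * r t powr (1 - \<mu>)" if t: "t \<in> {a..b}" for t
  proof -
    have "\<bar>r t * e_rp t * r' t\<bar> = r t * \<bar>e_rp t\<bar> * r' t"
      using r1[OF t] r'0[OF t] by (simp add: abs_mult)
    also have "\<dots> \<le> r t * (C * r t powr - \<mu>) * (2 * L)"
      using r1[OF t] r'0[OF t] speed[OF t] e[OF t rR[OF t]] C by (intro mult_mono) auto
    also have "\<dots> = 2 * C * L * r t powr (1 - \<mu>)"
      using r1[OF t] by (simp add: powr_diff powr_minus divide_inverse)
    finally show ?thesis .
  qed
  have m0: "m \<ge> 0"
  proof -
    have "0 \<le> m * r' a" using m r1[OF aI] by (meson abs_ge_zero mult_nonneg_nonneg order_trans zero_le_one)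
    then show ?thesis using speed[OF aI] L by (simp add: zero_le_mult_iff)
  qed
  define \<epsilon> where "\<epsilon> = 12 * C * r a powr - \<mu> + 3 * m"
  have Ka: "K a = 4 * \<epsilon> / \<sigma>\<^sup>2" by (simp add: K_def \<epsilon>_def)
  have \<epsilon>0: "\<epsilon> \<ge> 0" using C m0 by (simp add: \<epsilon>_def)
  have start: "\<bar>?A a\<bar> \<le> L * r a * (2 * C * r a powr - \<mu> + 3 * m)"
  proof -
    have e_pp: "0 \<le> 1 + e_pp a" "1 + e_pp a \<le> 3/2" using e[OF aI rR[OF aI]] small[OF aI] by auto
    have "\<bar>(r a)\<^sup>2 * \<sigma>\<^sup>2 * (1 + e_pp a) * \<phi>' a\<bar> = \<sigma>\<^sup>2 * (1 + e_pp a) * (r a * (r a * \<bar>\<phi>' a\<bar>))"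
      using e_pp r1[OF aI] by (simp add: abs_mult power2_eq_square)
    also have "\<dots> \<le> (1 * (3/2)) * (r a * (m * (2 * L)))"
    proof (rule mult_mono)
      show "\<sigma>\<^sup>2 * (1 + e_pp a) \<le> 1 * (3/2)"
        by (rule mult_mono) (use \<sigma> e_pp in \<open>auto simp: power_le_one\<close>)
      have "m * r' a \<le> m * (2 * L)" using speed[OF aI] m0 by (intro mult_left_mono)
      then have "r a * \<bar>\<phi>' a\<bar> \<le> m * (2 * L)" using m by linarith
      then show "r a * (r a * \<bar>\<phi>' a\<bar>) \<le> r a * (m * (2 * L))" using r1[OF aI] by (intro mult_left_mono) auto
    qed (use e_pp r1[OF aI] in auto)
    finally have "\<bar>(r a)\<^sup>2 * \<sigma>\<^sup>2 * (1 + e_pp a) * \<phi>' a\<bar> \<le> L * r a * (3 * m)" by (simp add: algebra_simps)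
    moreover have "2 * C * L * r a powr (1 - \<mu>) = L * r a * (2 * C * r a powr - \<mu>)"
      using r1[OF aI] by (simp add: powr_diff powr_minus divide_inverse)
    ultimately show ?thesis using radial[OF aI] unfolding distrib_left[of "L * r a"] by linarith
  qed
  \<comment> \<open>The initial momentum and the accumulated one are both absorbed into \<open>r q \<epsilon>\<close>, where \<open>q = (r(a) / r)\<^sup>\<mu>\<close>: use \<open>r(a) \<le> r q\<close> and \<open>r\<^sup>1\<^sup>-\<^sup>\<mu> = r(a)\<^sup>-\<^sup>\<mu> r q\<close>.\<close>
  have slope: "\<bar>r t * \<phi>' t\<bar> \<le> K a * (r a powr \<mu> * r t powr - \<mu>) * r' t" if t: "t \<in> {a..b}" for t
  proof -
    define q where "q = r a powr \<mu> * r t powr - \<mu>"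
    have q0: "q \<ge> 0" by (simp add: q_def)
    have ra: "r a \<le> r t * q"
    proof -
      have "r a powr (1 - \<mu>) \<le> r t powr (1 - \<mu>)" using mono[OF t] r1[OF aI] \<mu> by (intro powr_mono2) auto
      then have "r a powr \<mu> * r a powr (1 - \<mu>) \<le> r a powr \<mu> * r t powr (1 - \<mu>)"
        by (rule mult_left_mono) simp
      then show ?thesis using r1[OF aI] r1[OF t]
        by (simp add: q_def powr_add[symmetric] powr_diff powr_minus divide_inverse algebra_simps)
    qed
    have rt: "r t powr (1 - \<mu>) = r a powr - \<mu> * (r t * q)"
      using r1[OF aI] r1[OF t] by (simp add: q_def powr_diff powr_minus divide_inverse)
    have e_pp: "1 / 2 \<le> 1 + e_pp t" using e[OF t rR[OF t]] small[OF t] by auto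
    have "1 / 2 * (\<sigma>\<^sup>2 * (r t * \<bar>r t * \<phi>' t\<bar>)) \<le> (1 + e_pp t) * (\<sigma>\<^sup>2 * (r t * \<bar>r t * \<phi>' t\<bar>))"
      using e_pp r1[OF t] by (intro mult_right_mono) auto
    also have "\<dots> = \<bar>(r t)\<^sup>2 * \<sigma>\<^sup>2 * (1 + e_pp t) * \<phi>' t\<bar>"
      using e_pp r1[OF t] by (simp add: abs_mult power2_eq_square)
    also have "\<dots> \<le> \<bar>?A t\<bar> + 2 * C * L * r t powr (1 - \<mu>)" using radial[OF t] by linarith
    also have "\<dots> \<le> L * r a * (2 * C * r a powr - \<mu> + 3 * m) + 10 * C * L * r t powr (1 - \<mu>)"
      using momentum[OF t] start by linarith
    also have "\<dots> \<le> L * (r t * q) * (2 * C * r a powr - \<mu> + 3 * m) + 10 * C * L * r t powr (1 - \<mu>)"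
      using ra L C m0 by (intro add_right_mono mult_right_mono mult_left_mono) auto
    also have "\<dots> = r t * (L * q * \<epsilon>)" unfolding rt \<epsilon>_def by (simp add: algebra_simps)
    also have "\<dots> \<le> r t * (2 * r' t * q * \<epsilon>)"
      using speed[OF t] q0 \<epsilon>0 r1[OF t] by (intro mult_left_mono mult_right_mono) auto
    finally have "r t * (\<sigma>\<^sup>2 * \<bar>r t * \<phi>' t\<bar>) \<le> r t * (4 * r' t * q * \<epsilon>)" by (simp add: algebra_simps)
    then have "\<sigma>\<^sup>2 * \<bar>r t * \<phi>' t\<bar> \<le> 4 * r' t * q * \<epsilon>" using r1[OF t] by simp
    then have "\<bar>r t * \<phi>' t\<bar> \<le> 4 * r' t * q * \<epsilon> / \<sigma>\<^sup>2" using \<sigma> by (simp add: pos_le_divide_eq mult.commute)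
    then show ?thesis by (simp add: Ka q_def algebra_simps)
  qed
  have q1: "r a powr \<mu> * r t powr - \<mu> \<le> 1" if t: "t \<in> {a..b}" for t
  proof -
    have "r a powr \<mu> * r t powr - \<mu> \<le> r t powr \<mu> * r t powr - \<mu>"
      using mono[OF t] r1[OF aI] \<mu> by (intro mult_right_mono powr_mono2) auto
    then show ?thesis using r1[OF t] by (simp add: powr_minus)
  qed
  have K0: "K a \<ge> 0" using \<epsilon>0 by (simp add: Ka)
  show "r a \<le> r b" by (rule mono[OF bI])
  show "L / 2 \<le> r' b" by (rule speed[OF bI])
  have "\<bar>r b - r a\<bar> \<le> 2 * L * b - 2 * L * a"
    by (rule difference_bound[OF ab r, where g = "\<lambda>t. 2 * L * t" and g' = "\<lambda>_. 2 * L"])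
       (use speed r'0 in \<open>auto intro!: derivative_eq_intros\<close>)
  then show "r b \<le> r a + 2 * L * (b - a)" by (simp add: algebra_simps)
  have "K a * (r a powr \<mu> * r b powr - \<mu>) * r' b \<le> K a * 1 * r' b"
    using q1[OF bI] K0 r'0[OF bI] by (intro mult_right_mono mult_left_mono) auto
  then show "\<bar>r b * \<phi>' b\<bar> \<le> K a * r' b" using slope[OF bI] by simp
  have "\<bar>\<phi> b - \<phi> a\<bar> \<le> - (K a / \<mu> * r a powr \<mu>) * r b powr - \<mu> - - (K a / \<mu> * r a powr \<mu>) * r a powr - \<mu>"
  proof (rule difference_bound[OF ab \<phi>, where g' = "\<lambda>t. K a * r a powr \<mu> * r t powr (- \<mu> - 1) * r' t"])
    fix t assume t: "t \<in> {a..b}"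
    show "((\<lambda>t. - (K a / \<mu> * r a powr \<mu>) * r t powr - \<mu>) has_real_derivative
        K a * r a powr \<mu> * r t powr (- \<mu> - 1) * r' t) (at t within {a..b})"
      by (rule derivative_eq_intros r[OF t] refl | use r1[OF t] \<mu> in simp)+
    have "r t * \<bar>\<phi>' t\<bar> \<le> r t * (K a * r a powr \<mu> * r t powr (- \<mu> - 1) * r' t)"
      using slope[OF t] r1[OF t] by (simp add: abs_mult powr_diff algebra_simps)
    then show "\<bar>\<phi>' t\<bar> \<le> K a * r a powr \<mu> * r t powr (- \<mu> - 1) * r' t" using r1[OF t] by simp
  qed
  also have "\<dots> \<le> K a / \<mu> * r a powr \<mu> * r a powr - \<mu>" using K0 \<mu> by simp
  also have "\<dots> = K a / \<mu>" using r1[OF aI] by (simp add: powr_minus)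
  finally show "\<bar>\<phi> b - \<phi> a\<bar> \<le> K a / \<mu>" .
qed

section \<open>Geodesics in the conical end\<close>

text \<open>The part of the asymptotics that controls the angular momentum: the coefficients of the metric and
  their \<open>\<phi>\<close>-derivatives. The rate is capped at \<open>1/2\<close>, so that \<open>\<integral> r\<^sup>-\<^sup>\<mu> dr\<close> is at most
  \<open>2 r\<^sup>1\<^sup>-\<^sup>\<mu>\<close>, and the radius \<open>R\<close> is so large that the perturbation is at most \<open>1/8\<close>
  beyond it.\<close>

definition conical_bounds :: "(real^2 \<Rightarrow> real^2^2) \<Rightarrow> real \<Rightarrow> real \<Rightarrow> real \<Rightarrow> real \<Rightarrow> bool" where
  "conical_bounds G \<sigma> \<mu> C R \<longleftrightarrow>
     0 < \<sigma> \<and> \<sigma> \<le> 1 \<and> 0 < \<mu> \<and> \<mu> \<le> 1/2 \<and> 0 \<le> C \<and> 1 \<le> R \<and> C * R powr - \<mu> \<le> 1/8 \<and>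
     (\<forall>u. R \<le> u $ 1 \<longrightarrow>
        \<bar>polar_gram G 1 1 u - 1\<bar> \<le> C * u $ 1 powr - \<mu> \<and>
        \<bar>polar_gram G 2 2 u / ((u $ 1)\<^sup>2 * \<sigma>\<^sup>2) - 1\<bar> \<le> C * u $ 1 powr - \<mu> \<and>
        \<bar>polar_gram G 1 2 u / u $ 1\<bar> \<le> C * u $ 1 powr - \<mu> \<and>
        \<bar>pd 2 (polar_gram G 1 1) u\<bar> \<le> C * u $ 1 powr - \<mu> \<and>
        \<bar>pd 2 (polar_gram G 2 2) u\<bar> \<le> C * u $ 1 powr - \<mu> * ((u $ 1)\<^sup>2 * \<sigma>\<^sup>2) \<and>
        \<bar>pd 2 (polar_gram G 1 2) u\<bar> \<le> C * u $ 1 powr - \<mu> * u $ 1)"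

text \<open>Radial factors are constant for the differentiation in \<open>\<phi>\<close>; thus the bounds on the normalized
  coefficients give bounds on the coefficients of the metric.\<close>

lemma pd_2_mult_radial:
  assumes f: "f differentiable (at u)" and q: "(q has_real_derivative q') (at (u $ 1))"
  shows "pd 2 (\<lambda>u. f u * q (u $ 1) - c) u = pd 2 f u * q (u $ 1)"
proof -
  have f': "(f has_derivative frechet_derivative f (at u)) (at u)"
    using f frechet_derivative_works by blast
  have q': "((\<lambda>u. q (u $ 1)) has_derivative (\<lambda>h. q' * h $ 1)) (at u)"
    using has_derivative_compose[OF has_derivative_nth q[unfolded has_field_derivative_def]] by simp
  have "((\<lambda>u. f u * q (u $ 1) - c) has_derivative
      (\<lambda>h. f u * (q' * h $ 1) + frechet_derivative f (at u) h * q (u $ 1) - 0)) (at u)"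
    by (intro has_derivative_diff has_derivative_mult f' q' has_derivative_const)
  from frechet_derivative_at[OF this, symmetric] show ?thesis
    by (simp add: pd_def axis_def)
qed

lemma O2_bounds:
  assumes "O2 \<mu> e"
  obtains C R where "\<And>u. R \<le> u $ 1 \<Longrightarrow> \<bar>e u\<bar> \<le> C * u $ 1 powr - \<mu> \<and> \<bar>pd 2 e u\<bar> \<le> C * u $ 1 powr - \<mu>"
proof -
  obtain C R where CR: "\<And>a b u. a + b \<le> 2 \<Longrightarrow> u $ 1 \<ge> R \<Longrightarrow>
      \<bar>(pd 1 ^^ a) ((pd 2 ^^ b) e) u\<bar> \<le> C * (u $ 1) powr (- \<mu> - real a)"
    using assms unfolding O2_def by blast
  show ?thesis
    by (rule that[of R C]) (use CR[of 0 0] CR[of 0 1] in auto)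
qed

lemma asymptotically_conical_bounds:
  assumes "asymptotically_conical M \<Phi> \<alpha> \<mu>"
  obtains \<mu>' C R where "conical_bounds (gram \<Phi>) (sin \<alpha>) \<mu>' C R"
proof -
  let ?h = "polar_gram (gram \<Phi>)" and ?\<sigma> = "sin \<alpha>"
  have \<mu>: "\<mu> > 0" and \<alpha>: "0 < \<alpha>" "\<alpha> \<le> pi / 2"
    and o: "O2 \<mu> (\<lambda>u. ?h 1 1 u - 1)" "O2 \<mu> (\<lambda>u. ?h 2 2 u / ((u $ 1)\<^sup>2 * ?\<sigma>\<^sup>2) - 1)" "O2 \<mu> (\<lambda>u. ?h 1 2 u / u $ 1)"
    and ch: "riemannian_chart \<Phi>" and im: "cimage \<Phi> = - {0}"
    using assms by (auto simp: asymptotically_conical_def riemannian_atlas_def)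
  have \<sigma>: "0 < ?\<sigma>" using \<alpha> by (intro sin_gt_zero) auto
  obtain C1 R1 where 1: "\<And>u. R1 \<le> u $ 1 \<Longrightarrow> \<bar>?h 1 1 u - 1\<bar> \<le> C1 * u $ 1 powr - \<mu> \<and> \<bar>pd 2 (\<lambda>u. ?h 1 1 u - 1) u\<bar> \<le> C1 * u $ 1 powr - \<mu>"
    using O2_bounds[OF o(1)] by blast
  obtain C2 R2 where 2: "\<And>u. R2 \<le> u $ 1 \<Longrightarrow> \<bar>?h 2 2 u / ((u $ 1)\<^sup>2 * ?\<sigma>\<^sup>2) - 1\<bar> \<le> C2 * u $ 1 powr - \<mu>
      \<and> \<bar>pd 2 (\<lambda>u. ?h 2 2 u / ((u $ 1)\<^sup>2 * ?\<sigma>\<^sup>2) - 1) u\<bar> \<le> C2 * u $ 1 powr - \<mu>"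
    using O2_bounds[OF o(2)] by blast
  obtain C3 R3 where 3: "\<And>u. R3 \<le> u $ 1 \<Longrightarrow> \<bar>?h 1 2 u / u $ 1\<bar> \<le> C3 * u $ 1 powr - \<mu>
      \<and> \<bar>pd 2 (\<lambda>u. ?h 1 2 u / u $ 1) u\<bar> \<le> C3 * u $ 1 powr - \<mu>"
    using O2_bounds[OF o(3)] by blast
  define \<mu>' where "\<mu>' = min \<mu> (1/2)"
  define C where "C = Max {C1, C2, C3, 0}"
  have \<mu>': "0 < \<mu>'" "\<mu>' \<le> 1/2" "\<mu>' \<le> \<mu>" using \<mu> by (auto simp: \<mu>'_def)
  have C: "C1 \<le> C" "C2 \<le> C" "C3 \<le> C" "0 \<le> C" by (auto simp: C_def)
  have "((\<lambda>x. C * x powr - \<mu>') \<longlongrightarrow> C * 0) at_top"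
    using \<mu>' by (intro tendsto_mult_left tendsto_neg_powr filterlim_ident) auto
  then have "\<forall>\<^sub>F x in at_top. C * x powr - \<mu>' < 1/8" by (rule order_tendstoD(2)) simp
  then obtain R0 where R0: "\<And>x. R0 \<le> x \<Longrightarrow> C * x powr - \<mu>' < 1/8" by (auto simp: eventually_at_top_linorder)
  define R where "R = Max {R0, R1, R2, R3, 1}"
  have R: "R0 \<le> R" "R1 \<le> R" "R2 \<le> R" "R3 \<le> R" "1 \<le> R" by (auto simp: R_def)
  have "\<bar>?h 1 1 u - 1\<bar> \<le> C * u $ 1 powr - \<mu>' \<and>
        \<bar>?h 2 2 u / ((u $ 1)\<^sup>2 * ?\<sigma>\<^sup>2) - 1\<bar> \<le> C * u $ 1 powr - \<mu>' \<and>
        \<bar>?h 1 2 u / u $ 1\<bar> \<le> C * u $ 1 powr - \<mu>' \<and>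
        \<bar>pd 2 (?h 1 1) u\<bar> \<le> C * u $ 1 powr - \<mu>' \<and>
        \<bar>pd 2 (?h 2 2) u\<bar> \<le> C * u $ 1 powr - \<mu>' * ((u $ 1)\<^sup>2 * ?\<sigma>\<^sup>2) \<and>
        \<bar>pd 2 (?h 1 2) u\<bar> \<le> C * u $ 1 powr - \<mu>' * u $ 1"
    if u: "R \<le> u $ 1" for u
  proof -
    have u1: "1 \<le> u $ 1" using u R by simp
    have le: "x \<le> C * u $ 1 powr - \<mu>'" if "x \<le> c * u $ 1 powr - \<mu>" "c \<le> C" for x c
    proof -
      have "c * u $ 1 powr - \<mu> \<le> C * u $ 1 powr - \<mu>" using that by (intro mult_right_mono) auto
      also have "\<dots> \<le> C * u $ 1 powr - \<mu>'" using u1 \<mu>' C by (intro mult_left_mono powr_mono) auto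
      finally show ?thesis using that by simp
    qed
    have "polar (u $ 1) (u $ 2) \<noteq> 0" using norm_polar[of "u $ 1" "u $ 2"] u1 by auto
    then have d: "?h i j differentiable (at u)" for i j
      using ch im by (intro differentiable_polar_gram smooth_on_differentiable[of "- {0}"])
        (auto simp: riemannian_chart_def)
    have p1: "pd 2 (\<lambda>u. ?h 1 1 u - 1) u = pd 2 (?h 1 1) u"
      using pd_2_mult_radial[of "?h 1 1" u "\<lambda>_. 1" 0 1] d by simp
    have "((\<lambda>x. 1 / (x\<^sup>2 * ?\<sigma>\<^sup>2)) has_real_derivative - (2 * u $ 1 * ?\<sigma>\<^sup>2) / ((u $ 1)\<^sup>2 * ?\<sigma>\<^sup>2)\<^sup>2) (at (u $ 1))"
      by (rule derivative_eq_intros refl | use u1 \<sigma> in \<open>simp add: power2_eq_square\<close>)+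
    from pd_2_mult_radial[OF d this, of 2 2 1]
    have p2: "pd 2 (\<lambda>u. ?h 2 2 u / ((u $ 1)\<^sup>2 * ?\<sigma>\<^sup>2) - 1) u = pd 2 (?h 2 2) u / ((u $ 1)\<^sup>2 * ?\<sigma>\<^sup>2)" by simp
    have "((\<lambda>x. 1 / x) has_real_derivative - 1 / (u $ 1)\<^sup>2) (at (u $ 1))"
      by (rule derivative_eq_intros refl | use u1 in \<open>simp add: power2_eq_square\<close>)+
    from pd_2_mult_radial[OF d this, of 1 2 0]
    have p3: "pd 2 (\<lambda>u. ?h 1 2 u / u $ 1) u = pd 2 (?h 1 2) u / u $ 1" by simp
    note b1 = 1[of u, unfolded p1] and b2 = 2[of u, unfolded p2] and b3 = 3[of u, unfolded p3]
    have Ri: "R1 \<le> u $ 1" "R2 \<le> u $ 1" "R3 \<le> u $ 1" using u R by auto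
    have "\<bar>pd 2 (?h 2 2) u\<bar> / ((u $ 1)\<^sup>2 * ?\<sigma>\<^sup>2) \<le> C * u $ 1 powr - \<mu>'"
      using le[OF conjunct2[OF b2[OF Ri(2)]] C(2)] by (simp add: abs_divide)
    then have q2: "\<bar>pd 2 (?h 2 2) u\<bar> \<le> C * u $ 1 powr - \<mu>' * ((u $ 1)\<^sup>2 * ?\<sigma>\<^sup>2)"
      using u1 \<sigma> by (simp add: pos_divide_le_eq)
    have "\<bar>pd 2 (?h 1 2) u\<bar> / u $ 1 \<le> C * u $ 1 powr - \<mu>'"
      using le[OF conjunct2[OF b3[OF Ri(3)]] C(3)] u1 by (simp add: abs_divide)
    then have q3: "\<bar>pd 2 (?h 1 2) u\<bar> \<le> C * u $ 1 powr - \<mu>' * u $ 1"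
      using u1 by (simp add: pos_divide_le_eq)
    show ?thesis
      using le[OF conjunct1[OF b1[OF Ri(1)]] C(1)] le[OF conjunct2[OF b1[OF Ri(1)]] C(1)]
        le[OF conjunct1[OF b2[OF Ri(2)]] C(2)] le[OF conjunct1[OF b3[OF Ri(3)]] C(3)] q2 q3 by blast
  qed
  then have "conical_bounds (gram \<Phi>) ?\<sigma> \<mu>' C R"
    unfolding conical_bounds_def using \<sigma> \<mu>' C R R0[of R] by auto
  then show ?thesis by (rule that)
qed

lemma compact_sector: "compact {z :: real^2. a \<le> z $ 1 \<and> norm z \<le> b \<and> \<bar>z $ 2\<bar> \<le> k * z $ 1}"
proof (subst compact_eq_bounded_closed, intro conjI)
  show "bounded {z :: real^2. a \<le> z $ 1 \<and> norm z \<le> b \<and> \<bar>z $ 2\<bar> \<le> k * z $ 1}"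
    by (rule boundedI[of _ b]) auto
  show "closed {z :: real^2. a \<le> z $ 1 \<and> norm z \<le> b \<and> \<bar>z $ 2\<bar> \<le> k * z $ 1}"
    by (intro closed_Collect_conj closed_Collect_le continuous_intros)
qed

lemma abs_azimuth_le_iff:
  assumes "z $ 1 > 0" "0 < \<delta>" "\<delta> < pi / 2"
  shows "\<bar>azimuth z\<bar> \<le> \<delta> \<longleftrightarrow> \<bar>z $ 2\<bar> \<le> tan \<delta> * z $ 1"
proof -
  have "\<bar>azimuth z\<bar> = arctan \<bar>z $ 2 / z $ 1\<bar>"
    unfolding azimuth_def by (simp add: abs_if arctan_minus[symmetric] arctan_less_zero_iff)
  also have "(\<dots> \<le> \<delta>) \<longleftrightarrow> \<bar>z $ 2 / z $ 1\<bar> \<le> tan \<delta>"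
    using arctan_le_iff[of "\<bar>z $ 2 / z $ 1\<bar>" "tan \<delta>"] assms by (simp add: arctan_tan)
  finally show ?thesis using assms by (simp add: abs_divide pos_divide_le_eq)
qed

text \<open>Continuity argument. The set of times up to which the geodesic lies in the end, in the sector
  \<open>|\<phi>| \<le> \<delta>\<close> and in the cone \<open>|r \<phi>'| \<le> r'\<close> is closed, because until then the geodesic has remained
  in a compact part of the sector; it is open, because \<open>near_radial_estimate\<close> makes both
  inequalities strict.\<close>

lemma near_radial_geodesic_stays_in_sector:
  fixes M :: "'a::t2_space rchart set" and \<Phi> :: "'a rchart" and \<gamma> :: "real \<Rightarrow> 'a"
  defines "y \<equiv> coord \<Phi> \<circ> \<gamma>"
  defines "w \<equiv> vd {0..1} y"
  defines "r \<equiv> \<lambda>s. norm (y s)" and "\<phi> \<equiv> \<lambda>s. azimuth (y s)"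
    and "r' \<equiv> \<lambda>s. (y s \<bullet> w s) / norm (y s)"
    and "\<phi>' \<equiv> \<lambda>s. (y s $ 1 * w s $ 2 - y s $ 2 * w s $ 1) / (norm (y s))\<^sup>2"
  assumes atlas: "riemannian_atlas (insert \<Phi> M)" and im: "cimage \<Phi> = - {0}"
    and cb: "conical_bounds (gram \<Phi>) \<sigma> \<mu> C R"
    and geo: "geodesic_on M {0..1} \<gamma>"
    and t0: "t0 \<in> {0..1}" "\<gamma> t0 \<in> cdom \<Phi>" "y t0 $ 1 > 0" "R \<le> r t0"
    and out: "r' t0 > 0" and m: "r t0 * \<bar>\<phi>' t0\<bar> \<le> m * r' t0"
    and K: "4 * (12 * C * r t0 powr - \<mu> + 3 * m) / \<sigma>\<^sup>2 \<le> K" "K < 1"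
    and \<delta>: "\<bar>\<phi> t0\<bar> + K / \<mu> < \<delta>" "\<delta> < pi / 2"
  shows "\<gamma> 1 \<in> cdom \<Phi> \<and> y 1 $ 1 > 0 \<and> \<bar>azimuth (y 1)\<bar> \<le> \<delta>"
proof -
  let ?I = "{0..1::real}" and ?h = "polar_gram (gram \<Phi>)"
  have \<sigma>: "0 < \<sigma>" "\<sigma> \<le> 1" and \<mu>: "0 < \<mu>" "\<mu> \<le> 1/2" and C: "0 \<le> C" "C * R powr - \<mu> \<le> 1/8" and R: "1 \<le> R"
    using cb unfolding conical_bounds_def by auto
  have ch: "riemannian_chart \<Phi>" using atlas by (auto simp: riemannian_atlas_def)
  have op: "open (cdom \<Phi>)" and sym: "\<And>z. z \<noteq> 0 \<Longrightarrow> transpose (gram \<Phi> z) = gram \<Phi> z"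
    and pos: "\<And>z v. z \<noteq> 0 \<Longrightarrow> v \<noteq> 0 \<Longrightarrow> bil (gram \<Phi> z) v v > 0"
    and diff: "\<And>z. z \<noteq> 0 \<Longrightarrow> gram \<Phi> differentiable (at z)"
    and hom: "homeomorphism (cdom \<Phi>) (- {0}) (coord \<Phi>) (cinv \<Phi>)"
    using ch im smooth_on_differentiable[of "- {0}" "gram \<Phi>"] by (auto simp: riemannian_chart_def)
  have cont: "continuous_on ?I \<gamma>" using geo by (simp add: geodesic_on_def)
  define u where "u s = (vector [r s, \<phi> s] :: real^2)" for s
  have u: "u s $ 1 = r s" "u s $ 2 = \<phi> s" for s by (simp_all add: u_def)
  define m1 where "m1 = 4 * (12 * C * r t0 powr - \<mu> + 3 * m) / \<sigma>\<^sup>2"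
  have m_nonneg: "0 \<le> m"
  proof -
    have "0 \<le> r t0 * \<bar>\<phi>' t0\<bar>" by (simp add: r_def)
    then have "0 \<le> m * r' t0" using m by linarith
    then show ?thesis using out by (simp add: zero_le_mult_iff)
  qed
  have m1: "0 \<le> m1" "m1 \<le> K" using K C m_nonneg by (auto simp: m1_def)
  have \<delta>0: "0 < \<delta>" using \<delta> m1 \<mu> divide_nonneg_pos[of K \<mu>] by linarith
  define good where "good s \<longleftrightarrow> \<gamma> s \<in> cdom \<Phi> \<and> y s $ 1 > 0 \<and> \<bar>\<phi> s\<bar> \<le> \<delta> \<and> \<bar>r s * \<phi>' s\<bar> \<le> r' s" for s
  have y': "(y has_vector_derivative w s) (at s within ?I)"
    and wc: "continuous (at s within ?I) w"
    and EL: "euler_lagrange_at (\<lambda>z. bil (gram \<Phi> z)) ?I y w s"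
    and E0: "((\<lambda>s. bil (gram \<Phi> (y s)) (w s) (w s)) has_real_derivative 0) (at s within ?I)"
    if "s \<in> ?I" "\<gamma> s \<in> cdom \<Phi>" for s
    using geodesic_in_compatible_chart[OF atlas geo that] by (simp_all add: y_def w_def)
  have yc: "continuous (at s within ?I) y" if "s \<in> ?I" "\<gamma> s \<in> cdom \<Phi>" for s
    using y'[OF that] has_vector_derivative_continuous by blast
  have slope_c: "continuous (at s within ?I) (\<lambda>s. r' s - \<bar>r s * \<phi>' s\<bar>)"
    if "s \<in> ?I" "\<gamma> s \<in> cdom \<Phi>" "y s $ 1 > 0" for s
  proof -
    have "y s \<noteq> 0" using that(3) by auto
    then show ?thesis unfolding r'_def r_def \<phi>'_def
      by (intro continuous_intros continuous_component yc wc that(1,2)) auto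
  qed
  define L where "L = sqrt (bil (gram \<Phi> (y t0)) (w t0) (w t0))"
  have "w t0 \<noteq> 0" "y t0 \<noteq> 0" using out t0(3) by (auto simp: r'_def)
  then have L: "L > 0" "L\<^sup>2 = bil (gram \<Phi> (y t0)) (w t0) (w t0)"
    using pos[of "y t0" "w t0"] by (auto simp: L_def)
  have est: "r t0 \<le> r t \<and> r t \<le> r t0 + 2 * L * (t - t0) \<and> L / 2 \<le> r' t \<and>
      \<bar>r t * \<phi>' t\<bar> \<le> m1 * r' t \<and> \<bar>\<phi> t - \<phi> t0\<bar> \<le> m1 / \<mu>"
    if t: "t0 \<le> t" "t \<le> 1" and g: "\<And>s. t0 \<le> s \<Longrightarrow> s \<le> t \<Longrightarrow> good s" for t
  proof -
    have sI: "s \<in> ?I" and gd: "good s" if "s \<in> {t0..t}" for s using that t t0 g by auto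
    have sub: "(f has_real_derivative d) (at s within {t0..t})"
      if "(f has_real_derivative d) (at s within ?I)" for f d s
      using DERIV_subset[OF that, of "{t0..t}"] t t0 by auto
    have r0: "r s > 0" if "s \<in> {t0..t}" for s using gd[OF that] by (auto simp: good_def r_def)
    have E: "bil (gram \<Phi> (y s)) (w s) (w s) = L\<^sup>2" if s: "s \<in> {t0..t}" for s
    proof -
      have "\<bar>bil (gram \<Phi> (y s)) (w s) (w s) - bil (gram \<Phi> (y t0)) (w t0) (w t0)\<bar> \<le> (0::real) - 0"
      proof (rule difference_bound[where f = "\<lambda>s. bil (gram \<Phi> (y s)) (w s) (w s)" and f' = "\<lambda>_. 0"
              and g = "\<lambda>_. 0" and g' = "\<lambda>_. 0"])
        fix q assume "q \<in> {t0..s}"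
        then have q: "q \<in> {t0..t}" using s by auto
        show "((\<lambda>s. bil (gram \<Phi> (y s)) (w s) (w s)) has_real_derivative 0) (at q within {t0..s})"
          using E0[OF sI[OF q]] gd[OF q] DERIV_subset[of _ _ q ?I "{t0..s}"] s t t0 unfolding good_def by auto
      qed (use s in auto)
      then show ?thesis by (simp add: L)
    qed
    define A' where "A' s = ((r' s)\<^sup>2 * pd 2 (?h 1 1) (u s) + 2 * r' s * \<phi>' s * pd 2 (?h 1 2) (u s)
          + (\<phi>' s)\<^sup>2 * pd 2 (?h 2 2) (u s)) / 2" for s
    have d1: "(r has_real_derivative r' s) (at s within ?I)"
      and d2: "(\<phi> has_real_derivative \<phi>' s) (at s within ?I)"
      and d3: "((\<lambda>s. r' s * ?h 1 2 (u s) + \<phi>' s * ?h 2 2 (u s)) has_real_derivative A' s) (at s within ?I)"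
      and d4: "bil (gram \<Phi> (y s)) (w s) (w s) = (r' s)\<^sup>2 * ?h 1 1 (u s)
       + 2 * r' s * \<phi>' s * ?h 1 2 (u s) + (\<phi>' s)\<^sup>2 * ?h 2 2 (u s)"
      if s: "s \<in> {t0..t}" for s
    proof -
      have g': "\<gamma> s \<in> cdom \<Phi>" "y s $ 1 > 0" using gd[OF s] by (auto simp: good_def)
      note EP = euler_lagrange_polar[OF EL[OF sI[OF s] g'(1)] sI[OF s] sym diff y'[OF sI[OF s] g'(1)] g'(2)]
      show "(r has_real_derivative r' s) (at s within ?I)" "(\<phi> has_real_derivative \<phi>' s) (at s within ?I)"
        "((\<lambda>s. r' s * ?h 1 2 (u s) + \<phi>' s * ?h 2 2 (u s)) has_real_derivative A' s) (at s within ?I)"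
        "bil (gram \<Phi> (y s)) (w s) (w s) = (r' s)\<^sup>2 * ?h 1 1 (u s)
          + 2 * r' s * \<phi>' s * ?h 1 2 (u s) + (\<phi>' s)\<^sup>2 * ?h 2 2 (u s)"
        using EP unfolding r_def \<phi>_def r'_def \<phi>'_def u_def A'_def by blast+
    qed
    show ?thesis unfolding m1_def
    proof (rule near_radial_estimate[where r = r and r' = r' and \<phi> = \<phi> and \<phi>' = \<phi>' and a = t0 and b = t and R = R
          and C = C and \<sigma> = \<sigma> and \<mu> = \<mu> and m = m and L = L and A' = A' and
          e_rr = "\<lambda>s. ?h 1 1 (u s) - 1" and e_pp = "\<lambda>s. ?h 2 2 (u s) / ((r s)\<^sup>2 * \<sigma>\<^sup>2) - 1" and e_rp = "\<lambda>s. ?h 1 2 (u s) / r s"])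
      show "t0 \<le> t" "0 < \<mu>" "\<mu> \<le> 1/2" "0 < \<sigma>" "\<sigma> \<le> 1" "0 \<le> C" "C * R powr - \<mu> \<le> 1/8" "1 \<le> R" "R \<le> r t0"
        "L > 0" "r t0 * \<bar>\<phi>' t0\<bar> \<le> m * r' t0" by fact+
      fix s assume s: "s \<in> {t0..t}"
      have rs: "r s > 0" by (rule r0[OF s])
      show "(r has_real_derivative r' s) (at s within {t0..t})" "(\<phi> has_real_derivative \<phi>' s) (at s within {t0..t})"
        by (intro sub d1 d2 s)+
      show cone: "\<bar>r s * \<phi>' s\<bar> \<le> r' s" using gd[OF s] by (simp add: good_def)
      show "(1 + (?h 1 1 (u s) - 1)) * (r' s)\<^sup>2 + 2 * (?h 1 2 (u s) / r s) * r' s * (r s * \<phi>' s) +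
         \<sigma>\<^sup>2 * (1 + (?h 2 2 (u s) / ((r s)\<^sup>2 * \<sigma>\<^sup>2) - 1)) * (r s * \<phi>' s)\<^sup>2 = L\<^sup>2"
        using d4[OF s] E[OF s] rs \<sigma> by (simp add: power_mult_distrib algebra_simps)
      have eq: "r q * (?h 1 2 (u q) / r q) * r' q + (r q)\<^sup>2 * \<sigma>\<^sup>2 * (1 + (?h 2 2 (u q) / ((r q)\<^sup>2 * \<sigma>\<^sup>2) - 1)) * \<phi>' q
          = r' q * ?h 1 2 (u q) + \<phi>' q * ?h 2 2 (u q)" if "q \<in> {t0..t}" for q
        using r0[OF that] \<sigma> by simp
      have "((\<lambda>t. r t * (?h 1 2 (u t) / r t) * r' t + (r t)\<^sup>2 * \<sigma>\<^sup>2 * (1 + (?h 2 2 (u t) / ((r t)\<^sup>2 * \<sigma>\<^sup>2) - 1)) * \<phi>' t)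
         has_derivative (*) (A' s)) (at s within {t0..t})"
        by (rule has_derivative_transform[OF s eq sub[OF d3[OF s], unfolded has_field_derivative_def]])
      then show "((\<lambda>t. r t * (?h 1 2 (u t) / r t) * r' t + (r t)\<^sup>2 * \<sigma>\<^sup>2 * (1 + (?h 2 2 (u t) / ((r t)\<^sup>2 * \<sigma>\<^sup>2) - 1)) * \<phi>' t)
         has_real_derivative A' s) (at s within {t0..t})" by (simp add: has_field_derivative_def)
      assume "R \<le> r s"
      then have b: "\<bar>?h 1 1 (u s) - 1\<bar> \<le> C * r s powr - \<mu>"
        "\<bar>?h 2 2 (u s) / ((r s)\<^sup>2 * \<sigma>\<^sup>2) - 1\<bar> \<le> C * r s powr - \<mu>"
        "\<bar>?h 1 2 (u s) / r s\<bar> \<le> C * r s powr - \<mu>"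
        "\<bar>pd 2 (?h 1 1) (u s)\<bar> \<le> C * r s powr - \<mu>"
        "\<bar>pd 2 (?h 2 2) (u s)\<bar> \<le> C * r s powr - \<mu> * ((r s)\<^sup>2 * \<sigma>\<^sup>2)"
        "\<bar>pd 2 (?h 1 2) (u s)\<bar> \<le> C * r s powr - \<mu> * r s"
        using cb u[of s] unfolding conical_bounds_def by metis+
      show "\<bar>?h 1 1 (u s) - 1\<bar> \<le> C * r s powr - \<mu> \<and> \<bar>?h 2 2 (u s) / ((r s)\<^sup>2 * \<sigma>\<^sup>2) - 1\<bar> \<le> C * r s powr - \<mu> \<and>
         \<bar>?h 1 2 (u s) / r s\<bar> \<le> C * r s powr - \<mu>" using b by blast
      define c where "c = C * r s powr - \<mu>"
      define x where "x = r' s"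
      define z where "z = \<bar>r s * \<phi>' s\<bar>"
      have c0: "0 \<le> c" using C by (simp add: c_def)
      have zx: "0 \<le> z" "z \<le> x" using cone by (auto simp: z_def x_def)
      have "\<bar>x\<^sup>2 * pd 2 (?h 1 1) (u s)\<bar> \<le> c * x\<^sup>2"
        using mult_left_mono[OF b(4), of "x\<^sup>2"] by (simp add: abs_mult c_def mult.commute)
      moreover have "\<bar>2 * x * \<phi>' s * pd 2 (?h 1 2) (u s)\<bar> \<le> 2 * c * x\<^sup>2"
      proof -
        have "\<bar>2 * x * \<phi>' s * pd 2 (?h 1 2) (u s)\<bar> = 2 * x * \<bar>\<phi>' s\<bar> * \<bar>pd 2 (?h 1 2) (u s)\<bar>"
          using zx by (simp add: abs_mult)
        also have "\<dots> \<le> 2 * x * \<bar>\<phi>' s\<bar> * (c * r s)"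
          using b(6) zx by (intro mult_left_mono) (auto simp: c_def)
        also have "\<dots> = 2 * c * x * z" using rs by (simp add: z_def abs_mult)
        also have "\<dots> \<le> 2 * c * x * x" using zx c0 by (intro mult_left_mono) auto
        finally show ?thesis by (simp add: power2_eq_square)
      qed
      moreover have "\<bar>(\<phi>' s)\<^sup>2 * pd 2 (?h 2 2) (u s)\<bar> \<le> c * x\<^sup>2"
      proof -
        have "\<bar>(\<phi>' s)\<^sup>2 * pd 2 (?h 2 2) (u s)\<bar> \<le> (\<phi>' s)\<^sup>2 * (c * ((r s)\<^sup>2 * \<sigma>\<^sup>2))"
          using mult_left_mono[OF b(5), of "(\<phi>' s)\<^sup>2"] by (simp add: abs_mult c_def)
        also have "\<dots> = c * z\<^sup>2 * \<sigma>\<^sup>2" by (simp add: z_def power_mult_distrib)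
        also have "\<dots> \<le> c * z\<^sup>2 * 1" using c0 \<sigma> by (intro mult_left_mono) (auto simp: power_le_one)
        also have "\<dots> \<le> c * x\<^sup>2 * 1" using c0 zx by (intro mult_right_mono mult_left_mono power_mono) auto
        finally show ?thesis by simp
      qed
      moreover have "2 * A' s = x\<^sup>2 * pd 2 (?h 1 1) (u s) + 2 * x * \<phi>' s * pd 2 (?h 1 2) (u s) + (\<phi>' s)\<^sup>2 * pd 2 (?h 2 2) (u s)"
        by (simp add: A'_def x_def)
      ultimately have "\<bar>2 * A' s\<bar> \<le> 4 * (c * x\<^sup>2)" by linarith
      then show "\<bar>A' s\<bar> \<le> 2 * C * r s powr - \<mu> * (r' s)\<^sup>2" by (simp add: c_def x_def)
    qed
  qed
  have strict: "\<bar>\<phi> t\<bar> < \<delta>" if "\<bar>\<phi> t - \<phi> t0\<bar> \<le> m1 / \<mu>" for t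
  proof -
    have "m1 / \<mu> \<le> K / \<mu>" using m1 \<mu> by (intro divide_right_mono) auto
    then show ?thesis using that \<delta> by linarith
  qed
  have "good 1"
  proof (rule interval_induction[of t0 1 good])
    show "t0 \<le> 1" "1 \<in> {t0..1}" using t0 by auto
    show "good t0"
    proof -
      \<comment> \<open>The initial velocity lies in the cone: the smallness of \<open>K\<close> already bounds the initial slope.\<close>
      have "m \<le> 1"
      proof -
        have "12 * m / \<sigma>\<^sup>2 \<le> m1" unfolding m1_def using C by (intro divide_right_mono) auto
        then have "12 * m / \<sigma>\<^sup>2 < 1" using m1 K by linarith
        then have "12 * m < \<sigma>\<^sup>2" using \<sigma> by (simp add: pos_divide_less_eq)
        moreover have "\<sigma>\<^sup>2 \<le> 1" using \<sigma> by (simp add: power_le_one)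
        ultimately show ?thesis by linarith
      qed
      then have "m * r' t0 \<le> 1 * r' t0" using out by (intro mult_right_mono) auto
      moreover have "\<bar>r t0 * \<phi>' t0\<bar> = r t0 * \<bar>\<phi>' t0\<bar>" by (simp add: abs_mult r_def)
      moreover have "\<bar>\<phi> t0\<bar> < \<delta>" using m1 \<mu> by (intro strict) simp
      ultimately show ?thesis using t0 m by (simp add: good_def)
    qed
  next
    fix t assume t: "t0 < t" "t \<le> 1" and g: "\<And>s. t0 \<le> s \<Longrightarrow> s < t \<Longrightarrow> good s"
    have tI: "t \<in> ?I" using t t0 by auto
    \<comment> \<open>The compact part of the sector: the lower bound on the abscissa replaces \<open>r \<ge> r(t0)\<close>, the upper bound on the radius holds as the parameter interval has length at most \<open>1\<close>.\<close>
    define Q where "Q = {z :: real^2. r t0 * cos \<delta> \<le> z $ 1 \<and> norm z \<le> r t0 + 2 * L \<and> \<bar>z $ 2\<bar> \<le> tan \<delta> * z $ 1}"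
    have cos\<delta>: "cos \<delta> > 0" using \<delta>0 \<delta> by (intro cos_gt_zero_pi) auto
    have rc: "r t0 * cos \<delta> > 0" using cos\<delta> t0 R by simp
    have Q0: "z $ 1 > 0" if "z \<in> Q" for z using that rc by (auto simp: Q_def)
    have Qsub: "Q \<subseteq> - {0}" using Q0 by force
    have cQ: "closed (cinv \<Phi> ` Q)"
    proof (intro compact_imp_closed compact_continuous_image)
      show "compact Q" unfolding Q_def by (rule compact_sector)
      show "continuous_on Q (cinv \<Phi>)"
        using hom Qsub continuous_on_subset unfolding homeomorphism_def by blast
    qed
    have in_Q: "\<gamma> s \<in> cinv \<Phi> ` Q" if s: "t0 \<le> s" "s < t" for s
    proof -
      have gs: "\<gamma> s \<in> cdom \<Phi>" "y s $ 1 > 0" "\<bar>\<phi> s\<bar> \<le> \<delta>" using g[OF s] by (auto simp: good_def)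
      have e: "r t0 \<le> r s" "r s \<le> r t0 + 2 * L * (s - t0)" using est[of s] g s t by auto
      have "2 * L * (s - t0) \<le> 2 * L * 1" using L s t t0 by (intro mult_left_mono) auto
      then have n: "norm (y s) \<le> r t0 + 2 * L" using e by (simp add: r_def)
      have "cos \<delta> \<le> cos \<bar>\<phi> s\<bar>" using gs \<delta>0 \<delta> by (intro cos_monotone_0_pi_le) auto
      then have "r t0 * cos \<delta> \<le> r s * cos (\<phi> s)" using e cos\<delta> rc t0 R by (intro mult_mono) auto
      then have "y s \<in> Q" unfolding Q_def
        using n gs cos_azimuth[OF gs(2)] abs_azimuth_le_iff[OF gs(2) \<delta>0 \<delta>(2)] by (simp add: r_def \<phi>_def)
      moreover have "\<gamma> s = cinv \<Phi> (y s)" using cinv_coord[OF ch gs(1)] by (simp add: y_def)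
      ultimately show ?thesis by blast
    qed
    have left: "at t within {t0..t} = at_left t" using t by (intro at_within_Icc_at_left)
    have sub: "{t0..t} \<subseteq> ?I" using t t0 by auto
    have ev: "\<forall>\<^sub>F s in at_left t. t0 \<le> s \<and> s < t"
      using eventually_at_left_real[OF t(1)] by (auto elim: eventually_mono)
    have "(\<gamma> \<longlongrightarrow> \<gamma> t) (at t within ?I)" using cont tI by (simp add: continuous_on)
    then have lim: "(\<gamma> \<longlongrightarrow> \<gamma> t) (at_left t)" unfolding left[symmetric] using sub by (rule tendsto_within_subset)
    have "\<gamma> t \<in> cinv \<Phi> ` Q"
      by (rule Lim_in_closed_set[OF cQ _ _ lim]) (use ev in_Q in \<open>auto elim: eventually_mono\<close>)
    then obtain z where z: "z \<in> Q" "\<gamma> t = cinv \<Phi> z" by blast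
    have zi: "z \<in> cimage \<Phi>" using z Qsub im by auto
    have \<gamma>t: "\<gamma> t \<in> cdom \<Phi>" and yt: "y t = z" using z cinv_in_cdom[OF ch zi] coord_cinv[OF ch zi] by (auto simp: y_def)
    have y1: "y t $ 1 > 0" using Q0 z yt by simp
    have "\<bar>\<phi> t\<bar> \<le> \<delta>" using abs_azimuth_le_iff[OF y1 \<delta>0 \<delta>(2)] z yt by (simp add: \<phi>_def Q_def)
    moreover have "0 \<le> r' t - \<bar>r t * \<phi>' t\<bar>"
    proof (rule tendsto_lowerbound)
      show "((\<lambda>s. r' s - \<bar>r s * \<phi>' s\<bar>) \<longlongrightarrow> r' t - \<bar>r t * \<phi>' t\<bar>) (at_left t)"
        unfolding left[symmetric]
        by (rule tendsto_within_subset[OF _ sub]) (use slope_c[OF tI \<gamma>t y1] in \<open>simp add: continuous_within\<close>)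
      show "\<forall>\<^sub>F s in at_left t. 0 \<le> r' s - \<bar>r s * \<phi>' s\<bar>"
        using ev by eventually_elim (use g in \<open>auto simp: good_def\<close>)
    qed simp
    ultimately show "good t" using \<gamma>t y1 by (simp add: good_def)
  next
    fix t assume t: "t0 \<le> t" "t < 1" and g: "\<And>s. t0 \<le> s \<Longrightarrow> s \<le> t \<Longrightarrow> good s"
    have tI: "t \<in> ?I" using t t0 by auto
    have gt: "\<gamma> t \<in> cdom \<Phi>" "y t $ 1 > 0" using g[of t] t by (auto simp: good_def)
    have e: "L / 2 \<le> r' t" "\<bar>r t * \<phi>' t\<bar> \<le> m1 * r' t" "\<bar>\<phi> t - \<phi> t0\<bar> \<le> m1 / \<mu>"
      using est[of t] g t by auto
    have "m1 * r' t < 1 * r' t" using e(1) L m1 K by (intro mult_strict_right_mono) auto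
    then have s1: "0 < r' t - \<bar>r t * \<phi>' t\<bar>" using e(2) by simp
    have s2: "\<bar>\<phi> t\<bar> < \<delta>" using strict e by blast
    have y0: "y t $ 1 \<noteq> 0" using gt by simp
    have c\<phi>: "continuous (at t within ?I) (\<lambda>s. \<bar>\<phi> s\<bar>)" unfolding \<phi>_def azimuth_def
      by (intro continuous_intros continuous_component yc tI gt y0)
    have cy: "continuous (at t within ?I) (\<lambda>s. y s $ 1)" by (intro continuous_component yc tI gt)
    have "\<forall>\<^sub>F s in at t within ?I. good s"
      using eventually_in_open[OF cont tI op gt(1)]
        order_tendstoD(1)[OF cy[unfolded continuous_within] gt(2)]
        order_tendstoD(2)[OF c\<phi>[unfolded continuous_within] s2]
        order_tendstoD(1)[OF slope_c[OF tI gt, unfolded continuous_within] s1]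
      by eventually_elim (auto simp: good_def)
    then obtain d where d: "d > 0" "\<And>s. s \<in> ?I \<Longrightarrow> s \<noteq> t \<Longrightarrow> dist s t < d \<Longrightarrow> good s"
      unfolding eventually_at by blast
    show "\<exists>d>0. \<forall>s. t < s \<and> s < t + d \<and> s \<le> 1 \<longrightarrow> good s"
      using d t t0 by (intro exI[of _ d]) (auto simp: dist_real_def)
  qed
  then show ?thesis by (simp add: good_def \<phi>_def)
qed

section \<open>Starting point on a graph close to the half-line\<close>

text \<open>An arc of the geodesic coincides with the graph, because the geodesic is a homeomorphism onto its
  image. The abscissa \<open>X = r cos (\<sigma> \<phi>)\<close> is not constant on this arc, so its derivative is nonzero at
  some time. At that time the velocity is a nonzero tangent vector of the graph, and the graph is
  nearly radial.\<close>

lemma graph_tangent_point: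
  fixes M :: "'a::t2_space rchart set" and \<Phi> :: "'a rchart" and \<gamma> :: "real \<Rightarrow> 'a" and f f' :: "real \<Rightarrow> real"
  defines "y \<equiv> coord \<Phi> \<circ> \<gamma>"
  defines "w \<equiv> vd {0..1} y"
  defines "r \<equiv> \<lambda>s. norm (y s)" and "\<phi> \<equiv> \<lambda>s. azimuth (y s)"
    and "r' \<equiv> \<lambda>s. (y s \<bullet> w s) / norm (y s)"
    and "\<phi>' \<equiv> \<lambda>s. (y s $ 1 * w s $ 2 - y s $ 2 * w s $ 1) / (norm (y s))\<^sup>2"
  assumes atlas: "riemannian_atlas (insert \<Phi> M)" and im: "cimage \<Phi> = - {0}"
    and geo: "geodesic_on M {0..1} \<gamma>" and inj: "inj_on \<gamma> {0..1}"
    and graph: "cartesian_graph \<Phi> \<alpha> {p..q} f \<subseteq> \<gamma> ` {0..1}"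
    and pq: "0 < p" "p < q" and f: "C1_real_on {p..q} f f'"
    and small: "\<And>x. x \<in> {p..q} \<Longrightarrow> \<bar>f x\<bar> \<le> c * x" "\<And>x. x \<in> {p..q} \<Longrightarrow> \<bar>f' x\<bar> \<le> c"
    and \<sigma>: "0 < sin \<alpha>" and c: "c \<le> 1/4" "c < sin \<alpha>"
  obtains t where "t \<in> {0..1}" "\<gamma> t \<in> cdom \<Phi>" "y t $ 1 > 0" "p \<le> r t" "\<bar>\<phi> t\<bar> \<le> c / sin \<alpha>"
    "r' t \<noteq> 0" "r t * \<bar>\<phi>' t\<bar> \<le> 8 * c / sin \<alpha> * \<bar>r' t\<bar>"
proof -
  let ?I = "{0..1::real}" and ?\<sigma> = "sin \<alpha>"
  have ch: "riemannian_chart \<Phi>" using atlas by (auto simp: riemannian_atlas_def)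
  have sym: "\<And>z. z \<noteq> 0 \<Longrightarrow> transpose (gram \<Phi> z) = gram \<Phi> z"
    and diff: "\<And>z. z \<noteq> 0 \<Longrightarrow> gram \<Phi> differentiable (at z)"
    and hom: "homeomorphism (cdom \<Phi>) (- {0}) (coord \<Phi>) (cinv \<Phi>)"
    using ch im smooth_on_differentiable[of "- {0}" "gram \<Phi>"] by (auto simp: riemannian_chart_def)
  have cont: "continuous_on ?I \<gamma>" using geo by (simp add: geodesic_on_def)
  have c0: "0 \<le> c" using small(2)[of p] pq abs_ge_zero order_trans by fastforce
  have fc: "continuous_on {p..q} f"
    using f unfolding C1_real_on_def by (auto intro: DERIV_continuous_on)
  define z where "z x = (vector [x, f x] :: real^2)" for x
  have z: "z x $ 1 = x" "z x $ 2 = f x" for x by (simp_all add: z_def)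
  have zc: "continuous_on {p..q} (\<lambda>x. norm (z x))" "continuous_on {p..q} (\<lambda>x. azimuth (z x))"
    unfolding norm_vec2 azimuth_def z using pq by (auto intro!: continuous_intros fc)
  have az: "\<bar>azimuth (z x)\<bar> \<le> c" if x: "x \<in> {p..q}" for x
  proof -
    have "\<bar>azimuth (z x)\<bar> \<le> \<bar>f x / x\<bar>" unfolding azimuth_def z by (rule abs_arctan_le)
    also have "\<dots> \<le> c" using small(1)[OF x] x pq by (simp add: abs_divide pos_divide_le_eq)
    finally show ?thesis .
  qed
  define g where "g x = polar (norm (z x)) (azimuth (z x) / ?\<sigma>)" for x
  have npos: "norm (z x) > 0" if "x \<in> {p..q}" for x using that pq z(1)[of x] by auto
  have small_angle: "\<bar>azimuth (z x) / ?\<sigma>\<bar> < pi / 2" and angle_le: "\<bar>azimuth (z x) / ?\<sigma>\<bar> \<le> c / ?\<sigma>" if x: "x \<in> {p..q}" for x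
  proof -
    show "\<bar>azimuth (z x) / ?\<sigma>\<bar> \<le> c / ?\<sigma>" using az[OF x] \<sigma> by (simp add: abs_divide divide_right_mono)
    also have "c / ?\<sigma> < 1" using c \<sigma> by simp
    also have "1 < pi / 2" using pi_gt3 by simp
    finally show "\<bar>azimuth (z x) / ?\<sigma>\<bar> < pi / 2" .
  qed
  have g: "norm (g x) = norm (z x)" "azimuth (g x) = azimuth (z x) / ?\<sigma>" "g x $ 1 > 0" "g x \<noteq> 0" if x: "x \<in> {p..q}" for x
  proof -
    show "norm (g x) = norm (z x)" unfolding g_def by (rule norm_polar) simp
    then show "g x \<noteq> 0" using npos[OF x] by auto
    show "azimuth (g x) = azimuth (z x) / ?\<sigma>" unfolding g_def by (rule azimuth_polar[OF npos[OF x] small_angle[OF x]])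
    have "- (pi / 2) < azimuth (z x) / ?\<sigma>" "azimuth (z x) / ?\<sigma> < pi / 2"
      using small_angle[OF x] unfolding abs_less_iff by linarith+
    then show "g x $ 1 > 0"
      unfolding g_def polar_nth by (intro mult_pos_pos npos[OF x] cos_gt_zero_pi)
  qed
  have gc: "continuous_on {p..q} g"
  proof -
    have "polar s \<psi> = (s * cos \<psi>) *\<^sub>R axis 1 1 + (s * sin \<psi>) *\<^sub>R axis 2 1" for s \<psi>
      by (subst vec2_eq_axis) simp
    then show ?thesis unfolding g_def using \<sigma> by (simp only:) (intro continuous_intros zc, auto)
  qed
  define b where "b x = cinv \<Phi> (g x)" for x
  have b: "b x \<in> cdom \<Phi>" "coord \<Phi> (b x) = g x" if x: "x \<in> {p..q}" for x
    using g(4)[OF x] im cinv_in_cdom[OF ch, of "g x"] coord_cinv[OF ch, of "g x"] by (auto simp: b_def)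
  have b\<gamma>: "b x \<in> \<gamma> ` ?I" if x: "x \<in> {p..q}" for x
  proof -
    \<comment> \<open>This keeps the points of the graph inside the wedge \<open>|\<theta>| < \<pi> sin \<alpha>\<close>, where the Cartesian coordinates live.\<close>
    have "c < pi * ?\<sigma>"
    proof -
      have "1 * ?\<sigma> \<le> pi * ?\<sigma>" using \<sigma> pi_gt3 by (intro mult_right_mono) auto
      then show ?thesis using c by simp
    qed
    then have "norm (z x) > 0 \<and> \<bar>azimuth (z x)\<bar> < pi * ?\<sigma> \<and>
        coord \<Phi> (b x) = polar (norm (z x)) (azimuth (z x) / ?\<sigma>) \<and>
        norm (z x) * cos (azimuth (z x)) \<in> {p..q} \<and>
        norm (z x) * sin (azimuth (z x)) = f (norm (z x) * cos (azimuth (z x)))"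
      using b[OF x] npos[OF x] az[OF x] x pq cos_azimuth[of "z x"] sin_azimuth[of "z x"]
      by (auto simp: g_def z)
    then have "b x \<in> cartesian_graph \<Phi> \<alpha> {p..q} f"
      unfolding cartesian_graph_def using b(1)[OF x] by blast
    then show ?thesis using graph by blast
  qed
  have bc: "continuous_on {p..q} b"
    unfolding b_def
  proof (rule continuous_on_compose2[OF _ gc])
    show "continuous_on (- {0}) (cinv \<Phi>)" using hom by (simp add: homeomorphism_def)
    show "g ` {p..q} \<subseteq> - {0}" using g(4) by auto
  qed
  define \<tau> where "\<tau> x = the_inv_into ?I \<gamma> (b x)" for x
  have \<tau>: "\<tau> x \<in> ?I" "\<gamma> (\<tau> x) = b x" if x: "x \<in> {p..q}" for x
    unfolding \<tau>_def using b\<gamma>[OF x] the_inv_into_into[OF inj _ subset_refl] f_the_inv_into_f[OF inj] by blast+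
  have \<tau>c: "continuous_on {p..q} \<tau>"
    unfolding \<tau>_def
    by (rule continuous_on_compose2[OF continuous_on_inv_into[OF cont compact_Icc inj] bc]) (use b\<gamma> in auto)
  have conn: "connected (\<tau> ` {p..q})" by (rule connected_continuous_image[OF \<tau>c connected_Icc])
  define X where "X t = r t * cos (?\<sigma> * \<phi> t)" for t
  have X: "X (\<tau> x) = x" and Y: "r (\<tau> x) * sin (?\<sigma> * \<phi> (\<tau> x)) = f x" and r\<tau>: "r (\<tau> x) = norm (z x)"
    and \<phi>\<tau>: "\<phi> (\<tau> x) = azimuth (z x) / ?\<sigma>" and y1: "y (\<tau> x) $ 1 > 0" and cd: "\<gamma> (\<tau> x) \<in> cdom \<Phi>"
    if x: "x \<in> {p..q}" for x
  proof -
    have y: "y (\<tau> x) = g x" using \<tau>[OF x] b[OF x] by (simp add: y_def)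
    show r: "r (\<tau> x) = norm (z x)" and p: "\<phi> (\<tau> x) = azimuth (z x) / ?\<sigma>" and "y (\<tau> x) $ 1 > 0"
      using g[OF x] by (simp_all add: r_def \<phi>_def y)
    show "\<gamma> (\<tau> x) \<in> cdom \<Phi>" using \<tau>[OF x] b[OF x] by simp
    have "?\<sigma> * \<phi> (\<tau> x) = azimuth (z x)" using p \<sigma> by simp
    then show "X (\<tau> x) = x" "r (\<tau> x) * sin (?\<sigma> * \<phi> (\<tau> x)) = f x"
      using r cos_azimuth[of "z x"] sin_azimuth[of "z x"] x pq by (simp_all add: X_def z)
  qed
  \<comment> \<open>The preimage of the graph in the parameter interval is connected, so it contains \<open>[lo, hi]\<close>.\<close>
  define lo where "lo = min (\<tau> p) (\<tau> q)"
  define hi where "hi = max (\<tau> p) (\<tau> q)"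
  have "\<tau> p \<noteq> \<tau> q" using X[of p] X[of q] pq by auto
  then have lohi: "lo < hi" by (auto simp: lo_def hi_def)
  have onto: "\<exists>x\<in>{p..q}. t = \<tau> x" if "t \<in> {lo..hi}" for t
  proof -
    have "lo \<in> \<tau> ` {p..q}" "hi \<in> \<tau> ` {p..q}" using pq by (auto simp: lo_def hi_def min_def max_def)
    then show ?thesis using connected_contains_Icc[OF conn] that by blast
  qed
  have subI: "{lo..hi} \<subseteq> ?I" using onto \<tau> by blast
  have rd: "(r has_real_derivative r' t) (at t within {lo..hi})"
   and \<phi>d: "(\<phi> has_real_derivative \<phi>' t) (at t within {lo..hi})" if t: "t \<in> {lo..hi}" for t
  proof -
    have tI: "t \<in> ?I" and tc: "\<gamma> t \<in> cdom \<Phi>" "y t $ 1 > 0" using onto[OF t] \<tau>(1) cd y1 by auto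
    note G = geodesic_in_compatible_chart[OF atlas geo tI tc(1), folded y_def, folded w_def]
    note EP = euler_lagrange_polar[OF G(3) tI sym diff G(1) tc(2)]
    show "(r has_real_derivative r' t) (at t within {lo..hi})" "(\<phi> has_real_derivative \<phi>' t) (at t within {lo..hi})"
      using DERIV_subset[OF EP(1) subI] DERIV_subset[OF EP(2) subI] unfolding r_def \<phi>_def r'_def \<phi>'_def by blast+
  qed
  define X' where "X' t = r' t * cos (?\<sigma> * \<phi> t) - r t * (?\<sigma> * \<phi>' t) * sin (?\<sigma> * \<phi> t)" for t
  define Y' where "Y' t = r' t * sin (?\<sigma> * \<phi> t) + r t * (?\<sigma> * \<phi>' t) * cos (?\<sigma> * \<phi> t)" for t
  have Xd: "(X has_real_derivative X' t) (at t within {lo..hi})"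
    and Yd: "((\<lambda>t. r t * sin (?\<sigma> * \<phi> t)) has_real_derivative Y' t) (at t within {lo..hi})"
    if t: "t \<in> {lo..hi}" for t
    unfolding X_def[abs_def] X'_def Y'_def
    by (rule derivative_eq_intros rd[OF t] \<phi>d[OF t] refl | simp)+
  have "\<exists>t\<in>{lo..hi}. X' t \<noteq> 0"
  proof (rule ccontr)
    assume "\<not> (\<exists>t\<in>{lo..hi}. X' t \<noteq> 0)"
    then have "\<bar>X hi - X lo\<bar> \<le> (0::real) - 0"
      using lohi Xd by (intro difference_bound[where f = X and f' = X' and g = "\<lambda>_. 0" and g' = "\<lambda>_. 0"]) auto
    then have "X (\<tau> p) = X (\<tau> q)" unfolding lo_def hi_def by (auto simp: min_def max_def split: if_splits)
    then show False using X[of p] X[of q] pq by auto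
  qed
  then obtain t where t: "t \<in> {lo..hi}" "X' t \<noteq> 0" by blast
  obtain x where x: "x \<in> {p..q}" "t = \<tau> x" using onto[OF t(1)] by blast
  have Xt: "X t = x" using X x by simp
  have "((\<lambda>s. f (X s)) has_real_derivative f' x * X' t) (at t within {lo..hi})"
  proof -
    have "(f has_real_derivative f' x) (at x within {p..q})" using f x by (simp add: C1_real_on_def)
    moreover have "X ` {lo..hi} \<subseteq> {p..q}" using onto X by force
    ultimately have "(f has_real_derivative f' x) (at (X t) within X ` {lo..hi})"
      unfolding Xt by (rule DERIV_subset)
    from DERIV_image_chain[OF this Xd[OF t(1)]] show ?thesis by (simp add: o_def)
  qed
  then have "((\<lambda>t. r t * sin (?\<sigma> * \<phi> t)) has_derivative (*) (f' x * X' t)) (at t within {lo..hi})"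
    unfolding has_field_derivative_def
    by (rule has_derivative_transform[OF t(1), rotated]) (use onto X Y in force)
  then have "((\<lambda>t. r t * sin (?\<sigma> * \<phi> t)) has_real_derivative f' x * X' t) (at t within {lo..hi})"
    by (simp add: has_field_derivative_def)
  then have Y'X': "Y' t = f' x * X' t"
    using Yd[OF t(1)] lohi t(1) vector_derivative_unique_within_closed_interval[of lo hi t]
    by (simp add: has_real_derivative_iff_has_vector_derivative)
  define C where "C = cos (azimuth (z x))"
  define S where "S = sin (azimuth (z x))"
  have ang: "?\<sigma> * \<phi> t = azimuth (z x)" using \<phi>\<tau>[OF x(1)] x(2) \<sigma> by simp
  have S: "\<bar>S\<bar> \<le> c" unfolding S_def using abs_sin_x_le_abs_x[of "azimuth (z x)"] az[OF x(1)] by linarith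
  have C: "1/2 \<le> C" "C \<le> 1"
  proof -
    have Cp: "C > 0" unfolding C_def using abs_azimuth_less[of "z x"] by (intro cos_gt_zero_pi) auto
    have "S\<^sup>2 \<le> (1/2)\<^sup>2" using S c by (intro abs_le_square_iff[THEN iffD1]) auto
    moreover have "C\<^sup>2 = 1 - S\<^sup>2" unfolding C_def S_def by (simp add: cos_squared_eq)
    ultimately have "(1/2)\<^sup>2 \<le> C\<^sup>2" by (simp add: power2_eq_square)
    then show "1/2 \<le> C" by (rule power2_le_imp_le) (use Cp in simp)
    show "C \<le> 1" by (simp add: C_def)
  qed
  have SC: "S * S + C * C = 1" unfolding S_def C_def by (metis power2_eq_square sin_cos_squared_add)
  have Xe: "X' t = r' t * C - r t * (?\<sigma> * \<phi>' t) * S" and Ye: "Y' t = r' t * S + r t * (?\<sigma> * \<phi>' t) * C"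
    by (simp_all add: X'_def Y'_def ang C_def S_def)
  have r'e: "r' t = X' t * C + Y' t * S"
  proof -
    have "X' t * C + Y' t * S = r' t * (S * S + C * C)" unfolding Xe Ye by (simp add: algebra_simps)
    then show ?thesis by (simp add: SC)
  qed
  have \<phi>'e: "r t * (?\<sigma> * \<phi>' t) = Y' t * C - X' t * S"
  proof -
    have "Y' t * C - X' t * S = r t * (?\<sigma> * \<phi>' t) * (S * S + C * C)" unfolding Xe Ye by (simp add: algebra_simps)
    then show ?thesis by (simp add: SC)
  qed
  have Yb: "\<bar>Y' t\<bar> \<le> c * \<bar>X' t\<bar>" unfolding Y'X' using small(2)[OF x(1)] by (simp add: abs_mult mult_right_mono)
  have XS: "\<bar>X' t * S\<bar> \<le> c * \<bar>X' t\<bar>" using mult_right_mono[OF S, of "\<bar>X' t\<bar>"] by (simp add: abs_mult mult.commute)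
  have YC: "\<bar>Y' t * C\<bar> \<le> c * \<bar>X' t\<bar>"
  proof -
    have "\<bar>Y' t * C\<bar> \<le> \<bar>Y' t\<bar> * 1" using C by (simp add: abs_mult mult_left_le)
    then show ?thesis using Yb by simp
  qed
  have YS: "\<bar>Y' t * S\<bar> \<le> \<bar>X' t\<bar> / 4"
  proof -
    have "\<bar>Y' t\<bar> * \<bar>S\<bar> \<le> \<bar>Y' t\<bar> * 1" using S c by (intro mult_left_mono) auto
    moreover have "c * \<bar>X' t\<bar> \<le> 1/4 * \<bar>X' t\<bar>" using c by (intro mult_right_mono) auto
    ultimately show ?thesis using Yb by (simp add: abs_mult)
  qed
  have XC: "\<bar>X' t\<bar> / 2 \<le> \<bar>X' t * C\<bar>"
    using mult_left_mono[OF C(1), of "\<bar>X' t\<bar>"] C by (simp add: abs_mult)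
  have r'b: "\<bar>X' t\<bar> / 4 \<le> \<bar>r' t\<bar>" unfolding r'e using XC YS by linarith
  have "\<bar>r t * (?\<sigma> * \<phi>' t)\<bar> \<le> 2 * c * \<bar>X' t\<bar>" unfolding \<phi>'e using XS YC by linarith
  also have "\<dots> \<le> 2 * c * (4 * \<bar>r' t\<bar>)" using r'b c0 by (intro mult_left_mono) auto
  finally have "?\<sigma> * (r t * \<bar>\<phi>' t\<bar>) \<le> 8 * c * \<bar>r' t\<bar>" using \<sigma> by (simp add: abs_mult r_def algebra_simps)
  then have m: "r t * \<bar>\<phi>' t\<bar> \<le> 8 * c / ?\<sigma> * \<bar>r' t\<bar>" using \<sigma> by (simp add: field_simps)
  show ?thesis
  proof (rule that[of t])
    show "t \<in> ?I" using t subI by blast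
    show "\<gamma> t \<in> cdom \<Phi>" "y t $ 1 > 0" using cd y1 x by auto
    have "x \<le> norm (z x)" using component_le_norm_cart[of "z x" 1] z(1)[of x] x pq by simp
    then show "p \<le> r t" using r\<tau> x by simp
    show "\<bar>\<phi> t\<bar> \<le> c / ?\<sigma>" using \<phi>\<tau>[OF x(1)] angle_le[OF x(1)] x(2) by simp
    show "r' t \<noteq> 0" using r'b t by auto
    show "r t * \<bar>\<phi>' t\<bar> \<le> 8 * c / ?\<sigma> * \<bar>r' t\<bar>" by (rule m)
  qed
qed

lemma azimuth_polar_right_half_plane:
  assumes "r > 0" "\<bar>\<psi>\<bar> < pi" "polar r \<psi> $ 1 > 0"
  shows "azimuth (polar r \<psi>) = \<psi>"
proof (rule azimuth_polar[OF assms(1)])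
  have "cos \<bar>\<psi>\<bar> > 0" using assms by (simp add: zero_less_mult_iff)
  then show "\<bar>\<psi>\<bar> < pi / 2"
    using cos_monotone_0_pi_le[of "pi / 2" "\<bar>\<psi>\<bar>"] assms(2) by (force simp: not_less[symmetric])
qed

section \<open>Endpoints of nearly radial geodesics\<close>

text \<open>If the radius decreases at the time \<open>t\<close>, the geodesic is run backwards; one of the two endpoints
  of the parameter interval is then reached from \<open>t\<close> by moving outward.\<close>

lemma near_radial_geodesic_leaves_through_sector:
  fixes M :: "'a::t2_space rchart set" and \<Phi> :: "'a rchart" and \<gamma> :: "real \<Rightarrow> 'a"
  defines "y \<equiv> coord \<Phi> \<circ> \<gamma>"
  defines "w \<equiv> vd {0..1} y"
  defines "r' \<equiv> \<lambda>s. (y s \<bullet> w s) / norm (y s)"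
    and "\<phi>' \<equiv> \<lambda>s. (y s $ 1 * w s $ 2 - y s $ 2 * w s $ 1) / (norm (y s))\<^sup>2"
  assumes atlas: "riemannian_atlas (insert \<Phi> M)" and im: "cimage \<Phi> = - {0}"
    and cb: "conical_bounds (gram \<Phi>) \<sigma> \<mu> C R"
    and geo: "geodesic_on M {0..1} \<gamma>"
    and t: "t \<in> {0..1}" "\<gamma> t \<in> cdom \<Phi>" "y t $ 1 > 0" "R \<le> norm (y t)"
    and r': "r' t \<noteq> 0" and m: "norm (y t) * \<bar>\<phi>' t\<bar> \<le> m * \<bar>r' t\<bar>"
    and K: "4 * (12 * C * norm (y t) powr - \<mu> + 3 * m) / \<sigma>\<^sup>2 \<le> K" "K < 1"
    and \<delta>: "\<bar>azimuth (y t)\<bar> + K / \<mu> < \<delta>" "\<delta> < pi / 2"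
  shows "\<exists>e\<in>{0, 1}. \<gamma> e \<in> cdom \<Phi> \<and> y e $ 1 > 0 \<and> \<bar>azimuth (y e)\<bar> \<le> \<delta>"
proof (cases "r' t > 0")
  case True
  then have m': "norm (y t) * \<bar>\<phi>' t\<bar> \<le> m * r' t" using m by simp
  have "\<gamma> 1 \<in> cdom \<Phi> \<and> y 1 $ 1 > 0 \<and> \<bar>azimuth (y 1)\<bar> \<le> \<delta>"
    by (rule near_radial_geodesic_stays_in_sector[OF atlas im cb geo t(1,2), of m K \<delta>, folded y_def, folded w_def,
          OF t(3,4) True[unfolded r'_def] m'[unfolded r'_def \<phi>'_def] K \<delta>])
  then show ?thesis by blast
next
  case False
  define \<eta> where "\<eta> = (\<lambda>s. \<gamma> (1 - s))"
  define y1 where "y1 = coord \<Phi> \<circ> \<eta>"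
  define w1 where "w1 = vd {0..1} y1"
  have geo1: "geodesic_on M {0..1} \<eta>" unfolding \<eta>_def
    using atlas geo by (intro geodesic_on_reverse) (auto simp: riemannian_atlas_def riemannian_chart_def)
  have t1: "1 - t \<in> {0..1}" "\<eta> (1 - t) \<in> cdom \<Phi>" using t by (auto simp: \<eta>_def)
  have y1: "y1 s = y (1 - s)" for s by (simp add: y1_def \<eta>_def y_def)
  have w1: "w1 (1 - t) = - w t"
    unfolding w1_def
  proof (rule vd_eqI[OF _ t1(1)])
    have d: "(y has_vector_derivative w t) (at t within {0..1})"
      using geodesic_in_compatible_chart(1)[OF atlas geo t(1,2)] by (simp add: y_def w_def)
    have img: "(\<lambda>t. 1 - t) ` {0..1::real} = {0..1}" by (auto simp: image_iff intro: bexI[of _ "1 - _"])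
    have "((\<lambda>s. 1 - s) has_vector_derivative -1) (at (1 - t) within {0..1::real})"
      by (auto intro!: derivative_eq_intros simp: has_vector_derivative_def)
    from vector_diff_chain_within[OF this, of y "w t"] d
    show "(y1 has_vector_derivative - w t) (at (1 - t) within {0..1})"
      by (simp add: img o_def y1[abs_def])
  qed
  have out: "(y1 (1 - t) \<bullet> w1 (1 - t)) / norm (y1 (1 - t)) = - r' t"
    by (simp add: y1 w1 r'_def)
  have ang: "(y1 (1 - t) $ 1 * w1 (1 - t) $ 2 - y1 (1 - t) $ 2 * w1 (1 - t) $ 1) / (norm (y1 (1 - t)))\<^sup>2 = - \<phi>' t"
    by (simp add: y1 w1 \<phi>'_def minus_divide_left)
  have "\<eta> 1 \<in> cdom \<Phi> \<and> y1 1 $ 1 > 0 \<and> \<bar>azimuth (y1 1)\<bar> \<le> \<delta>"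
    by (rule near_radial_geodesic_stays_in_sector[OF atlas im cb geo1 t1, of m K \<delta>, folded y1_def, folded w1_def,
          unfolded out ang])
       (use t m K \<delta> r' False in \<open>simp_all add: y1\<close>)
  then show ?thesis by (auto simp: \<eta>_def y1)
qed

text \<open>The graph of \<open>f\<^sub>k\<close> has slope at most \<open>c k = 2 / k\<close> with respect to the half-line, in the sense of
  \<open>graph_tangent_point\<close>, so that \<open>K k\<close> bounds the constant of \<open>near_radial_estimate\<close>. Both
  tend to \<open>0\<close>. For large \<open>k\<close> an endpoint of \<open>\<Gamma>\<^sub>k\<close> would have a polar angle in \<open>[-\<delta>, \<delta>]\<close>, but \<open>\<delta>\<close> is
  chosen smaller than \<open>\<psi>\<close> and \<open>\<pi> - \<psi>\<close>.\<close>

theorem proposition25: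
  fixes M :: "'a::{second_countable_topology, t2_space} rchart set"
    and \<Phi> :: "'a rchart"
    and \<gamma>1 \<gamma>2 :: "real \<Rightarrow> real \<Rightarrow> real \<Rightarrow> 'a"
    and \<gamma> :: "real \<Rightarrow> 'a"
    and \<alpha> \<mu> rbar \<theta> :: real
  assumes "asymptotically_conical M \<Phi> \<alpha> \<mu>"
    and "nonneg_scalar_curvature M"
    and "\<alpha> < pi / 2"
    and "plateau_family M \<Phi> \<alpha> rbar \<gamma>1 \<gamma>2"
    and "properly_embedded_geodesic_ray M \<gamma>"
    and "asymptotic_to_half_line \<Phi> \<alpha> \<mu> \<gamma>"
    and "0 < \<theta>" and "\<theta> < pi * sin \<alpha>"
  shows "\<not> (\<exists>(\<rho> :: nat \<Rightarrow> real) (\<rho>' :: nat \<Rightarrow> real) (\<Gamma> :: nat \<Rightarrow> 'a set)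
             (f :: nat \<Rightarrow> real \<Rightarrow> real) (f' :: nat \<Rightarrow> real \<Rightarrow> real).
     filterlim \<rho> at_top sequentially \<and> filterlim \<rho>' at_top sequentially \<and>
     (\<forall>k\<ge>1.
        0 < \<rho>' k \<and> \<rho>' k < \<rho> k \<and>
        minmax_plateau_solution M \<Phi> rbar \<gamma>1 \<gamma>2 (\<rho> k) ((\<theta> - pi * sin \<alpha>) / sin \<alpha>) (\<Gamma> k) \<and>
        C1_real_on {\<rho>' k / 2..2 * \<rho>' k} (f k) (f' k) \<and>
        cartesian_graph \<Phi> \<alpha> {\<rho>' k / 2..2 * \<rho>' k} (f k) \<subseteq> \<Gamma> k \<and>
        (SUP r\<in>{\<rho>' k / 2..2 * \<rho>' k}. \<bar>f k r\<bar> + \<rho>' k * \<bar>f' k r\<bar>) < \<rho>' k / real k))"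
proof (rule notI, elim exE conjE)
  fix \<rho> \<rho>' :: "nat \<Rightarrow> real" and \<Gamma> :: "nat \<Rightarrow> 'a set" and f f' :: "nat \<Rightarrow> real \<Rightarrow> real"
  assume \<rho>'_top: "filterlim \<rho>' at_top sequentially"
    and all: "\<forall>k\<ge>1.
        0 < \<rho>' k \<and> \<rho>' k < \<rho> k \<and>
        minmax_plateau_solution M \<Phi> rbar \<gamma>1 \<gamma>2 (\<rho> k) ((\<theta> - pi * sin \<alpha>) / sin \<alpha>) (\<Gamma> k) \<and>
        C1_real_on {\<rho>' k / 2..2 * \<rho>' k} (f k) (f' k) \<and>
        cartesian_graph \<Phi> \<alpha> {\<rho>' k / 2..2 * \<rho>' k} (f k) \<subseteq> \<Gamma> k \<and>
        (SUP r\<in>{\<rho>' k / 2..2 * \<rho>' k}. \<bar>f k r\<bar> + \<rho>' k * \<bar>f' k r\<bar>) < \<rho>' k / real k"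
  let ?\<sigma> = "sin \<alpha>"
  have atlas: "riemannian_atlas (insert \<Phi> M)" and im: "cimage \<Phi> = - {0}" and \<alpha>: "0 < \<alpha>" "\<alpha> \<le> pi / 2"
    using assms(1) by (auto simp: asymptotically_conical_def)
  have ch: "riemannian_chart \<Phi>" using atlas by (auto simp: riemannian_atlas_def)
  have \<sigma>: "0 < ?\<sigma>" using \<alpha> by (intro sin_gt_zero) auto
  obtain \<nu> C R where cb: "conical_bounds (gram \<Phi>) ?\<sigma> \<nu> C R"
    using asymptotically_conical_bounds[OF assms(1)] .
  have \<nu>: "0 < \<nu>" and C: "0 \<le> C" and R: "1 \<le> R" using cb by (auto simp: conical_bounds_def)
  define \<psi> where "\<psi> = \<theta> / ?\<sigma>"
  have \<psi>: "0 < \<psi>" "\<psi> < pi" using assms(7,8) \<sigma> by (auto simp: \<psi>_def pos_divide_less_eq)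
  \<comment> \<open>Half the minimum is at most \<open>\<pi> / 4\<close>; hence the sector also lies in the right half-plane.\<close>
  define \<delta> where "\<delta> = min \<psi> (pi - \<psi>) / 2"
  have \<delta>: "0 < \<delta>" "\<delta> < \<psi>" "\<delta> < pi - \<psi>" "\<delta> < pi / 2" using \<psi> by (auto simp: \<delta>_def min_def)
  define c where "c k = 2 / real k" for k
  define K where "K k = 4 * (12 * C * (\<rho>' k / 2) powr - \<nu> + 3 * (8 * c k / ?\<sigma>)) / ?\<sigma>\<^sup>2" for k
  have c_lim: "c \<longlonglongrightarrow> 0" unfolding c_def by (rule lim_const_over_n)
  have half_top: "filterlim (\<lambda>k. \<rho>' k / 2) at_top sequentially"
    using filterlim_tendsto_pos_mult_at_top[OF tendsto_const _ \<rho>'_top, of "1/2"] by simp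
  have K_lim: "K \<longlonglongrightarrow> 4 * (12 * C * 0 + 3 * (8 * 0 / ?\<sigma>)) / ?\<sigma>\<^sup>2" unfolding K_def
    using \<sigma> \<nu> by (intro tendsto_intros c_lim tendsto_neg_powr half_top) auto
  have s_lim: "(\<lambda>k. c k / ?\<sigma> + K k / \<nu>) \<longlonglongrightarrow> 0 / ?\<sigma> + (4 * (12 * C * 0 + 3 * (8 * 0 / ?\<sigma>)) / ?\<sigma>\<^sup>2) / \<nu>"
    using \<sigma> \<nu> by (intro tendsto_intros c_lim K_lim) auto
  have "\<forall>\<^sub>F k in sequentially. 1 \<le> k \<and> c k < 1/4 \<and> c k < ?\<sigma> \<and> R \<le> \<rho>' k / 2 \<and> K k < 1 \<and> c k / ?\<sigma> + K k / \<nu> < \<delta>"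
    using \<sigma> \<delta>(1) half_top unfolding filterlim_at_top
    by (intro eventually_conj eventually_ge_at_top order_tendstoD(2)[OF c_lim]
        order_tendstoD(2)[OF K_lim] order_tendstoD(2)[OF s_lim]) auto
  then obtain k where k: "1 \<le> k" "c k < 1/4" "c k < ?\<sigma>" "R \<le> \<rho>' k / 2" "K k < 1" "c k / ?\<sigma> + K k / \<nu> < \<delta>"
    unfolding eventually_sequentially by blast
  have \<rho>': "0 < \<rho>' k" "\<rho>' k < \<rho> k" and sol: "minmax_plateau_solution M \<Phi> rbar \<gamma>1 \<gamma>2 (\<rho> k) ((\<theta> - pi * ?\<sigma>) / ?\<sigma>) (\<Gamma> k)"
    and fk: "C1_real_on {\<rho>' k / 2..2 * \<rho>' k} (f k) (f' k)"
    and graph: "cartesian_graph \<Phi> \<alpha> {\<rho>' k / 2..2 * \<rho>' k} (f k) \<subseteq> \<Gamma> k"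
    and sup: "(SUP r\<in>{\<rho>' k / 2..2 * \<rho>' k}. \<bar>f k r\<bar> + \<rho>' k * \<bar>f' k r\<bar>) < \<rho>' k / real k"
    using all k(1) by auto
  have \<psi>': "(\<theta> - pi * ?\<sigma>) / ?\<sigma> = \<psi> - pi" using \<sigma> by (simp add: \<psi>_def diff_divide_distrib)
  obtain \<eta> where geo: "geodesic_on M {0..1} \<eta>" and inj: "inj_on \<eta> {0..1}" and \<Gamma>: "\<Gamma> k = \<eta> ` {0..1}"
    and ends: "\<eta> 0 = end_point \<Phi> (\<rho> k) (\<psi> - pi)" "\<eta> 1 = end_point \<Phi> (\<rho> k) \<psi>"
    using sol unfolding minmax_plateau_solution_def \<psi>' by auto
  have bound: "\<bar>f k x\<bar> + \<rho>' k * \<bar>f' k x\<bar> < \<rho>' k / real k" if x: "x \<in> {\<rho>' k / 2..2 * \<rho>' k}" for x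
  proof -
    have "continuous_on {\<rho>' k / 2..2 * \<rho>' k} (f k)" "continuous_on {\<rho>' k / 2..2 * \<rho>' k} (f' k)"
      using fk unfolding C1_real_on_def by (auto intro: DERIV_continuous_on)
    then have "compact ((\<lambda>x. \<bar>f k x\<bar> + \<rho>' k * \<bar>f' k x\<bar>) ` {\<rho>' k / 2..2 * \<rho>' k})"
      by (intro compact_continuous_image continuous_intros) auto
    then have "bdd_above ((\<lambda>x. \<bar>f k x\<bar> + \<rho>' k * \<bar>f' k x\<bar>) ` {\<rho>' k / 2..2 * \<rho>' k})"
      by (intro bounded_imp_bdd_above compact_imp_bounded)
    from cSUP_upper[OF x this] sup show ?thesis by linarith
  qed
  have fb: "\<bar>f k x\<bar> \<le> c k * x" if x: "x \<in> {\<rho>' k / 2..2 * \<rho>' k}" for x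
  proof -
    have "\<bar>f k x\<bar> \<le> \<rho>' k / real k" using bound[OF x] \<rho>' mult_nonneg_nonneg[of "\<rho>' k" "\<bar>f' k x\<bar>"] by linarith
    also have "\<dots> \<le> (2 * x) / real k" using x k by (intro divide_right_mono) auto
    finally show ?thesis by (simp add: c_def)
  qed
  have fb': "\<bar>f' k x\<bar> \<le> c k" if x: "x \<in> {\<rho>' k / 2..2 * \<rho>' k}" for x
  proof -
    have "\<rho>' k * \<bar>f' k x\<bar> \<le> \<rho>' k * (1 / real k)" using bound[OF x] by simp
    then have "\<bar>f' k x\<bar> \<le> 1 / real k" using \<rho>'(1) by (simp only: mult_le_cancel_left_pos)
    also have "\<dots> \<le> c k" by (simp add: c_def divide_right_mono)
    finally show ?thesis .
  qed
  obtain t where t: "t \<in> {0..1}" "\<eta> t \<in> cdom \<Phi>" "(coord \<Phi> \<circ> \<eta>) t $ 1 > 0" "\<rho>' k / 2 \<le> norm ((coord \<Phi> \<circ> \<eta>) t)"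
      "\<bar>azimuth ((coord \<Phi> \<circ> \<eta>) t)\<bar> \<le> c k / ?\<sigma>"
    and rt: "((coord \<Phi> \<circ> \<eta>) t \<bullet> vd {0..1} (coord \<Phi> \<circ> \<eta>) t) / norm ((coord \<Phi> \<circ> \<eta>) t) \<noteq> 0"
    and slope: "norm ((coord \<Phi> \<circ> \<eta>) t) * \<bar>((coord \<Phi> \<circ> \<eta>) t $ 1 * vd {0..1} (coord \<Phi> \<circ> \<eta>) t $ 2
         - (coord \<Phi> \<circ> \<eta>) t $ 2 * vd {0..1} (coord \<Phi> \<circ> \<eta>) t $ 1) / (norm ((coord \<Phi> \<circ> \<eta>) t))\<^sup>2\<bar>
       \<le> 8 * c k / ?\<sigma> * \<bar>((coord \<Phi> \<circ> \<eta>) t \<bullet> vd {0..1} (coord \<Phi> \<circ> \<eta>) t) / norm ((coord \<Phi> \<circ> \<eta>) t)\<bar>"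
    using graph_tangent_point[OF atlas im geo inj graph[unfolded \<Gamma>] _ _ fk fb fb' \<sigma>] k \<rho>' by auto
  have "(norm ((coord \<Phi> \<circ> \<eta>) t)) powr - \<nu> \<le> (\<rho>' k / 2) powr - \<nu>"
    using t(4) \<rho>' \<nu> by (intro powr_mono2') auto
  then have "12 * C * (norm ((coord \<Phi> \<circ> \<eta>) t)) powr - \<nu> \<le> 12 * C * (\<rho>' k / 2) powr - \<nu>"
    using C by (intro mult_left_mono) auto
  then have Kk: "4 * (12 * C * norm ((coord \<Phi> \<circ> \<eta>) t) powr - \<nu> + 3 * (8 * c k / ?\<sigma>)) / ?\<sigma>\<^sup>2 \<le> K k"
    unfolding K_def by (intro divide_right_mono) auto
  have "\<exists>e\<in>{0, 1}. \<eta> e \<in> cdom \<Phi> \<and> (coord \<Phi> \<circ> \<eta>) e $ 1 > 0 \<and> \<bar>azimuth ((coord \<Phi> \<circ> \<eta>) e)\<bar> \<le> \<delta>"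
    by (rule near_radial_geodesic_leaves_through_sector[OF atlas im cb geo t(1,2,3) _ rt slope Kk k(5) _ \<delta>(4)])
       (use t k in auto)
  moreover have "coord \<Phi> (end_point \<Phi> (\<rho> k) \<beta>) = polar (\<rho> k) \<beta>" for \<beta>
  proof -
    have "polar (\<rho> k) \<beta> \<noteq> 0" using norm_polar[of "\<rho> k" \<beta>] \<rho>' by auto
    then show ?thesis unfolding end_point_def using im by (intro coord_cinv[OF ch]) auto
  qed
  moreover have "\<bar>\<psi> - pi\<bar> < pi" "\<bar>\<psi>\<bar> < pi" "\<bar>\<psi> - pi\<bar> > \<delta>" "\<bar>\<psi>\<bar> > \<delta>" using \<psi> \<delta> by auto
  ultimately show False
    using azimuth_polar_right_half_plane[of "\<rho> k"] ends \<rho>' by auto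
qed

end
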